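(* The 2-DSP problem can be solved in weighted directed acyclic graphs (DAGs) in $O(m+n)$ time.
   Context: In the $k$-Disjoint Shortest Paths problem ($k$-DSP), the input is a graph $G$ with $n$ vertices, $m$ edges and positive edge weights, together with source vertices $s_1,\dots,s_k$ and target vertices $t_1,\dots,t_k$; the task is to decide whether there exist paths $P_1,\dots,P_k$ that are pairwise internally vertex-disjoint and such that each $P_i$ is a shortest $(s_i,t_i)$-path in $G$. 2-DSP is the case $k=2$. The computational model is the word-RAM with words of $O(\log n)$ bits; the algorithm in question is randomized and decides the problem correctly with high probability (it solves the decision version only). *)

theory Defs
  imports
    "HOL-Probability.Probability"
    "HOL-Library.Log_Nat"
    "Graph_Theory.Graph_Theory"
begin

section \<open>Disjoint shortest paths\<close>

definition (in wf_digraph) shortest_path :: "'b weight_fun \<Rightarrow> 'a \<Rightarrow> 'b awalk \<Rightarrow> 'a \<Rightarrow> bool" where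
  "shortest_path f u p v \<longleftrightarrow> apath u p v \<and> ereal (awalk_cost f p) = \<mu> f u v"

text \<open>Paths are given with their start vertex, since an empty arc list does not determine it.
  Two paths are internally disjoint if neither contains an inner vertex of the other; that is,
  a common vertex has to be an endpoint of both.\<close>

definition (in pre_digraph) internally_disjoint :: "'a \<Rightarrow> 'b awalk \<Rightarrow> 'a \<Rightarrow> 'b awalk \<Rightarrow> bool" where
  "internally_disjoint u p v q \<longleftrightarrow>
     set (inner_verts p) \<inter> set (awalk_verts v q) = {} \<and>
     set (inner_verts q) \<inter> set (awalk_verts u p) = {}"

text \<open>The problem $k$-DSP, where $k$ is the common length of the lists of sources and targets.\<close>

definition (in wf_digraph) disjoint_shortest_paths ::
    "'b weight_fun \<Rightarrow> 'a list \<Rightarrow> 'a list \<Rightarrow> bool" where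
  "disjoint_shortest_paths f ss ts \<longleftrightarrow>
     length ss = length ts \<and>
     (\<exists>ps. length ps = length ss \<and>
        (\<forall>i < length ss. shortest_path f (ss ! i) (ps ! i) (ts ! i)) \<and>
        (\<forall>i < length ss. \<forall>j < length ss. i \<noteq> j \<longrightarrow>
           internally_disjoint (ss ! i) (ps ! i) (ss ! j) (ps ! j)))"

definition weighted_dag :: "'a pair_pre_digraph \<Rightarrow> ('a \<times> 'a \<Rightarrow> nat) \<Rightarrow> bool" where
  "weighted_dag G wt \<longleftrightarrow>
     pair_digraph G \<and> (\<nexists>p. pre_digraph.cycle (with_proj G) p) \<and> (\<forall>e \<in> parcs G. wt e > 0)"


section \<open>Randomized word-RAM\<close>

text \<open>A machine with words of \<open>w\<close> bits. Programs are finite instruction lists, so that they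
  mention only finitely many registers; the memory is addressed by words. Words are represented
  as natural numbers below \<open>2 ^ w\<close>.\<close>

datatype binop = Add | Sub | Mul | Div | Mod | And | Or | Xor | Shl | Shr | Less | Eq

datatype instr =
    Const nat nat            \<comment> \<open>\<open>Const d k\<close>: \<open>R[d] := k\<close>\<close>
  | Op binop nat nat nat     \<comment> \<open>\<open>Op f d a b\<close>: \<open>R[d] := f R[a] R[b]\<close>\<close>
  | Load nat nat             \<comment> \<open>\<open>Load d a\<close>: \<open>R[d] := M[R[a]]\<close>\<close>
  | Store nat nat            \<comment> \<open>\<open>Store a b\<close>: \<open>M[R[a]] := R[b]\<close>\<close>
  | Rand nat                 \<comment> \<open>\<open>Rand d\<close>: \<open>R[d] :=\<close> uniformly random word\<close>
  | Jump nat                 \<comment> \<open>\<open>Jump l\<close>: go to line \<open>l\<close>\<close>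
  | JumpZ nat nat            \<comment> \<open>\<open>JumpZ a l\<close>: go to line \<open>l\<close> if \<open>R[a] = 0\<close>\<close>

datatype config = Config (pc: nat) (reg: "nat \<Rightarrow> nat") (mem: "nat \<Rightarrow> nat")

text \<open>Arithmetic is modulo \<open>2 ^ w\<close>; \<open>x div 0 = 0\<close> and \<open>x mod 0 = x\<close>.\<close>

fun eval_binop :: "nat \<Rightarrow> binop \<Rightarrow> nat \<Rightarrow> nat \<Rightarrow> nat" where
  "eval_binop w Add x y = take_bit w (x + y)"
| "eval_binop w Sub x y = take_bit w (2 ^ w + x - y)"
| "eval_binop w Mul x y = take_bit w (x * y)"
| "eval_binop w Div x y = take_bit w (x div y)"
| "eval_binop w Mod x y = take_bit w (x mod y)"
| "eval_binop w And x y = take_bit w (Bit_Operations.and x y)"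
| "eval_binop w Or x y = take_bit w (Bit_Operations.or x y)"
| "eval_binop w Xor x y = take_bit w (Bit_Operations.xor x y)"
| "eval_binop w Shl x y = take_bit w (push_bit y x)"
| "eval_binop w Shr x y = take_bit w (drop_bit y x)"
| "eval_binop w Less x y = take_bit w (of_bool (x < y))"
| "eval_binop w Eq x y = take_bit w (of_bool (x = y))"

fun exec_instr :: "nat \<Rightarrow> instr \<Rightarrow> config \<Rightarrow> config pmf" where
  "exec_instr w (Const d k) (Config l R M) =
     return_pmf (Config (Suc l) (R(d := take_bit w k)) M)"
| "exec_instr w (Op f d a b) (Config l R M) =
     return_pmf (Config (Suc l) (R(d := eval_binop w f (R a) (R b))) M)"
| "exec_instr w (Load d a) (Config l R M) =
     return_pmf (Config (Suc l) (R(d := M (R a))) M)"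
| "exec_instr w (Store a b) (Config l R M) =
     return_pmf (Config (Suc l) R (M(R a := R b)))"
| "exec_instr w (Rand d) (Config l R M) =
     map_pmf (\<lambda>x. Config (Suc l) (R(d := x)) M) (pmf_of_set {..<2 ^ w})"
| "exec_instr w (Jump l') (Config l R M) =
     return_pmf (Config l' R M)"
| "exec_instr w (JumpZ a l') (Config l R M) =
     return_pmf (Config (if R a = 0 then l' else Suc l) R M)"

text \<open>The machine halts when the program counter leaves the program.\<close>

definition halted :: "instr list \<Rightarrow> config \<Rightarrow> bool" where
  "halted P c \<longleftrightarrow> length P \<le> pc c"

definition step :: "nat \<Rightarrow> instr list \<Rightarrow> config \<Rightarrow> config pmf" where
  "step w P c = (if halted P c then return_pmf c else exec_instr w (P ! pc c) c)"

text \<open>The distribution of the configuration after \<open>T\<close> time steps, each instruction taking one.\<close>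

primrec run :: "nat \<Rightarrow> instr list \<Rightarrow> nat \<Rightarrow> config \<Rightarrow> config pmf" where
  "run w P 0 c = return_pmf c"
| "run w P (Suc T) c = bind_pmf (step w P c) (run w P T)"

text \<open>The input is placed at the start of the memory; all other cells and registers are zero.\<close>

definition initial :: "nat \<Rightarrow> nat list \<Rightarrow> config" where
  "initial w xs =
     Config 0 (\<lambda>_. 0) (\<lambda>a. if a < length xs then take_bit w (xs ! a) else 0)"

definition accepting :: "instr list \<Rightarrow> config \<Rightarrow> bool" where
  "accepting P c \<longleftrightarrow> halted P c \<and> reg c 0 \<noteq> 0"

definition rejecting :: "instr list \<Rightarrow> config \<Rightarrow> bool" where
  "rejecting P c \<longleftrightarrow> halted P c \<and> reg c 0 = 0"


section \<open>Instances of 2-DSP as machine inputs\<close>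

text \<open>The graph is presented as an edge list \<open>es\<close>, in arbitrary order.\<close>

definition encode_2dsp ::
    "nat \<Rightarrow> (nat \<times> nat) list \<Rightarrow> (nat \<times> nat \<Rightarrow> nat) \<Rightarrow> nat \<Rightarrow> nat \<Rightarrow> nat \<Rightarrow> nat \<Rightarrow> nat list" where
  "encode_2dsp n es wt s1 t1 s2 t2 =
     [n, length es, s1, t1, s2, t2] @ concat (map (\<lambda>e. [fst e, snd e, wt e]) es)"

text \<open>The bound on the weights expresses that each of them has \<open>O(log n)\<close> bits;
  \<open>floorlog 2 n\<close> is the length of the binary representation of \<open>n\<close>.\<close>

definition dag_instance_2dsp ::
    "nat \<Rightarrow> nat pair_pre_digraph \<Rightarrow> (nat \<times> nat) list \<Rightarrow> (nat \<times> nat \<Rightarrow> nat) \<Rightarrow>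
     nat \<Rightarrow> nat \<Rightarrow> nat \<Rightarrow> nat \<Rightarrow> bool" where
  "dag_instance_2dsp b G es wt s1 t1 s2 t2 \<longleftrightarrow>
     weighted_dag G wt \<and>
     pverts G = {..<card (pverts G)} \<and>
     {s1, t1, s2, t2} \<subseteq> pverts G \<and>
     distinct es \<and> set es = parcs G \<and>
     (\<forall>e \<in> parcs G. wt e < 2 ^ (b * floorlog 2 (card (pverts G))))"

end

theory Submission
  imports Defs "HOL-Library.Z2" "HOL-Computational_Algebra.Polynomial_Factorial"
    "HOL-Number_Theory.Residue_Primitive_Roots"
begin

text \<open>
  Call an edge tight for the source \<open>s\<^sub>i\<close> if it lies on a shortest path from \<open>s\<^sub>i\<close>, so that the
  shortest paths from \<open>s\<^sub>i\<close> are the paths of tight edges. Give every edge a variable (two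
  variables, one for each path, if it leaves a common source) and consider the sum, over all solutions,
  of the products of the variables of the edges used. Different solutions have different squarefree
  monomials, so this polynomial over the field with two elements vanishes only if there is no solution.

  It has a formula of linear size. From the product of the two sums over all paths one subtracts the
  pairs that meet, split at their first common vertex \<open>v\<close>. The pairs that end in \<open>v\<close> and do not meet
  before are again obtained by subtraction: if they meet before, the two paths between the last two
  common vertices are interchangeable, as both are shortest, so that in characteristic 2 all such pairs
  cancel except those where the two paths share the last edge into \<open>v\<close>.

  The formula is evaluated at random elements of \<open>GF(2)[z]/(z\<^sup>N + 1)\<close> with \<open>N = 3\<^sup>k = \<Theta>(log n)\<close>.
  As 2 is a primitive root modulo every power of 3, \<open>z\<^sup>N + 1\<close> has an irreducible factor of degree
  \<open>2 * N / 3\<close>, and a nonzero multilinear polynomial of degree at most \<open>2 * n\<close> vanishes modulo that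
  factor with probability at most \<open>2 * n / 2 ^ (2 * N / 3)\<close>. Elements fit into one word and are
  multiplied in constant time with a table of the products of all polynomials of degree below
  \<open>(log n) / 2\<close>.
\<close>

section \<open>The random words as a tape\<close>

text \<open>Two obstacles shape the construction. First, arithmetic must take constant time, and an
  irreducible polynomial of degree about log n would have to be found. The modulus
  \<open>z^N + 1\<close> needs no search and reduces by one shift; its zero divisors do no harm,
  because the error bound only asks for one prime factor of large degree. Second, solutions may
  cancel in characteristic 2: if both sources and both targets coincide, swapping the two paths of a
  solution keeps the product of the edge variables. This is why edges out of a common source carry a
  second variable; elsewhere disjointness determines which path uses an edge. Randomness is confined
  to the tape. For a fixed tape the machine is deterministic, so the program is verified by weakest
  preconditions for every tape, and probability enters only when the set of failing tapes is
  measured. The error is one-sided, as a nonzero value certifies a solution.\<close>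

fun tape_exec :: "nat \<Rightarrow> (nat \<Rightarrow> nat) \<Rightarrow> instr \<Rightarrow> config \<times> nat \<Rightarrow> config \<times> nat" where
  "tape_exec w \<omega> (Const d k) (Config l R M, j) = (Config (Suc l) (R(d := take_bit w k)) M, j)"
| "tape_exec w \<omega> (Op f d a b) (Config l R M, j) =
     (Config (Suc l) (R(d := eval_binop w f (R a) (R b))) M, j)"
| "tape_exec w \<omega> (Load d a) (Config l R M, j) = (Config (Suc l) (R(d := M (R a))) M, j)"
| "tape_exec w \<omega> (Store a b) (Config l R M, j) = (Config (Suc l) R (M(R a := R b)), j)"
| "tape_exec w \<omega> (Rand d) (Config l R M, j) = (Config (Suc l) (R(d := \<omega> j)) M, Suc j)"
| "tape_exec w \<omega> (Jump l') (Config l R M, j) = (Config l' R M, j)"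
| "tape_exec w \<omega> (JumpZ a l') (Config l R M, j) = (Config (if R a = 0 then l' else Suc l) R M, j)"

definition tape_step :: "nat \<Rightarrow> instr list \<Rightarrow> (nat \<Rightarrow> nat) \<Rightarrow> config \<times> nat \<Rightarrow> config \<times> nat" where
  "tape_step w P \<omega> x = (if halted P (fst x) then x else tape_exec w \<omega> (P ! pc (fst x)) x)"

abbreviation word_pmf :: "nat \<Rightarrow> nat pmf" where
  "word_pmf w \<equiv> pmf_of_set {..<2 ^ w}"

lemma tape_step_cong:
  assumes "\<And>i. j \<le> i \<Longrightarrow> \<omega> i = \<omega>' i"
  shows "tape_step w P \<omega> (c, j) = tape_step w P \<omega>' (c, j) \<and> j \<le> snd (tape_step w P \<omega> (c, j))"
  using assms by (cases c; cases "P ! pc c") (auto simp: tape_step_def)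

text \<open>Entries before the counter \<open>j\<close> are never read again, so an entry may be
  overwritten once it has been consumed.\<close>

lemma tape_steps_cong:
  assumes "\<And>i. j \<le> i \<Longrightarrow> \<omega> i = \<omega>' i"
  shows "(tape_step w P \<omega> ^^ T) (c, j) = (tape_step w P \<omega>' ^^ T) (c, j)"
  using assms
proof (induction T arbitrary: c j)
  case (Suc T)
  obtain c' j' where x: "tape_step w P \<omega> (c, j) = (c', j')" by fastforce
  have "j \<le> j'" and x': "tape_step w P \<omega>' (c, j) = (c', j')"
    using tape_step_cong[of j \<omega> \<omega>' w P c] Suc.prems x by auto
  then have "(tape_step w P \<omega> ^^ T) (c', j') = (tape_step w P \<omega>' ^^ T) (c', j')"
    by (intro Suc.IH) (use Suc.prems in auto)
  then show ?case by (simp add: funpow_swap1 x x')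
qed simp

text \<open>Lazy and eager sampling agree: a \<open>Rand\<close> step reads the entry at the
  counter, and the rest of the run depends only on later entries, which are independent of it. A run
  of \<open>T\<close> steps reads at most \<open>T\<close> entries, whence
  \<open>j + T \<le> L\<close>.\<close>

lemma run_eq_tape:
  assumes "j + T \<le> L"
  shows "run w P T c =
    map_pmf (\<lambda>\<omega>. fst ((tape_step w P \<omega> ^^ T) (c, j))) (Pi_pmf {j..<L} 0 (\<lambda>_. word_pmf w))"
  using assms
proof (induction T arbitrary: c j)
  case 0
  show ?case by (simp add: map_pmf_const)
next
  case (Suc T)
  obtain l R M where c: "c = Config l R M" by (cases c)
  show ?case
  proof (cases "\<not> halted P c \<and> (\<exists>d. P ! l = Rand d)")
    case True
    then obtain d where d: "P ! l = Rand d" and nh: "\<not> halted P c" by auto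
    have ins: "{j..<L} = insert j {Suc j..<L}" using Suc.prems by auto
    have "run w P (Suc T) c =
        bind_pmf (word_pmf w) (\<lambda>x. run w P T (Config (Suc l) (R(d := x)) M))"
      using nh d by (simp add: step_def c bind_map_pmf)
    also have "\<dots> = bind_pmf (word_pmf w) (\<lambda>x. map_pmf
        (\<lambda>f. fst ((tape_step w P f ^^ T) (Config (Suc l) (R(d := x)) M, Suc j)))
        (Pi_pmf {Suc j..<L} 0 (\<lambda>_. word_pmf w)))"
      using Suc.prems by (intro bind_pmf_cong refl Suc.IH) auto
    also have "\<dots> = bind_pmf (word_pmf w) (\<lambda>x. map_pmf
        (\<lambda>f. fst ((tape_step w P (f(j := x)) ^^ Suc T) (c, j)))
        (Pi_pmf {Suc j..<L} 0 (\<lambda>_. word_pmf w)))"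
    proof (intro bind_pmf_cong refl map_pmf_cong)
      fix x f
      have "(tape_step w P f ^^ T) (Config (Suc l) (R(d := x)) M, Suc j) =
            (tape_step w P (f(j := x)) ^^ T) (Config (Suc l) (R(d := x)) M, Suc j)"
        by (rule tape_steps_cong) auto
      then show "fst ((tape_step w P f ^^ T) (Config (Suc l) (R(d := x)) M, Suc j)) =
          fst ((tape_step w P (f(j := x)) ^^ Suc T) (c, j))"
        using nh d by (simp add: funpow_swap1 tape_step_def c)
    qed
    also have "\<dots> = map_pmf (\<lambda>\<omega>. fst ((tape_step w P \<omega> ^^ Suc T) (c, j)))
        (Pi_pmf {j..<L} 0 (\<lambda>_. word_pmf w))"
      unfolding ins
      by (subst Pi_pmf_insert) (auto simp: pair_pmf_def map_bind_pmf map_pmf_def bind_assoc_pmf bind_return_pmf)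
    finally show ?thesis .
  next
    case False
    \<comment> \<open>No word is read in this case, so any tape yields the same successor.\<close>
    define c' where "c' = fst (tape_step w P (\<lambda>_. 0) (c, j))"
    have 1: "tape_step w P \<omega> (c, j) = (c', j)" for \<omega>
      using False by (cases "P ! l") (auto simp: c'_def tape_step_def c)
    have 2: "step w P c = return_pmf c'"
      using False by (cases "P ! l") (auto simp: c'_def tape_step_def c step_def)
    show ?thesis using Suc.IH[of j c'] Suc.prems
      by (simp add: 2 bind_return_pmf funpow_swap1 1)
  qed
qed

section \<open>A structured language with named arrays\<close>

datatype expr = Cst nat | Var nat | Bin binop expr expr | Arr nat expr | Inp expr

datatype com =
    Assign nat expr
  | Put nat expr expr
  | Draw nat
  | Then com com (infixr \<open>;;\<close> 60)
  | Cond expr com com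
  | Loop expr com

text \<open>The program gets by with variables 0 to 27 and arrays 0 to 14. The value of
  \<open>narr\<close> returns as the factor 16 in the bounds on the word size.\<close>

abbreviation nvar :: nat where "nvar \<equiv> 64"
abbreviation narr :: nat where "narr \<equiv> 16"

fun bop :: "binop \<Rightarrow> nat \<Rightarrow> nat \<Rightarrow> nat" where
  "bop Add x y = x + y"
| "bop Sub x y = x - y"
| "bop Mul x y = x * y"
| "bop Div x y = x div y"
| "bop binop.Mod x y = x mod y"
| "bop And x y = Bit_Operations.and x y"
| "bop Or x y = Bit_Operations.or x y"
| "bop Xor x y = Bit_Operations.xor x y"
| "bop Shl x y = x * 2 ^ y"
| "bop Shr x y = x div 2 ^ y"
| "bop Less x y = of_bool (x < y)"
| "bop Eq x y = of_bool (x = y)"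

text \<open>Only these four operations can leave the range of words, subtraction by wrapping around.
  Under these conditions arithmetic modulo \<open>2 ^ w\<close> is that of the natural numbers, so
  programs can be verified without modular reasoning.\<close>

fun bop_ok :: "nat \<Rightarrow> binop \<Rightarrow> nat \<Rightarrow> nat \<Rightarrow> bool" where
  "bop_ok w Add x y \<longleftrightarrow> x + y < 2 ^ w"
| "bop_ok w Sub x y \<longleftrightarrow> y \<le> x"
| "bop_ok w Mul x y \<longleftrightarrow> x * y < 2 ^ w"
| "bop_ok w Shl x y \<longleftrightarrow> x * 2 ^ y < 2 ^ w"
| "bop_ok w _ x y \<longleftrightarrow> True"

lemma eval_binop_bop:
  assumes "bop_ok w f x y" "x < 2 ^ w" "y < 2 ^ w" "w > 0"
  shows "eval_binop w f x y = bop f x y \<and> bop f x y < 2 ^ w"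
proof (cases f)
  case Sub
  have "(2 ^ w + x - y) mod 2 ^ w = x - y" using assms Sub
    by (metis Nat.add_diff_assoc bop_ok.simps(2) less_imp_diff_less mod_add_self1 mod_less)
  then show ?thesis using assms Sub by (auto simp: take_bit_eq_mod)
next
  case And
  have "Bit_Operations.and x y < 2 ^ w"
    using assms by (metis take_bit_and take_bit_nat_eq_self_iff)
  then show ?thesis using And by (simp add: take_bit_nat_eq_self del: take_bit_and)
next
  case Or
  have "Bit_Operations.or x y < 2 ^ w"
    using assms by (metis take_bit_or take_bit_nat_eq_self_iff)
  then show ?thesis using Or by (simp add: take_bit_nat_eq_self del: take_bit_or)
next
  case Xor
  have "Bit_Operations.xor x y < 2 ^ w"
    using assms by (metis take_bit_xor take_bit_nat_eq_self_iff)
  then show ?thesis using Xor by (simp add: take_bit_nat_eq_self del: take_bit_xor)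
next
  case Div
  have "x div y < 2 ^ w" using assms by (meson div_le_dividend le_less_trans)
  then show ?thesis using Div by (simp add: take_bit_nat_eq_self_iff)
next
  case Shr
  have "x div 2 ^ y < 2 ^ w" using assms by (meson div_le_dividend le_less_trans)
  then show ?thesis using Shr by (simp add: take_bit_nat_eq_self_iff drop_bit_eq_div)
next
  case ("Mod")
  have "x mod y < 2 ^ w" using assms by (meson mod_less_eq_dividend le_less_trans)
  then show ?thesis using "Mod" by (simp add: take_bit_nat_eq_self_iff)
next
  case Less
  have "1 < (2::nat) ^ w" using assms(4) by (rule one_less_power[rotated]) simp
  then show ?thesis using Less by (auto simp: take_bit_nat_eq_self_iff)
next
  case Eq
  have "1 < (2::nat) ^ w" using assms(4) by (rule one_less_power[rotated]) simp
  then show ?thesis using Eq by (auto simp: take_bit_nat_eq_self_iff)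
qed (use assms in \<open>auto simp: take_bit_nat_eq_self_iff push_bit_eq_mult\<close>)

type_synonym env = "nat \<Rightarrow> nat"
type_synonym arrs = "nat \<Rightarrow> nat \<Rightarrow> nat"

fun wf_expr :: "expr \<Rightarrow> bool" where
  "wf_expr (Cst k) = True"
| "wf_expr (Var x) = (x < nvar)"
| "wf_expr (Bin f a b) = (wf_expr a \<and> wf_expr b)"
| "wf_expr (Arr k e) = (k < narr \<and> wf_expr e)"
| "wf_expr (Inp e) = wf_expr e"

fun wf_com :: "com \<Rightarrow> bool" where
  "wf_com (Assign x e) = (x < nvar \<and> wf_expr e)"
| "wf_com (Put k i e) = (k < narr \<and> wf_expr i \<and> wf_expr e)"
| "wf_com (Draw x) = (x < nvar)"
| "wf_com (c ;; d) = (wf_com c \<and> wf_com d)"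
| "wf_com (Cond e c d) = (wf_expr e \<and> wf_com c \<and> wf_com d)"
| "wf_com (Loop e c) = (wf_expr e \<and> wf_com c)"

fun vmods :: "com \<Rightarrow> nat set" where
  "vmods (Assign x e) = {x}"
| "vmods (Put k i e) = {}"
| "vmods (Draw x) = {x}"
| "vmods (c ;; d) = vmods c \<union> vmods d"
| "vmods (Cond e c d) = vmods c \<union> vmods d"
| "vmods (Loop e c) = vmods c"

fun amods :: "com \<Rightarrow> nat set" where
  "amods (Assign x e) = {}"
| "amods (Put k i e) = {k}"
| "amods (Draw x) = {}"
| "amods (c ;; d) = amods c \<union> amods d"
| "amods (Cond e c d) = amods c \<union> amods d"
| "amods (Loop e c) = amods c"

text \<open>Variable \<open>x\<close> lives in register \<open>x\<close>, entry \<open>i\<close> of array \<open>k\<close> in memory cell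
  \<open>base + narr * i + k\<close>, behind the input. Register \<open>nvar\<close> holds \<open>base\<close>, and the registers
  from \<open>tmp\<close> on are scratch space.\<close>

abbreviation tmp :: nat where "tmp \<equiv> Suc nvar"

definition addr_code :: "nat \<Rightarrow> nat \<Rightarrow> instr list" where
  "addr_code k d = [Const (Suc d) narr, Op Mul d d (Suc d), Const (Suc d) k, Op Add d d (Suc d),
     Op Add d d nvar]"

text \<open>The registers from \<open>d\<close> on serve as an expression stack: the value ends up
  in \<open>d\<close>, and everything below \<open>d\<close> survives. \<open>Or\<close> of a
  register with itself is a move.\<close>

fun cexpr :: "expr \<Rightarrow> nat \<Rightarrow> instr list" where
  "cexpr (Cst k) d = [Const d k]"
| "cexpr (Var x) d = [Op Or d x x]"
| "cexpr (Bin f a b) d = cexpr a d @ cexpr b (Suc d) @ [Op f d d (Suc d)]"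
| "cexpr (Arr k e) d = cexpr e d @ addr_code k d @ [Load d d]"
| "cexpr (Inp e) d = cexpr e d @ [Load d d]"

text \<open>Jumps are absolute, hence the parameter \<open>p\<close>, the address of the first
  instruction. Code for expressions contains no jumps and can be placed anywhere.\<close>

fun ccom :: "nat \<Rightarrow> com \<Rightarrow> instr list" where
  "ccom p (Assign x e) = cexpr e tmp @ [Op Or x tmp tmp]"
| "ccom p (Put k i e) = cexpr i tmp @ addr_code k tmp @ cexpr e (Suc tmp) @ [Store tmp (Suc tmp)]"
| "ccom p (Draw x) = [Rand x]"
| "ccom p (c ;; d) = (let C = ccom p c in C @ ccom (p + length C) d)"
| "ccom p (Cond e c d) =
     (let E = cexpr e tmp; C = ccom (Suc (p + length E)) c;
          q = p + length E + length C + 2; D = ccom q d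
      in E @ [JumpZ tmp q] @ C @ [Jump (q + length D)] @ D)"
| "ccom p (Loop e c) =
     (let E = cexpr e tmp; C = ccom (Suc (p + length E)) c
      in E @ [JumpZ tmp (p + length E + length C + 2)] @ C @ [Jump p])"

section \<open>Placement of code and execution of straight-line code\<close>

definition code_at :: "instr list \<Rightarrow> nat \<Rightarrow> instr list \<Rightarrow> bool" where
  "code_at P p C \<longleftrightarrow> (\<forall>i < length C. p + i < length P \<and> P ! (p + i) = C ! i)"

lemma code_at_append:
  "code_at P p (C @ D) \<longleftrightarrow> code_at P p C \<and> code_at P (p + length C) D"
  (is "?l \<longleftrightarrow> ?r")
proof
  assume l: ?l
  have "p + length C + i < length P \<and> P ! (p + length C + i) = D ! i" if "i < length D" for i
    using l[unfolded code_at_def, rule_format, of "length C + i"] that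
    by (simp add: nth_append add.assoc)
  moreover have "p + i < length P \<and> P ! (p + i) = C ! i" if "i < length C" for i
    using l[unfolded code_at_def, rule_format, of i] that by (simp add: nth_append)
  ultimately show ?r by (simp add: code_at_def)
next
  assume r: ?r
  show ?l unfolding code_at_def
  proof (intro allI impI)
    fix i assume i: "i < length (C @ D)"
    show "p + i < length P \<and> P ! (p + i) = (C @ D) ! i"
    proof (cases "i < length C")
      case True then show ?thesis using r by (simp add: code_at_def nth_append)
    next
      case False
      then have "p + length C + (i - length C) < length P \<and>
          P ! (p + length C + (i - length C)) = D ! (i - length C)"
        using r i unfolding code_at_def by (metis length_append nat_add_left_cancel_less le_add_diff_inverse not_less)
      then show ?thesis using False by (simp add: nth_append add.assoc)
    qed
  qed
qed

lemma code_at_Cons: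
  "code_at P p (i # C) \<longleftrightarrow> p < length P \<and> P ! p = i \<and> code_at P (Suc p) C"
  using code_at_append[of P p "[i]" C] by (simp add: code_at_def)

fun plain :: "instr \<Rightarrow> bool" where
  "plain (Const d k) = True" | "plain (Op f d a b) = True" | "plain (Load d a) = True"
| "plain (Store a b) = True" | "plain _ = False"

fun plain_exec :: "nat \<Rightarrow> instr \<Rightarrow> env \<times> env \<Rightarrow> env \<times> env" where
  "plain_exec w (Const d k) (R, M) = (R(d := take_bit w k), M)"
| "plain_exec w (Op f d a b) (R, M) = (R(d := eval_binop w f (R a) (R b)), M)"
| "plain_exec w (Load d a) (R, M) = (R(d := M (R a)), M)"
| "plain_exec w (Store a b) (R, M) = (R, M(R a := R b))"
| "plain_exec w _ x = x"

lemma plain_steps: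
  assumes "code_at P p C" "list_all plain C" "fold (plain_exec w) C (R, M) = (R', M')"
  shows "(tape_step w P \<omega> ^^ length C) (Config p R M, j) = (Config (p + length C) R' M', j)"
  using assms
proof (induction C arbitrary: p R M)
  case (Cons i C)
  obtain R1 M1 where 1: "plain_exec w i (R, M) = (R1, M1)" by fastforce
  have "tape_step w P \<omega> (Config p R M, j) = (Config (Suc p) R1 M1, j)"
    using Cons.prems 1 by (cases i) (auto simp: tape_step_def code_at_Cons halted_def)
  moreover have "(tape_step w P \<omega> ^^ length C) (Config (Suc p) R1 M1, j) =
      (Config (Suc p + length C) R' M', j)"
    using Cons.prems 1 by (intro Cons.IH) (auto simp: code_at_Cons)
  ultimately show ?case by (simp add: funpow_swap1)
qed simp

lemma plain_addr_code: "list_all plain (addr_code k d)"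
  by (simp add: addr_code_def)

lemma plain_cexpr: "list_all plain (cexpr e d)"
  by (induction e arbitrary: d) (auto simp: plain_addr_code)

text \<open>The interleaved arrays, of \<open>lim\<close> entries each, occupy
  \<open>narr * lim\<close> cells from \<open>base\<close> on. By \<open>space\<close> every address
  fits into a word, and by \<open>narr_le\<close> so does the constant used to compute
  addresses.\<close>

locale ram =
  fixes w lim base :: nat and inp \<omega> :: "nat \<Rightarrow> nat"
  assumes w_pos: "w > 0"
    and space: "base + narr * lim \<le> 2 ^ w"
    and narr_le: "narr < (2::nat) ^ w"
    and inp_less: "\<And>a. inp a < 2 ^ w"
    and tape_less: "\<And>j. \<omega> j < 2 ^ w"
begin

fun ev :: "env \<Rightarrow> arrs \<Rightarrow> expr \<Rightarrow> nat" where
  "ev V A (Cst k) = k"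
| "ev V A (Var x) = V x"
| "ev V A (Bin f a b) = bop f (ev V A a) (ev V A b)"
| "ev V A (Arr k e) = A k (ev V A e)"
| "ev V A (Inp e) = inp (ev V A e)"

fun ok :: "env \<Rightarrow> arrs \<Rightarrow> expr \<Rightarrow> bool" where
  "ok V A (Cst k) \<longleftrightarrow> k < 2 ^ w"
| "ok V A (Var x) \<longleftrightarrow> True"
| "ok V A (Bin f a b) \<longleftrightarrow> ok V A a \<and> ok V A b \<and> bop_ok w f (ev V A a) (ev V A b)"
| "ok V A (Arr k e) \<longleftrightarrow> ok V A e \<and> ev V A e < lim"
| "ok V A (Inp e) \<longleftrightarrow> ok V A e \<and> ev V A e < base"

definition bounded_state :: "env \<Rightarrow> arrs \<Rightarrow> bool" where
  "bounded_state V A \<longleftrightarrow> (\<forall>x. V x < 2 ^ w) \<and> (\<forall>k i. A k i < 2 ^ w)"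

lemma ev_less:
  assumes "bounded_state V A" "ok V A e"
  shows "ev V A e < 2 ^ w"
  using assms
proof (induction e)
  case (Bin f a b)
  then show ?case using eval_binop_bop[of w f "ev V A a" "ev V A b"] w_pos by simp
qed (auto simp: bounded_state_def inp_less)

text \<open>The last two components of a state are the number of random words used and the time.\<close>

type_synonym state = "env \<times> arrs \<times> nat \<times> nat"

inductive big :: "com \<Rightarrow> state \<Rightarrow> state \<Rightarrow> bool" where
  big_Assign: "ok V A e \<Longrightarrow> big (Assign x e) (V, A, j, t) (V(x := ev V A e), A, j, Suc t)"
| big_Put: "ok V A i \<Longrightarrow> ok V A e \<Longrightarrow> ev V A i < lim \<Longrightarrow>
    big (Put k i e) (V, A, j, t) (V, A(k := (A k)(ev V A i := ev V A e)), j, Suc t)"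
| big_Draw: "big (Draw x) (V, A, j, t) (V(x := \<omega> j), A, Suc j, Suc t)"
| big_Then: "big c s s' \<Longrightarrow> big d s' s'' \<Longrightarrow> big (c ;; d) s s''"
| big_Cond1: "ok V A e \<Longrightarrow> ev V A e \<noteq> 0 \<Longrightarrow> big c (V, A, j, Suc t) s \<Longrightarrow> big (Cond e c d) (V, A, j, t) s"
| big_Cond2: "ok V A e \<Longrightarrow> ev V A e = 0 \<Longrightarrow> big d (V, A, j, Suc t) s \<Longrightarrow> big (Cond e c d) (V, A, j, t) s"
| big_Loop1: "ok V A e \<Longrightarrow> ev V A e \<noteq> 0 \<Longrightarrow> big c (V, A, j, Suc t) s \<Longrightarrow> big (Loop e c) s s' \<Longrightarrow>
    big (Loop e c) (V, A, j, t) s'"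
| big_Loop2: "ok V A e \<Longrightarrow> ev V A e = 0 \<Longrightarrow> big (Loop e c) (V, A, j, t) (V, A, j, Suc t)"

inductive_cases big_elims:
  "big (Assign x e) s s'" "big (Put k i e) s s'" "big (Draw x) s s'" "big (c ;; d) s s'"
  "big (Cond e c d) s s'" "big (Loop e c) s s'"

lemma big_frame:
  assumes "big c s s'"
  shows "(x \<notin> vmods c \<longrightarrow> fst s' x = fst s x) \<and> (k \<notin> amods c \<longrightarrow> fst (snd s') k = fst (snd s) k)"
  using assms by (induction rule: big.induct) auto

lemma big_bounded:
  assumes "big c s s'" "bounded_state (fst s) (fst (snd s))"
  shows "bounded_state (fst s') (fst (snd s'))"
  using assms
proof (induction rule: big.induct)
  case (big_Assign V A e x j t)
  then show ?case using ev_less[of V A e] by (auto simp: bounded_state_def)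
next
  case (big_Put V A i e k j t)
  then show ?case using ev_less[of V A e] by (auto simp: bounded_state_def)
next
  case (big_Draw x V A j t)
  then show ?case by (auto simp: bounded_state_def tape_less)
qed auto

subsection \<open>Correctness of the compiler\<close>

definition rel :: "env \<Rightarrow> arrs \<Rightarrow> env \<Rightarrow> env \<Rightarrow> bool" where
  "rel V A R M \<longleftrightarrow> bounded_state V A \<and> (\<forall>x<nvar. R x = V x) \<and> R nvar = base \<and>
     (\<forall>a<base. M a = inp a) \<and> (\<forall>k<narr. \<forall>i<lim. M (base + narr * i + k) = A k i)"

lemma rel_cong: "rel V A R M \<Longrightarrow> (\<And>x. x < tmp \<Longrightarrow> R' x = R x) \<Longrightarrow> rel V A R' M"
  by (auto simp: rel_def)

lemma addr_code_correct:
  assumes "R d < lim" "k < narr" "R nvar = base" "nvar < d"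
  shows "\<exists>R'. fold (plain_exec w) (addr_code k d) (R, M) = (R', M) \<and>
     R' d = base + narr * R d + k \<and> (\<forall>x<d. R' x = R x)"
proof -
  have *: "base + narr * R d + k < 2 ^ w" using assms space by linarith
  have 1: "take_bit w narr = narr"
    using narr_le by (simp add: take_bit_nat_eq_self_iff)
  have 2: "take_bit w (R d * narr) = R d * narr" "take_bit w k = k"
    "take_bit w (R d * narr + k) = R d * narr + k"
    "take_bit w (R d * narr + k + base) = R d * narr + k + base"
    using * by (auto simp: take_bit_nat_eq_self_iff)
  show ?thesis using assms 1 2 by (simp add: addr_code_def)
qed

lemma cexpr_correct:
  assumes "rel V A R M" "ok V A e" "wf_expr e" "nvar < d"
  shows "\<exists>R'. fold (plain_exec w) (cexpr e d) (R, M) = (R', M) \<and> R' d = ev V A e \<and>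
    (\<forall>x<d. R' x = R x)"
  using assms
proof (induction e arbitrary: R d)
  case (Cst k)
  then show ?case by (simp add: take_bit_nat_eq_self_iff)
next
  case (Var x)
  then have "take_bit w (V x) = V x" by (simp add: take_bit_nat_eq_self_iff rel_def bounded_state_def)
  then show ?case using Var by (simp add: rel_def)
next
  case (Bin f a b)
  from Bin.IH(1)[of R d] Bin.prems obtain R1 where
    1: "fold (plain_exec w) (cexpr a d) (R, M) = (R1, M)" "R1 d = ev V A a" "\<forall>x<d. R1 x = R x"
    by auto
  have r1: "rel V A R1 M" by (rule rel_cong[OF Bin.prems(1)]) (use 1 Bin.prems in auto)
  from Bin.IH(2)[of R1 "Suc d"] Bin.prems r1 obtain R2 where
    2: "fold (plain_exec w) (cexpr b (Suc d)) (R1, M) = (R2, M)" "R2 (Suc d) = ev V A b"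
      "\<forall>x<Suc d. R2 x = R1 x"
    by auto
  have "eval_binop w f (ev V A a) (ev V A b) = bop f (ev V A a) (ev V A b)"
    using Bin.prems w_pos ev_less[of V A a] ev_less[of V A b] eval_binop_bop
    by (auto simp: rel_def)
  then show ?case using 1 2 by simp
next
  case (Arr k e)
  from Arr.IH[of R d] Arr.prems obtain R1 where
    1: "fold (plain_exec w) (cexpr e d) (R, M) = (R1, M)" "R1 d = ev V A e" "\<forall>x<d. R1 x = R x"
    by auto
  have r1: "rel V A R1 M" by (rule rel_cong[OF Arr.prems(1)]) (use 1 Arr.prems in auto)
  from addr_code_correct[of R1 d k M] 1 Arr.prems r1 obtain R2 where
    2: "fold (plain_exec w) (addr_code k d) (R1, M) = (R2, M)"
      "R2 d = base + narr * ev V A e + k" "\<forall>x<d. R2 x = R1 x"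
    by (auto simp: rel_def)
  then show ?case using 1 r1 Arr.prems by (auto simp: rel_def)
next
  case (Inp e)
  from Inp.IH[of R d] Inp.prems obtain R1 where
    1: "fold (plain_exec w) (cexpr e d) (R, M) = (R1, M)" "R1 d = ev V A e" "\<forall>x<d. R1 x = R x"
    by auto
  then show ?case using Inp.prems by (auto simp: rel_def)
qed

lemma funpow_one: "((f :: 'a \<Rightarrow> 'a) ^^ 1) x = f x"
  by simp

lemma rel_Put:
  assumes "rel V A R M" "i < lim" "k < narr" "x < 2 ^ w"
  shows "rel V (A(k := (A k)(i := x))) R (M(base + narr * i + k := x))"
proof -
  \<comment> \<open>Dividing the offset by \<open>narr\<close> recovers the index, so different
    array entries never share a cell.\<close>
  have "base + narr * i' + k' = base + narr * i + k \<longleftrightarrow> i' = i \<and> k' = k" if "k' < narr" for i' k'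
  proof
    assume "base + narr * i' + k' = base + narr * i + k"
    then have *: "narr * i' + k' = narr * i + k" by simp
    have "(narr * i' + k') div narr = i'" "(narr * i + k) div narr = i"
      using that assms(3) by auto
    then show "i' = i \<and> k' = k" using * by simp
  qed simp
  then show ?thesis using assms by (auto simp: rel_def bounded_state_def)
qed

text \<open>Each tick pays for a single pass over the instructions of one construct, without its
  subcommands, and there are at most \<open>\<kappa>\<close> of these if \<open>\<kappa>\<close>
  bounds the length of the whole code. The time bound is additive to avoid truncated
  subtraction.\<close>

lemma ccom_correct:
  assumes "big c (V, A, j, t) (V', A', j', t')" "wf_com c" "rel V A R M"
    "code_at P p (ccom p c)" "length (ccom p c) \<le> \<kappa>"
  shows "\<exists>T R' M'. (tape_step w P \<omega> ^^ T) (Config p R M, j) =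
    (Config (p + length (ccom p c)) R' M', j') \<and> rel V' A' R' M' \<and> \<kappa> * t + T \<le> \<kappa> * t'"
  using assms
proof (induction c "(V, A, j, t)" "(V', A', j', t')"
    arbitrary: V A j t V' A' j' t' R M p rule: big.induct)
  case (big_Assign V A e x j t)
  from cexpr_correct[of V A R M e tmp] big_Assign obtain R1 where
    1: "fold (plain_exec w) (cexpr e tmp) (R, M) = (R1, M)" "R1 tmp = ev V A e" "\<forall>x<tmp. R1 x = R x"
    by auto
  have lt: "ev V A e < 2 ^ w" using big_Assign ev_less by (auto simp: rel_def)
  have "fold (plain_exec w) (ccom p (Assign x e)) (R, M) = (R1(x := ev V A e), M)"
    using 1 lt by (simp add: take_bit_nat_eq_self)
  from plain_steps[OF big_Assign.prems(3) _ this, of \<omega> j]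
  have "(tape_step w P \<omega> ^^ length (ccom p (Assign x e))) (Config p R M, j) =
     (Config (p + length (ccom p (Assign x e))) (R1(x := ev V A e)) M, j)"
    by (simp add: plain_cexpr)
  moreover have "rel (V(x := ev V A e)) A (R1(x := ev V A e)) M"
    using big_Assign 1 lt by (auto simp: rel_def bounded_state_def)
  ultimately show ?case using big_Assign.prems(4) by (metis add_le_mono le_refl mult_Suc_right add.commute)
next
  case (big_Put V A i e k j t)
  from cexpr_correct[of V A R M i tmp] big_Put obtain R1 where
    1: "fold (plain_exec w) (cexpr i tmp) (R, M) = (R1, M)" "R1 tmp = ev V A i" "\<forall>x<tmp. R1 x = R x"
    by auto
  from addr_code_correct[of R1 tmp k M] 1 big_Put obtain R2 where
    2: "fold (plain_exec w) (addr_code k tmp) (R1, M) = (R2, M)"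
      "R2 tmp = base + narr * ev V A i + k" "\<forall>x<tmp. R2 x = R1 x"
    by (auto simp: rel_def)
  have r2: "rel V A R2 M" by (rule rel_cong[OF big_Put.prems(2)]) (use 1 2 in auto)
  from cexpr_correct[of V A R2 M e "Suc tmp"] big_Put r2 obtain R3 where
    3: "fold (plain_exec w) (cexpr e (Suc tmp)) (R2, M) = (R3, M)" "R3 (Suc tmp) = ev V A e"
      "\<forall>x<Suc tmp. R3 x = R2 x"
    by auto
  let ?M = "M(base + narr * ev V A i + k := ev V A e)"
  have lt: "ev V A e < 2 ^ w" using big_Put ev_less by (auto simp: rel_def)
  have "fold (plain_exec w) (ccom p (Put k i e)) (R, M) = (R3, ?M)"
    using 1 2 3 by simp
  from plain_steps[OF big_Put.prems(3) _ this, of \<omega> j]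
  have "(tape_step w P \<omega> ^^ length (ccom p (Put k i e))) (Config p R M, j) =
     (Config (p + length (ccom p (Put k i e))) R3 ?M, j)"
    by (simp add: plain_cexpr plain_addr_code)
  moreover have "rel V (A(k := (A k)(ev V A i := ev V A e))) R3 ?M"
    by (rule rel_Put) (use big_Put lt 1 2 3 in \<open>auto intro: rel_cong[OF r2]\<close>)
  ultimately show ?case using big_Put.prems(4) by (metis add_le_mono le_refl mult_Suc_right add.commute)
next
  case (big_Draw x V A j t)
  have "(tape_step w P \<omega> ^^ 1) (Config p R M, j) = (Config (p + 1) (R(x := \<omega> j)) M, Suc j)"
    using big_Draw by (auto simp: tape_step_def code_at_Cons halted_def)
  moreover have "rel (V(x := \<omega> j)) A (R(x := \<omega> j)) M"
    using big_Draw tape_less by (auto simp: rel_def bounded_state_def)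
  ultimately show ?case using big_Draw
    by (intro exI[of _ 1] exI[of _ "R(x := \<omega> j)"] exI[of _ M]) auto
next
  case (big_Then c s d V A j t V' A' j' t')
  obtain V1 A1 j1 t1 where s: "s = (V1, A1, j1, t1)" by (cases s)
  let ?C = "ccom p c"
  from big_Then(2)[OF s _ big_Then.prems(2), of p] big_Then.prems obtain T1 R1 M1 where
    1: "(tape_step w P \<omega> ^^ T1) (Config p R M, j) = (Config (p + length ?C) R1 M1, j1)"
      "rel V1 A1 R1 M1" "\<kappa> * t + T1 \<le> \<kappa> * t1"
    by (auto simp: Let_def code_at_append)
  from big_Then(4)[OF s _ 1(2), of "p + length ?C"] big_Then.prems obtain T2 R2 M2 where
    2: "(tape_step w P \<omega> ^^ T2) (Config (p + length ?C) R1 M1, j1) =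
      (Config (p + length ?C + length (ccom (p + length ?C) d)) R2 M2, j')"
      "rel V' A' R2 M2" "\<kappa> * t1 + T2 \<le> \<kappa> * t'"
    by (auto simp: Let_def code_at_append)
  show ?case
    using 1 2 by (intro exI[of _ "T2 + T1"] exI[of _ R2] exI[of _ M2])
      (simp add: funpow_add Let_def add.assoc)
next
  case (big_Cond1 V A e c j t d V' A' j' t')
  let ?E = "cexpr e tmp" let ?C = "ccom (Suc (p + length ?E)) c"
  let ?q = "p + length ?E + length ?C + 2" let ?D = "ccom ?q d"
  from cexpr_correct[of V A R M e tmp] big_Cond1 obtain R1 where
    1: "fold (plain_exec w) ?E (R, M) = (R1, M)" "R1 tmp = ev V A e" "\<forall>x<tmp. R1 x = R x"
    by auto
  have r1: "rel V A R1 M" by (rule rel_cong[OF big_Cond1.prems(2)]) (use 1 in auto)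
  have code: "code_at P p ?E" "p + length ?E < length P" "P ! (p + length ?E) = JumpZ tmp ?q"
    "code_at P (Suc (p + length ?E)) ?C" "p + length ?E + 1 + length ?C < length P"
    "P ! (p + length ?E + 1 + length ?C) = Jump (?q + length ?D)"
    using big_Cond1.prems(3) by (auto simp: Let_def code_at_append code_at_Cons add.assoc)
  have s1: "(tape_step w P \<omega> ^^ length ?E) (Config p R M, j) = (Config (p + length ?E) R1 M, j)"
    using plain_steps[OF code(1) plain_cexpr 1(1)] .
  have s2: "tape_step w P \<omega> (Config (p + length ?E) R1 M, j) = (Config (Suc (p + length ?E)) R1 M, j)"
    using code big_Cond1 1 by (auto simp: tape_step_def halted_def)
  from big_Cond1(4)[OF _ r1 code(4)] big_Cond1.prems obtain T2 R2 M2 where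
    2: "(tape_step w P \<omega> ^^ T2) (Config (Suc (p + length ?E)) R1 M, j) =
      (Config (Suc (p + length ?E) + length ?C) R2 M2, j')"
      "rel V' A' R2 M2" "\<kappa> * Suc t + T2 \<le> \<kappa> * t'"
    by (auto simp: Let_def)
  have s3: "tape_step w P \<omega> (Config (Suc (p + length ?E) + length ?C) R2 M2, j') =
     (Config (?q + length ?D) R2 M2, j')"
    using code by (auto simp: tape_step_def halted_def)
  \<comment> \<open>Read from right to left: the test, \<open>JumpZ\<close>, the branch taken, and
    the jump over the other branch.\<close>
  have "(tape_step w P \<omega> ^^ (1 + (T2 + (1 + length ?E)))) (Config p R M, j) =
     (Config (?q + length ?D) R2 M2, j')"
    by (simp only: funpow_add o_apply s1 2 s2 s3 funpow_one One_nat_def[symmetric])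
  moreover have "\<kappa> * t + (1 + (T2 + (1 + length ?E))) \<le> \<kappa> * t'"
    using 2(3) big_Cond1.prems(4) by (simp add: Let_def)
  ultimately show ?case using 2(2)
    by (intro exI[of _ "1 + (T2 + (1 + length ?E))"] exI[of _ R2] exI[of _ M2])
      (simp add: Let_def add.assoc)
next
  case (big_Cond2 V A e d j t c V' A' j' t')
  let ?E = "cexpr e tmp" let ?C = "ccom (Suc (p + length ?E)) c"
  let ?q = "p + length ?E + length ?C + 2" let ?D = "ccom ?q d"
  from cexpr_correct[of V A R M e tmp] big_Cond2 obtain R1 where
    1: "fold (plain_exec w) ?E (R, M) = (R1, M)" "R1 tmp = ev V A e" "\<forall>x<tmp. R1 x = R x"
    by auto
  have r1: "rel V A R1 M" by (rule rel_cong[OF big_Cond2.prems(2)]) (use 1 in auto)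
  have code: "code_at P p ?E" "p + length ?E < length P" "P ! (p + length ?E) = JumpZ tmp ?q"
    "code_at P ?q ?D"
    using big_Cond2.prems(3) by (auto simp: Let_def code_at_append code_at_Cons add.assoc)
  have s1: "(tape_step w P \<omega> ^^ length ?E) (Config p R M, j) = (Config (p + length ?E) R1 M, j)"
    using plain_steps[OF code(1) plain_cexpr 1(1)] .
  have s2: "tape_step w P \<omega> (Config (p + length ?E) R1 M, j) = (Config ?q R1 M, j)"
    using code big_Cond2 1 by (auto simp: tape_step_def halted_def)
  from big_Cond2(4)[OF _ r1 code(4)] big_Cond2.prems obtain T2 R2 M2 where
    2: "(tape_step w P \<omega> ^^ T2) (Config ?q R1 M, j) = (Config (?q + length ?D) R2 M2, j')"
      "rel V' A' R2 M2" "\<kappa> * Suc t + T2 \<le> \<kappa> * t'"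
    by (auto simp: Let_def)
  have "(tape_step w P \<omega> ^^ (T2 + (1 + length ?E))) (Config p R M, j) =
     (Config (?q + length ?D) R2 M2, j')"
    by (simp only: funpow_add o_apply s1 2 s2 funpow_one One_nat_def[symmetric])
  moreover have "\<kappa> * t + (T2 + (1 + length ?E)) \<le> \<kappa> * t'"
    using 2(3) big_Cond2.prems(4) by (simp add: Let_def)
  ultimately show ?case using 2(2)
    by (intro exI[of _ "T2 + (1 + length ?E)"] exI[of _ R2] exI[of _ M2])
      (simp add: Let_def add.assoc)
next
  case (big_Loop1 V A e c j t s V' A' j' t')
  obtain V1 A1 j1 t1 where s: "s = (V1, A1, j1, t1)" by (cases s)
  let ?E = "cexpr e tmp" let ?C = "ccom (Suc (p + length ?E)) c"
  let ?q = "p + length ?E + length ?C + 2"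
  from cexpr_correct[of V A R M e tmp] big_Loop1 obtain R1 where
    1: "fold (plain_exec w) ?E (R, M) = (R1, M)" "R1 tmp = ev V A e" "\<forall>x<tmp. R1 x = R x"
    by auto
  have r1: "rel V A R1 M" by (rule rel_cong[OF big_Loop1.prems(2)]) (use 1 in auto)
  have code: "code_at P p ?E" "p + length ?E < length P" "P ! (p + length ?E) = JumpZ tmp ?q"
    "code_at P (Suc (p + length ?E)) ?C" "p + length ?E + 1 + length ?C < length P"
    "P ! (p + length ?E + 1 + length ?C) = Jump p"
    using big_Loop1.prems(3) by (auto simp: Let_def code_at_append code_at_Cons add.assoc)
  have s1: "(tape_step w P \<omega> ^^ length ?E) (Config p R M, j) = (Config (p + length ?E) R1 M, j)"
    using plain_steps[OF code(1) plain_cexpr 1(1)] .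
  have s2: "tape_step w P \<omega> (Config (p + length ?E) R1 M, j) = (Config (Suc (p + length ?E)) R1 M, j)"
    using code big_Loop1 1 by (auto simp: tape_step_def halted_def)
  from big_Loop1(4)[OF s _ r1 code(4)] big_Loop1.prems obtain T2 R2 M2 where
    2: "(tape_step w P \<omega> ^^ T2) (Config (Suc (p + length ?E)) R1 M, j) =
      (Config (Suc (p + length ?E) + length ?C) R2 M2, j1)"
      "rel V1 A1 R2 M2" "\<kappa> * Suc t + T2 \<le> \<kappa> * t1"
    by (auto simp: Let_def)
  have s3: "tape_step w P \<omega> (Config (Suc (p + length ?E) + length ?C) R2 M2, j1) =
     (Config p R2 M2, j1)"
    using code by (auto simp: tape_step_def halted_def)
  from big_Loop1(6)[OF s _ 2(2) big_Loop1.prems(3)] big_Loop1.prems obtain T3 R3 M3 where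
    3: "(tape_step w P \<omega> ^^ T3) (Config p R2 M2, j1) =
      (Config (p + length (ccom p (Loop e c))) R3 M3, j')"
      "rel V' A' R3 M3" "\<kappa> * t1 + T3 \<le> \<kappa> * t'"
    by blast
  \<comment> \<open>One round (test, \<open>JumpZ\<close>, body, \<open>Jump p\<close>) leads back
    to \<open>p\<close>; \<open>T3\<close> counts the steps of the remaining rounds.\<close>
  have "(tape_step w P \<omega> ^^ (T3 + (1 + (T2 + (1 + length ?E))))) (Config p R M, j) =
     (Config (p + length (ccom p (Loop e c))) R3 M3, j')"
    by (simp only: funpow_add o_apply s1 2 s2 s3 3 funpow_one One_nat_def[symmetric])
  moreover have "\<kappa> * t + (T3 + (1 + (T2 + (1 + length ?E)))) \<le> \<kappa> * t'"
    using 2(3) 3(3) big_Loop1.prems(4) by (simp add: Let_def)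
  ultimately show ?case using 3(2) by blast
next
  case (big_Loop2 V A e c j t)
  let ?E = "cexpr e tmp" let ?C = "ccom (Suc (p + length ?E)) c"
  let ?q = "p + length ?E + length ?C + 2"
  from cexpr_correct[of V A R M e tmp] big_Loop2 obtain R1 where
    1: "fold (plain_exec w) ?E (R, M) = (R1, M)" "R1 tmp = ev V A e" "\<forall>x<tmp. R1 x = R x"
    by auto
  have r1: "rel V A R1 M" by (rule rel_cong[OF big_Loop2.prems(2)]) (use 1 in auto)
  have code: "code_at P p ?E" "p + length ?E < length P" "P ! (p + length ?E) = JumpZ tmp ?q"
    using big_Loop2.prems(3) by (auto simp: Let_def code_at_append code_at_Cons add.assoc)
  have s1: "(tape_step w P \<omega> ^^ length ?E) (Config p R M, j) = (Config (p + length ?E) R1 M, j)"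
    using plain_steps[OF code(1) plain_cexpr 1(1)] .
  have s2: "tape_step w P \<omega> (Config (p + length ?E) R1 M, j) = (Config ?q R1 M, j)"
    using code big_Loop2 1 by (auto simp: tape_step_def halted_def)
  have "(tape_step w P \<omega> ^^ (1 + length ?E)) (Config p R M, j) = (Config ?q R1 M, j)"
    by (simp only: funpow_add o_apply s1 s2 funpow_one)
  moreover have "\<kappa> * t + (1 + length ?E) \<le> \<kappa> * Suc t"
    using big_Loop2.prems(4) by (simp add: Let_def)
  ultimately show ?case using r1
    by (intro exI[of _ "1 + length ?E"] exI[of _ R1] exI[of _ M]) (simp add: Let_def add.assoc)
qed

subsection \<open>Weakest preconditions\<close>

text \<open>As a terminating derivation is required, this is total correctness. It includes the
  absence of overflow, since \<open>big\<close> demands \<open>ok\<close> of every expression, and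
  the postcondition can speak of the running time.\<close>

definition wp :: "com \<Rightarrow> (env \<Rightarrow> arrs \<Rightarrow> nat \<Rightarrow> nat \<Rightarrow> bool) \<Rightarrow> env \<Rightarrow> arrs \<Rightarrow> nat \<Rightarrow> nat \<Rightarrow> bool" where
  "wp c Q V A j t \<longleftrightarrow> (\<exists>V' A' j' t'. big c (V, A, j, t) (V', A', j', t') \<and> Q V' A' j' t')"

lemma big_iff:
  "big (Assign x e) (V, A, j, t) s \<longleftrightarrow> ok V A e \<and> s = (V(x := ev V A e), A, j, Suc t)"
  "big (Put k i e) (V, A, j, t) s \<longleftrightarrow> ok V A i \<and> ok V A e \<and> ev V A i < lim \<and>
     s = (V, A(k := (A k)(ev V A i := ev V A e)), j, Suc t)"
  "big (Draw x) (V, A, j, t) s \<longleftrightarrow> s = (V(x := \<omega> j), A, Suc j, Suc t)"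
  by (auto elim: big_elims intro: big.intros)

lemma wp_Assign:
  "wp (Assign x e) Q V A j t \<longleftrightarrow> ok V A e \<and> Q (V(x := ev V A e)) A j (Suc t)"
  by (simp add: wp_def big_iff)

lemma wp_Put:
  "wp (Put k i e) Q V A j t \<longleftrightarrow> ok V A i \<and> ok V A e \<and> ev V A i < lim \<and>
     Q V (A(k := (A k)(ev V A i := ev V A e))) j (Suc t)"
  by (auto simp add: wp_def big_iff)

lemma wp_Draw: "wp (Draw x) Q V A j t \<longleftrightarrow> Q (V(x := \<omega> j)) A (Suc j) (Suc t)"
  by (simp add: wp_def big_iff)

lemma wp_Then: "wp (c ;; d) Q V A j t \<longleftrightarrow> wp c (wp d Q) V A j t"
proof -
  have "big (c ;; d) s s'' \<longleftrightarrow> (\<exists>s'. big c s s' \<and> big d s' s'')" for s s''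
    by (auto simp del: split_paired_Ex intro: big.intros elim: big_elims)
  then show ?thesis by (simp add: wp_def split_paired_Ex) blast
qed

lemma big_iff_Cond: "big (Cond e c d) (V, A, j, t) s \<longleftrightarrow>
    ok V A e \<and> (if ev V A e \<noteq> 0 then big c (V, A, j, Suc t) s else big d (V, A, j, Suc t) s)"
  by (auto intro: big.intros elim: big_elims)

lemma wp_Cond: "wp (Cond e c d) Q V A j t \<longleftrightarrow>
    ok V A e \<and> (if ev V A e \<noteq> 0 then wp c Q V A j (Suc t) else wp d Q V A j (Suc t))"
  by (auto simp: wp_def big_iff_Cond)

lemma wp_Loop: "wp (Loop e c) Q V A j t \<longleftrightarrow>
    ok V A e \<and> (if ev V A e \<noteq> 0 then wp c (wp (Loop e c) Q) V A j (Suc t) else Q V A j (Suc t))"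
proof -
  have "big (Loop e c) (V, A, j, t) s'' \<longleftrightarrow> ok V A e \<and>
      (if ev V A e \<noteq> 0 then \<exists>s'. big c (V, A, j, Suc t) s' \<and> big (Loop e c) s' s''
       else s'' = (V, A, j, Suc t))" for s''
    by (auto simp del: split_paired_Ex intro: big.intros elim: big_elims)
  then show ?thesis by (simp add: wp_def split_paired_Ex) blast
qed

lemmas wp_simps = wp_Assign wp_Put wp_Draw wp_Then wp_Cond

section \<open>Frame conditions and the loop rule\<close>

definition frame :: "com \<Rightarrow> env \<Rightarrow> arrs \<Rightarrow> env \<Rightarrow> arrs \<Rightarrow> bool" where
  "frame c V A V' A' \<longleftrightarrow> (\<forall>x. x \<notin> vmods c \<longrightarrow> V' x = V x) \<and> (\<forall>k. k \<notin> amods c \<longrightarrow> A' k = A k) \<and>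
     (bounded_state V A \<longrightarrow> bounded_state V' A')"

lemma frame_refl: "frame c V A V A"
  by (simp add: frame_def)

lemma frame_trans: "frame c V A V1 A1 \<Longrightarrow> frame c V1 A1 V2 A2 \<Longrightarrow> frame c V A V2 A2"
  by (simp add: frame_def)

lemma wp_conseq:
  assumes "wp c Q V A j t"
    and "\<And>V' A' j' t'. Q V' A' j' t' \<Longrightarrow> frame c V A V' A' \<Longrightarrow> Q' V' A' j' t'"
  shows "wp c Q' V A j t"
proof -
  from assms(1) obtain V' A' j' t' where
    b: "big c (V, A, j, t) (V', A', j', t')" and q: "Q V' A' j' t'"
    by (auto simp: wp_def)
  have "frame c V A V' A'" using big_frame[OF b] big_bounded[OF b] by (simp add: frame_def)
  from assms(2)[OF q this] b show ?thesis by (auto simp: wp_def)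
qed

text \<open>The invariant need not mention variables and arrays that the body leaves alone:
  \<open>frame\<close> relates every intermediate state to the initial one. The variant
  \<open>\<mu>\<close> gives termination.\<close>

lemma wp_loop_rule:
  assumes init: "I V A j t"
    and oke: "\<And>V' A' j' t'. I V' A' j' t' \<Longrightarrow> frame c V A V' A' \<Longrightarrow> ok V' A' e"
    and step: "\<And>V' A' j' t'. I V' A' j' t' \<Longrightarrow> frame c V A V' A' \<Longrightarrow> ev V' A' e \<noteq> 0 \<Longrightarrow>
      wp c (\<lambda>V'' A'' j'' t''. I V'' A'' j'' t'' \<and> \<mu> V'' A'' < (\<mu> V' A' :: nat)) V' A' j' (Suc t')"
    and post: "\<And>V' A' j' t'. I V' A' j' t' \<Longrightarrow> frame c V A V' A' \<Longrightarrow> ev V' A' e = 0 \<Longrightarrow>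
      Q V' A' j' (Suc t')"
  shows "wp (Loop e c) Q V A j t"
proof -
  have "wp (Loop e c) Q V' A' j' t'" if "I V' A' j' t'" "frame c V A V' A'" for V' A' j' t'
    using that
  proof (induction "\<mu> V' A'" arbitrary: V' A' j' t' rule: less_induct)
    case less
    show ?case
    proof (subst wp_Loop, intro conjI)
      show "ok V' A' e" using oke less.prems .
      show "if ev V' A' e \<noteq> 0 then wp c (wp (Loop e c) Q) V' A' j' (Suc t') else Q V' A' j' (Suc t')"
      proof (cases "ev V' A' e = 0")
        case True then show ?thesis using post less.prems by simp
      next
        case False
        have "wp c (wp (Loop e c) Q) V' A' j' (Suc t')"
        proof (rule wp_conseq[OF step[OF less.prems False]])
          fix V'' A'' j'' t''
          assume "I V'' A'' j'' t'' \<and> \<mu> V'' A'' < \<mu> V' A'" "frame c V' A' V'' A''"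
          then show "wp (Loop e c) Q V'' A'' j'' t''"
            using less.hyps frame_trans[OF less.prems(2)] by blast
        qed
        then show ?thesis using False by simp
      qed
    qed
  qed
  then show ?thesis using init frame_refl by blast
qed

end

hide_const (open) up_ring.coeff up_ring.monom

section \<open>Words as polynomials over the field with two elements\<close>

lemma bit_add_self [simp]: "(x :: bit) + x = 0"
  by (cases x) simp_all

lemma bit_poly_add_self [simp]: "(p :: bit poly) + p = 0"
  by (rule poly_eqI) (simp only: coeff_add bit_add_self coeff_0)

lemma bit_poly_add_left_self [simp]: "(p :: bit poly) + (p + q) = q"
  by (simp flip: add.assoc)

lemma bit_poly_minus: "(p :: bit poly) - q = p + q"
  by (rule poly_eqI) simp

lemma bit_poly_eq_iff: "(p :: bit poly) = q \<longleftrightarrow> p + q = 0"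
  by (metis add_0_right bit_poly_add_left_self)

fun word_poly :: "nat \<Rightarrow> bit poly" where
  "word_poly a = (if a = 0 then 0 else pCons (of_bool (odd a)) (word_poly (a div 2)))"

declare word_poly.simps [simp del]

lemma word_poly_0 [simp]: "word_poly 0 = 0"
  by (simp add: word_poly.simps)

lemma coeff_word_poly: "coeff (word_poly a) i = of_bool (Bit_Operations.bit a i)"
proof (induction i arbitrary: a)
  case 0
  show ?case by (subst word_poly.simps) (auto simp: bit_0)
next
  case (Suc i)
  show ?case by (subst word_poly.simps) (auto simp: Suc bit_Suc)
qed

lemma word_poly_xor: "word_poly (Bit_Operations.xor a b) = word_poly a + word_poly b"
  by (rule poly_eqI) (auto simp: coeff_word_poly bit_xor_iff)

lemma word_poly_1: "word_poly 1 = 1"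
  by (simp add: word_poly.simps one_pCons)

lemma word_poly_mult_power: "word_poly (a * 2 ^ k) = monom 1 k * word_poly a"
  by (rule poly_eqI)
    (auto simp: coeff_word_poly coeff_monom_mult bit_push_bit_iff simp flip: push_bit_eq_mult)

lemma word_poly_div_mod:
  "word_poly a = monom 1 k * word_poly (a div 2 ^ k) + word_poly (a mod 2 ^ k)"
  by (rule poly_eqI)
    (auto simp: coeff_word_poly coeff_monom_mult bit_drop_bit_eq bit_take_bit_iff
      simp flip: drop_bit_eq_div take_bit_eq_mod)

lemma word_poly_inject: "word_poly a = word_poly b \<longleftrightarrow> a = b"
proof
  assume "word_poly a = word_poly b"
  then have "coeff (word_poly a) i = coeff (word_poly b) i" for i by simp
  then show "a = b" by (intro bit_eqI) (metis coeff_word_poly of_bool_eq_iff)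
qed simp

lemma word_poly_eq_0_iff: "word_poly a = 0 \<longleftrightarrow> a = 0"
  using word_poly_inject[of a 0] by simp

lemma less_power_iff_degree_word_poly:
  "a < 2 ^ k \<longleftrightarrow> word_poly a = 0 \<or> degree (word_poly a) < k"
proof -
  have "a < 2 ^ k \<longleftrightarrow> (\<forall>i. Bit_Operations.bit (take_bit k a) i = Bit_Operations.bit a i)"
    using take_bit_nat_eq_self_iff[of k a] bit_eq_iff[of "take_bit k a" a] by simp
  also have "\<dots> \<longleftrightarrow> (\<forall>i. k \<le> i \<longrightarrow> \<not> Bit_Operations.bit a i)"
    unfolding bit_take_bit_iff not_less[symmetric] by blast
  also have "\<dots> \<longleftrightarrow> (\<forall>i. k \<le> i \<longrightarrow> coeff (word_poly a) i = 0)"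
    unfolding coeff_word_poly of_bool_eq_0_iff ..
  also have "\<dots> \<longleftrightarrow> word_poly a = 0 \<or> degree (word_poly a) < k"
    by (metis coeff_0 coeff_eq_0 leading_coeff_0_iff linorder_not_le order.strict_trans2)
  finally show ?thesis .
qed

lemma word_poly_surj: "\<exists>a. word_poly a = f"
proof (induction f)
  case (pCons c f)
  then obtain a where a: "word_poly a = f" by blast
  have "coeff (word_poly (2 * a + of_bool (c = 1))) i = coeff (pCons c f) i" for i
    by (cases i; cases c) (auto simp: coeff_word_poly bit_0 bit_Suc simp flip: a)
  then have "word_poly (2 * a + of_bool (c = 1)) = pCons c f" by (rule poly_eqI)
  then show ?case ..
qed (use word_poly_0 in blast)

text \<open>There are no carries, so degrees simply add. The loops below obtain the size of an
  accumulator from the polynomial it represents, without a separate bound in the invariant.\<close>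

lemma less_power_of_word_poly_mult:
  assumes "word_poly v = word_poly a * word_poly b" "a < 2 ^ i" "b < 2 ^ j"
  shows "v < 2 ^ (i + j)"
proof (cases "word_poly a = 0 \<or> word_poly b = 0")
  case True
  then show ?thesis using assms by (auto simp: less_power_iff_degree_word_poly)
next
  case False
  then have "degree (word_poly v) = degree (word_poly a) + degree (word_poly b)"
    using assms(1) by (simp add: degree_mult_eq)
  then show ?thesis using False assms(2,3) by (simp add: less_power_iff_degree_word_poly)
qed

lemma xor_less_power:
  fixes a b :: nat
  assumes "a < 2 ^ k" "b < 2 ^ k"
  shows "Bit_Operations.xor a b < 2 ^ k"
  using assms by (metis take_bit_nat_eq_self_iff take_bit_xor)

lemma and_mask_mod: "Bit_Operations.and a (2 ^ k - 1) = (a :: nat) mod 2 ^ k"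
  using take_bit_eq_mask[of k a] by (simp add: take_bit_eq_mod mask_eq_exp_minus_1)

section \<open>Congruence modulo a principal ideal\<close>

definition pcong :: "'a::comm_ring_1 \<Rightarrow> 'a \<Rightarrow> 'a \<Rightarrow> bool" where
  "pcong g a b \<longleftrightarrow> g dvd a - b"

lemma pcong_refl [simp]: "pcong g a a"
  by (simp add: pcong_def)

lemma pcong_sym: "pcong g a b \<Longrightarrow> pcong g b a"
  unfolding pcong_def by (subst minus_diff_eq[symmetric], subst dvd_minus_iff)

lemma pcong_trans [trans]: "pcong g a b \<Longrightarrow> pcong g b c \<Longrightarrow> pcong g a c"
  unfolding pcong_def using dvd_add[of g "a - b" "b - c"] by simp

lemma pcong_add: "pcong g a b \<Longrightarrow> pcong g c d \<Longrightarrow> pcong g (a + c) (b + d)"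
  unfolding pcong_def using dvd_add[of g "a - b" "c - d"] by (simp add: algebra_simps)

lemma pcong_mult: "pcong g a b \<Longrightarrow> pcong g c d \<Longrightarrow> pcong g (a * c) (b * d)"
proof -
  assume "pcong g a b" "pcong g c d"
  then have "g dvd (a - b) * c + b * (c - d)"
    unfolding pcong_def by (intro dvd_add dvd_mult2 dvd_mult) auto
  then show ?thesis by (simp add: pcong_def algebra_simps)
qed

lemma pcong_sum: "(\<And>i. i \<in> I \<Longrightarrow> pcong g (f i) (f' i)) \<Longrightarrow> pcong g (sum f I) (sum f' I)"
  by (induction I rule: infinite_finite_induct) (auto intro: pcong_add)

lemma pcong_power: "pcong g a b \<Longrightarrow> pcong g (a ^ n) (b ^ n)"
  by (induction n) (auto intro: pcong_mult)

definition cyc :: "nat \<Rightarrow> bit poly" where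
  "cyc N = monom 1 N + 1"

text \<open>Modulo \<open>cyc N\<close> the monomial of degree \<open>N\<close> equals 1, so the
  high part of a word is added onto the low part. Reducing a product thus takes a mask, a shift and
  an xor.\<close>

lemma word_poly_fold:
  "pcong (cyc N) (word_poly (Bit_Operations.xor (v mod 2 ^ N) (v div 2 ^ N))) (word_poly v)"
proof -
  have "word_poly (Bit_Operations.xor (v mod 2 ^ N) (v div 2 ^ N)) - word_poly v =
      cyc N * word_poly (v div 2 ^ N)"
    using word_poly_div_mod[of v N]
    by (simp add: bit_poly_minus word_poly_xor cyc_def algebra_simps)
  then show ?thesis by (simp add: pcong_def)
qed

section \<open>A large irreducible factor of \<open>z\<^sup>N + 1\<close>\<close>

lemma finite_degree_less: "finite {f :: bit poly. f = 0 \<or> degree f < d}"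
  and card_degree_less: "card {f :: bit poly. f = 0 \<or> degree f < d} = 2 ^ d"
proof -
  have *: "{f :: bit poly. f = 0 \<or> degree f < d} = word_poly ` {..<2 ^ d}"
  proof (rule Set.set_eqI, rule iffI)
    fix f :: "bit poly"
    assume f: "f \<in> {f. f = 0 \<or> degree f < d}"
    obtain a where "word_poly a = f" using word_poly_surj by blast
    then show "f \<in> word_poly ` {..<2 ^ d}"
      using f less_power_iff_degree_word_poly[of a d] by auto
  qed (auto simp: less_power_iff_degree_word_poly)
  show "finite {f :: bit poly. f = 0 \<or> degree f < d}" by (simp add: *)
  show "card {f :: bit poly. f = 0 \<or> degree f < d} = 2 ^ d"
    unfolding * by (subst card_image) (auto simp: inj_on_def word_poly_inject)
qed

text \<open>A nonconstant divisor of least degree cannot split further.\<close>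

lemma irreducible_factor_exists:
  fixes f :: "'a::field poly"
  assumes "degree f > 0"
  obtains p where "prime_elem p" "p dvd f" "degree p > 0"
proof -
  let ?P = "\<lambda>p. p dvd f \<and> degree p > 0"
  define p where "p = arg_min degree ?P"
  have p: "?P p" and min: "\<And>q. ?P q \<Longrightarrow> degree p \<le> degree q"
    unfolding p_def using arg_min_nat_lemma[of ?P f degree] assms by auto
  have "irreducible p"
  proof (rule Factorial_Ring.irreducibleI)
    show "p \<noteq> 0" using p by auto
    show "\<not> is_unit p" using p by (metis is_unit_iff_degree degree_0 less_numeral_extra(3))
    fix a b assume ab: "p = a * b"
    show "is_unit a \<or> is_unit b"
    proof (rule ccontr)
      assume "\<not> (is_unit a \<or> is_unit b)"
      then have "degree a > 0" "degree b > 0" "a \<noteq> 0" "b \<noteq> 0"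
        using ab \<open>p \<noteq> 0\<close> is_unit_iff_degree by auto
      moreover have "?P a" using ab p \<open>degree a > 0\<close> by (auto dest: dvd_mult_left)
      ultimately show False using min[of a] ab by (simp add: degree_mult_eq)
    qed
  qed
  then have "prime_elem p" by (rule field_poly_irreducible_imp_prime)
  then show ?thesis using p that by blast
qed

text \<open>Fermat's little theorem in the residue field of \<open>p\<close>: multiplication by
  \<open>z\<close> permutes the nonzero residues \<open>S\<close>, so the product over
  \<open>S\<close> is multiplied by \<open>z ^ card S\<close> and yet unchanged.\<close>

lemma poly_fermat:
  fixes p z :: "bit poly"
  assumes "prime_elem p" "degree p > 0" "\<not> p dvd z"
  shows "pcong p (z ^ (2 ^ degree p - 1)) 1"
proof -
  define S where "S = {f :: bit poly. f = 0 \<or> degree f < degree p} - {0}"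
  have fin: "finite S" unfolding S_def by (rule finite_Diff[OF finite_degree_less])
  have card: "card S = 2 ^ degree p - 1"
    unfolding S_def by (subst card_Diff_singleton) (auto simp: card_degree_less)
  have ndvd: "\<not> p dvd f" if "f \<in> S" for f
    using that dvd_imp_degree_le[of p f] by (auto simp: S_def)
  have mem: "(z * f) mod p \<in> S" if "f \<in> S" for f
  proof -
    have "\<not> p dvd z * f" using assms ndvd[OF that] prime_elem_dvd_mult_iff by blast
    then show ?thesis
      using degree_mod_less[of p "z * f"] assms by (auto simp: S_def dvd_eq_mod_eq_0)
  qed
  have inj: "inj_on (\<lambda>f. (z * f) mod p) S"
  proof (rule inj_onI)
    fix f g assume fg: "f \<in> S" "g \<in> S" "(z * f) mod p = (z * g) mod p"
    then have "p dvd z * f - z * g" by (simp add: mod_eq_dvd_iff)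
    then have "p dvd f - g" using assms by (simp add: prime_elem_dvd_mult_iff flip: right_diff_distrib)
    moreover have "f - g = 0 \<or> degree (f - g) < degree p"
      using fg degree_diff_le_max[of f g] assms(2) by (auto simp: S_def)
    ultimately show "f = g" using dvd_imp_degree_le[of p "f - g"] by (cases "f = g") auto
  qed
  have "(\<lambda>f. (z * f) mod p) ` S = S"
    using mem by (intro endo_inj_surj[OF fin _ inj]) auto
  then have "\<Prod>S = (\<Prod>f\<in>S. (z * f) mod p)"
    using prod.reindex[OF inj, of "\<lambda>x. x"] by simp
  also have "pcong p \<dots> (\<Prod>f\<in>S. z * f)"
    using fin
  proof (induction S rule: finite_induct)
    case (insert f F)
    have "pcong p ((z * f) mod p) (z * f)"
      unfolding pcong_def by (metis dvd_minus_mod minus_diff_eq dvd_minus_iff)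
    then show ?case using insert by (auto intro: pcong_mult)
  qed simp
  also have "(\<Prod>f\<in>S. z * f) = z ^ card S * \<Prod>S"
    by (simp add: prod.distrib)
  finally have "p dvd \<Prod>S - z ^ card S * \<Prod>S" by (simp add: pcong_def)
  then have "p dvd (z ^ card S - 1) * \<Prod>S"
    by (metis dvd_minus_iff left_diff_distrib minus_diff_eq mult_1)
  moreover have "\<not> p dvd \<Prod>S"
    using fin ndvd
  proof (induction S rule: finite_induct)
    case empty
    then show ?case using assms(1) by auto
  next
    case (insert f F)
    then show ?case using assms(1) by (simp add: prime_elem_dvd_mult_iff)
  qed
  ultimately show ?thesis
    using assms(1) prime_elem_dvd_mult_iff card by (auto simp: pcong_def)
qed

text \<open>2 generates the units modulo 3, and \<open>2 ^ 2\<close> is not 1 modulo 9, which is the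
  criterion for lifting a primitive root to all powers of 3.\<close>

lemma two_residue_primroot_power_3: "residue_primroot (3 ^ Suc k) 2"
proof -
  have p3: "prime (3 :: nat)" by simp
  have ord: "ord (3 :: nat) (2 :: nat) = 2"
  proof -
    have "ord (3 :: nat) (2 :: nat) dvd 2" by (subst ord_divides[symmetric]) (simp add: cong_def)
    moreover have "\<not> ord (3 :: nat) (2 :: nat) dvd 1" by (subst ord_divides[symmetric]) (simp add: cong_def)
    ultimately show ?thesis by (metis dvd_refl one_dvd prime_nat_iff two_is_prime_nat)
  qed
  have "residue_primroot 3 2"
    by (simp add: residue_primroot_def ord totient_prime p3)
  then have "\<forall>k>0. residue_primroot (3 ^ k) 2"
    by (subst residue_primroot_prime_lift_iff) (auto simp: cong_def)
  then show ?thesis by blast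
qed

text \<open>With \<open>M = 3 ^ k\<close>, \<open>z^(3M) + 1\<close> is the product of
  \<open>z^M + 1\<close> and \<open>\<Phi>\<close>. Modulo a prime factor \<open>p\<close> of
  \<open>\<Phi>\<close> the variable \<open>z\<close> has order exactly \<open>3 * M\<close>. By
  Fermat this order divides \<open>2 ^ degree p - 1\<close>, so the degree is a multiple of the
  order of 2 modulo \<open>3 ^ Suc k\<close>, which is \<open>2 * 3 ^ k\<close>.\<close>

lemma cyc_large_prime_factor:
  obtains p where "prime_elem p" "p dvd cyc (3 * 3 ^ k)" "2 * 3 ^ k \<le> degree p"
proof -
  define M :: nat where "M = 3 ^ k"
  define z :: "bit poly" where "z = monom 1 1"
  have z: "monom 1 e = z ^ e" for e by (simp add: z_def monom_power)
  define \<Phi> where "\<Phi> = z ^ (2 * M) + z ^ M + 1"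
  have M: "M > 0" by (simp add: M_def)
  have "degree \<Phi> \<ge> 2 * M"
    by (rule le_degree) (use M in \<open>simp add: \<Phi>_def flip: z\<close>)
  then obtain p where p: "prime_elem p" "p dvd \<Phi>" "degree p > 0"
    using irreducible_factor_exists[of \<Phi>] M by auto
  let ?q = "z ^ M"
  have "3 * M = M + M + M" by simp
  then have q: "z ^ (2 * M) = ?q * ?q" "z ^ (3 * M) = ?q * ?q * ?q"
    by (simp_all only: mult_2 power_add)
  have "(?q * ?q + ?q + 1) * (?q + 1) = ?q * ?q * ?q + 1 + (?q * ?q + ?q * ?q) + (?q + ?q)"
    by (simp only: distrib_left distrib_right mult_1_left mult_1_right ac_simps)
  then have "cyc (3 * M) = \<Phi> * (?q + 1)"
    by (simp add: cyc_def z \<Phi>_def q)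
  then have pc: "p dvd cyc (3 * M)" using p(2) by simp
  have nu: "\<not> p dvd 1" using p(1) by auto
  have c3: "pcong p (z ^ (3 * M)) 1"
    using pc by (simp add: pcong_def bit_poly_minus cyc_def z)
  have nz: "\<not> p dvd z"
  proof
    assume "p dvd z"
    then have "p dvd z ^ (3 * M)" by (rule dvd_trans, intro dvd_power) (use M in simp)
    then show False using pc nu unfolding cyc_def z by (simp add: dvd_add_right_iff)
  qed
  \<comment> \<open>If \<open>z ^ M\<close> were 1, then \<open>\<Phi>\<close> would be
    \<open>1 + 1 + 1 = 1\<close> modulo \<open>p\<close>.\<close>
  have nM: "\<not> pcong p (z ^ M) 1"
  proof
    assume h: "pcong p (z ^ M) 1"
    have "pcong p (z ^ (2 * M)) 1" using pcong_power[OF h, of 2] by (simp add: power_mult mult.commute)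
    then have "pcong p \<Phi> (1 + 1 + 1)" unfolding \<Phi>_def by (intro pcong_add h pcong_refl)
    then have "pcong p \<Phi> 1" by (simp only: bit_poly_add_self add_0_left)
    then show False using p(2) nu dvd_diff[of p \<Phi> "\<Phi> - 1"] by (simp add: pcong_def)
  qed
  let ?a = "2 ^ degree p - 1 :: nat"
  have "(2::nat) ^ degree p > 1" using p(3) by (rule one_less_power[rotated]) simp
  then have a0: "?a \<noteq> 0" by simp
  \<comment> \<open>Both \<open>?a\<close> and \<open>3 ^ Suc k\<close> are exponents that send
    \<open>z\<close> to 1, hence so is their gcd \<open>?r\<close>. It is a power of 3, and a proper
    one would divide \<open>M\<close>.\<close>
  obtain x y where xy: "?a * x = 3 ^ Suc k * y + gcd ?a (3 ^ Suc k)"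
    using bezout_nat[OF a0, of "3 ^ Suc k"] by blast
  let ?r = "gcd ?a (3 ^ Suc k)"
  have "pcong p (z ^ (?a * x)) 1"
    using pcong_power[OF poly_fermat[OF p(1,3) nz], of x] by (simp add: power_mult)
  then have "pcong p (z ^ (3 ^ Suc k * y) * z ^ ?r) 1" by (simp only: xy power_add)
  moreover have "pcong p (z ^ (3 ^ Suc k * y) * z ^ ?r) (1 * z ^ ?r)"
  proof (rule pcong_mult)
    have "z ^ (3 ^ Suc k * y) = (z ^ (3 * M)) ^ y"
      unfolding power_mult[symmetric] M_def by simp
    then show "pcong p (z ^ (3 ^ Suc k * y)) 1" using pcong_power[OF c3, of y] by simp
  qed simp
  ultimately have r: "pcong p (z ^ ?r) 1" using pcong_trans pcong_sym unfolding mult_1 by blast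
  have "?r dvd 3 ^ Suc k" by simp
  then obtain j where j: "j \<le> Suc k" "?r = 3 ^ j" by (subst (asm) divides_primepow_nat) auto
  have "j = Suc k"
  proof (rule ccontr)
    assume "j \<noteq> Suc k"
    then have "3 ^ j dvd M" using j unfolding M_def by (intro le_imp_power_dvd) auto
    then obtain q where "M = ?r * q" using j(2) by (metis dvdE)
    then have "pcong p (z ^ M) 1" using pcong_power[OF r, of q] by (simp add: power_mult)
    then show False using nM by blast
  qed
  then have "3 ^ Suc k dvd ?a" using j(2) by (metis gcd_dvd1)
  then have "[2 ^ degree p = (1 :: nat)] (mod 3 ^ Suc k)"
    by (subst cong_altdef_nat) simp_all
  then have "ord (3 ^ Suc k) (2 :: nat) dvd degree p" by (simp only: ord_divides)
  moreover have "ord (3 ^ Suc k) (2 :: nat) = 2 * 3 ^ k"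
    using two_residue_primroot_power_3[of k] totient_prime_power_Suc[of 3 k]
    by (simp add: residue_primroot_def)
  ultimately have "2 * 3 ^ k \<le> degree p" using p(3) by (metis dvd_imp_le)
  then show ?thesis using that[of p] p pc by (simp add: M_def)
qed

section \<open>Multilinear polynomials rarely vanish\<close>

lemma measure_bind_pmf_le:
  assumes "\<And>y. measure_pmf.prob (f y) X \<le> e"
  shows "measure_pmf.prob (bind_pmf P f) X \<le> e"
proof -
  have e: "0 \<le> e" using assms measure_nonneg order_trans by blast
  have "emeasure (bind_pmf P f) X = (\<integral>\<^sup>+y. emeasure (f y) X \<partial>P)" by (rule emeasure_bind_pmf)
  also have "\<dots> \<le> (\<integral>\<^sup>+y. ennreal e \<partial>P)"
    using assms by (intro nn_integral_mono) (auto simp: measure_pmf.emeasure_eq_measure intro: ennreal_leI)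
  also have "\<dots> = ennreal e" by simp
  finally show ?thesis using e by (simp add: measure_pmf.emeasure_eq_measure)
qed

text \<open>The Schwartz-Zippel argument: as a polynomial in variable \<open>i\<close> the sum is
  \<open>A + f x * B\<close>. Either \<open>B\<close> vanishes, which is covered by induction since
  its degree is at most \<open>d - 1\<close>, or the other variables leave at most an
  \<open>\<epsilon>\<close> fraction of values for \<open>x\<close>. The bound counts the degree,
  not the variables. A nonempty family is a nonzero polynomial because different sets are different
  monomials.\<close>

lemma multilinear_vanish_prob:
  fixes f :: "'a \<Rightarrow> 'r::comm_ring_1" and \<mu> :: "'a pmf" and I :: "'i set"
  assumes step: "\<And>a b. \<not> p dvd b \<Longrightarrow> measure_pmf.prob \<mu> {x. p dvd a + f x * b} \<le> \<epsilon>"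
    and unit: "\<not> p dvd 1" and nonneg: "0 \<le> \<epsilon>"
    and "finite I" "\<S> \<subseteq> Pow I" "\<S> \<noteq> {}" "\<And>S. S \<in> \<S> \<Longrightarrow> card S \<le> d"
  shows "measure_pmf.prob (Pi_pmf I dflt (\<lambda>_. \<mu>)) {\<omega>. p dvd (\<Sum>S\<in>\<S>. \<Prod>i\<in>S. f (\<omega> i))} \<le> d * \<epsilon>"
  using assms(4-7)
proof (induction I arbitrary: \<S> d rule: finite_induct)
  case empty
  then have "\<S> = {{}}" by auto
  then show ?case using unit nonneg by simp
next
  case (insert i I)
  define \<S>0 where "\<S>0 = {S \<in> \<S>. i \<notin> S}"
  define \<S>1 where "\<S>1 = (\<lambda>S. S - {i}) ` {S \<in> \<S>. i \<in> S}"
  let ?P = "Pi_pmf I dflt (\<lambda>_. \<mu>)"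
  define A where "A \<omega> = (\<Sum>S\<in>\<S>0. \<Prod>i\<in>S. f (\<omega> i))" for \<omega>
  define B where "B \<omega> = (\<Sum>S\<in>\<S>1. \<Prod>i\<in>S. f (\<omega> i))" for \<omega>
  have fin: "finite \<S>" using insert.prems(1) insert.hyps(1) finite_subset by fastforce
  have sub: "\<S>0 \<subseteq> Pow I" "\<S>1 \<subseteq> Pow I" using insert.prems(1) by (auto simp: \<S>0_def \<S>1_def)
  have finS: "finite S" if "S \<in> \<S>" for S
    using that insert.prems(1) insert.hyps(1) by (meson PowD finite.insertI finite_subset subsetD)
  have split: "(\<Sum>S\<in>\<S>. \<Prod>j\<in>S. f ((fun_upd \<omega> i x) j)) = A \<omega> + f x * B \<omega>" for \<omega> x
  proof -
    let ?g = "\<lambda>S. \<Prod>j\<in>S. f ((fun_upd \<omega> i x) j)"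
    have "\<S> = \<S>0 \<union> {S \<in> \<S>. i \<in> S}" by (auto simp: \<S>0_def)
    then have "sum ?g \<S> = sum ?g \<S>0 + sum ?g {S \<in> \<S>. i \<in> S}"
      using fin sum.union_disjoint[of \<S>0 "{S \<in> \<S>. i \<in> S}" ?g] by (auto simp: \<S>0_def)
    also have "sum ?g \<S>0 = A \<omega>"
      unfolding A_def by (intro sum.cong prod.cong refl) (auto simp: \<S>0_def)
    also have "sum ?g {S \<in> \<S>. i \<in> S} = (\<Sum>S\<in>{S \<in> \<S>. i \<in> S}. f x * (\<Prod>j\<in>S - {i}. f (\<omega> j)))"
    proof (rule sum.cong[OF refl])
      fix S assume S: "S \<in> {S \<in> \<S>. i \<in> S}"
      have "?g S = f ((fun_upd \<omega> i x) i) * (\<Prod>j\<in>S - {i}. f ((fun_upd \<omega> i x) j))"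
        using S finS by (intro prod.remove) auto
      also have "(\<Prod>j\<in>S - {i}. f ((fun_upd \<omega> i x) j)) = (\<Prod>j\<in>S - {i}. f (\<omega> j))"
        by (rule prod.cong) auto
      finally show "?g S = f x * (\<Prod>j\<in>S - {i}. f (\<omega> j))" by simp
    qed
    also have "\<dots> = f x * B \<omega>"
    proof -
      have "inj_on (\<lambda>S. S - {i}) {S \<in> \<S>. i \<in> S}" by (auto simp: inj_on_def)
      then show ?thesis by (simp add: B_def \<S>1_def sum.reindex sum_distrib_left)
    qed
    finally show ?thesis .
  qed
  have "measure_pmf.prob (Pi_pmf (insert i I) dflt (\<lambda>_. \<mu>)) {\<omega>. p dvd (\<Sum>S\<in>\<S>. \<Prod>i\<in>S. f (\<omega> i))} =
      measure_pmf.prob (pair_pmf \<mu> ?P) {(x, \<omega>). p dvd A \<omega> + f x * B \<omega>}"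
    using insert.hyps by (subst Pi_pmf_insert)
      (simp_all add: vimage_def split case_prod_unfold del: fun_upd_apply)
  also have "\<dots> \<le> d * \<epsilon>"
  proof (cases "\<S>1 = {}")
    case True
    then have "\<S> = \<S>0" by (auto simp: \<S>0_def \<S>1_def)
    have "measure_pmf.prob (pair_pmf \<mu> ?P) {(x, \<omega>). p dvd A \<omega> + f x * B \<omega>} =
        measure_pmf.prob (map_pmf snd (pair_pmf \<mu> ?P)) {\<omega>. p dvd A \<omega>}"
      using True by (simp add: B_def vimage_def case_prod_unfold)
    also have "\<dots> \<le> d * \<epsilon>"
      unfolding map_snd_pair_pmf A_def \<open>\<S> = \<S>0\<close>[symmetric]
      by (rule insert.IH) (use sub insert.prems \<open>\<S> = \<S>0\<close> in auto)
    finally show ?thesis .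
  next
    case False
    then obtain S where S: "S \<in> \<S>" "i \<in> S" by (auto simp: \<S>1_def)
    then have d: "1 \<le> d" using insert.prems(3)[OF S(1)] finS[OF S(1)]
      by (metis One_nat_def Suc_leI card_gt_0_iff empty_iff le_trans)
    have c1: "card S \<le> d - 1" if mem: "S \<in> \<S>1" for S
    proof -
      obtain S' where S': "S' \<in> {S \<in> \<S>. i \<in> S}" "S = S' - {i}"
        using mem unfolding \<S>1_def by (rule imageE)
      then show ?thesis using insert.prems(3)[of S'] by simp
    qed
    have "measure_pmf.prob (pair_pmf \<mu> ?P) {(x, \<omega>). p dvd A \<omega> + f x * B \<omega>} \<le>
       measure_pmf.prob (pair_pmf \<mu> ?P)
         ({(x, \<omega>). p dvd B \<omega>} \<union> {(x, \<omega>). \<not> p dvd B \<omega> \<and> p dvd A \<omega> + f x * B \<omega>})"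
      by (intro measure_pmf.finite_measure_mono) auto
    also have "\<dots> \<le> measure_pmf.prob (pair_pmf \<mu> ?P) {(x, \<omega>). p dvd B \<omega>} +
       measure_pmf.prob (pair_pmf \<mu> ?P) {(x, \<omega>). \<not> p dvd B \<omega> \<and> p dvd A \<omega> + f x * B \<omega>}"
      by (intro measure_Un_le) auto
    also have "measure_pmf.prob (pair_pmf \<mu> ?P) {(x, \<omega>). p dvd B \<omega>} =
        measure_pmf.prob (map_pmf snd (pair_pmf \<mu> ?P)) {\<omega>. p dvd B \<omega>}"
      by (simp add: vimage_def case_prod_unfold)
    also have "\<dots> \<le> real (d - 1) * \<epsilon>"
      unfolding map_snd_pair_pmf B_def by (rule insert.IH) (use sub False c1 in auto)
    also have "measure_pmf.prob (pair_pmf \<mu> ?P) {(x, \<omega>). \<not> p dvd B \<omega> \<and> p dvd A \<omega> + f x * B \<omega>} \<le> \<epsilon>"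
    proof -
      \<comment> \<open>Draw the other variables first, so that \<open>A\<close> and
        \<open>B\<close> are fixed when \<open>x\<close> is drawn.\<close>
      have "pair_pmf \<mu> ?P = bind_pmf ?P (\<lambda>\<omega>. map_pmf (\<lambda>x. (x, \<omega>)) \<mu>)"
        unfolding pair_pmf_def map_pmf_def by (rule bind_commute_pmf)
      moreover have "measure_pmf.prob (map_pmf (\<lambda>x. (x, \<omega>)) \<mu>)
          {(x, \<omega>). \<not> p dvd B \<omega> \<and> p dvd A \<omega> + f x * B \<omega>} \<le> \<epsilon>" for \<omega>
        using step[of "B \<omega>" "A \<omega>"] nonneg by (cases "p dvd B \<omega>") (auto simp: vimage_def)
      ultimately show ?thesis by (simp add: measure_bind_pmf_le)
    qed
    also have "real (d - 1) * \<epsilon> + \<epsilon> = d * \<epsilon>" using d by (simp add: of_nat_diff algebra_simps)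
    finally show ?thesis by simp
  qed
  finally show ?case .
qed

text \<open>Two words in the event that agree except in their lowest \<open>degree p\<close> bits
  differ by a polynomial of smaller degree that \<open>p\<close> divides, so they are equal. The
  bits above thus determine the word.\<close>

lemma word_vanish_prob:
  fixes p :: "bit poly"
  assumes "prime_elem p" "degree p \<le> N" "N \<le> w" "\<not> p dvd b"
  shows "measure_pmf.prob (pmf_of_set {..<2 ^ w}) {x. p dvd a + word_poly (x mod 2 ^ N) * b}
    \<le> 1 / 2 ^ degree p"
proof -
  let ?d = "degree p"
  let ?S = "{..<2 ^ w} \<inter> {x. p dvd a + word_poly (x mod 2 ^ N) * b}"
  have pow: "(2::nat) ^ w = 2 ^ (w - ?d) * 2 ^ ?d" using assms by (simp flip: power_add)
  have "card ?S \<le> card {..<2 ^ (w - ?d) :: nat}"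
  proof (rule card_inj_on_le)
    show "(\<lambda>x. x div 2 ^ ?d) ` ?S \<subseteq> {..<2 ^ (w - ?d)}"
      using pow by (auto simp: less_mult_imp_div_less)
    show "inj_on (\<lambda>x. x div 2 ^ ?d) ?S"
    proof (rule inj_onI)
      fix x y assume xy: "x \<in> ?S" "y \<in> ?S" "x div 2 ^ ?d = y div 2 ^ ?d"
      let ?u = "Bit_Operations.xor (x mod 2 ^ N) (y mod 2 ^ N)"
      have "p dvd (a + word_poly (x mod 2 ^ N) * b) + (a + word_poly (y mod 2 ^ N) * b)"
        using xy by (intro dvd_add[of p "_ + _" "_ + _"]) simp_all
      also have "\<dots> = word_poly ?u * b + (a + a)"
        by (simp add: word_poly_xor algebra_simps)
      finally have dvd: "p dvd word_poly ?u"
        using assms by (simp add: prime_elem_dvd_mult_iff)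
      have "drop_bit ?d ?u = 0"
        using xy(3) by (simp add: drop_bit_xor drop_bit_take_bit flip: take_bit_eq_mod drop_bit_eq_div)
      then have "?u < 2 ^ ?d" by (simp add: drop_bit_eq_div div_eq_0_iff)
      then have "word_poly ?u = 0"
        using dvd dvd_imp_degree_le[of p "word_poly ?u"] less_power_iff_degree_word_poly[of ?u ?d]
        by (cases "word_poly ?u = 0") auto
      then have "x mod 2 ^ N = y mod 2 ^ N"
        by (simp add: word_poly_xor word_poly_inject flip: bit_poly_eq_iff)
      then have "x mod 2 ^ ?d = y mod 2 ^ ?d"
        using mod_mod_cancel[of "2 ^ ?d" "2 ^ N :: nat"] assms(2) by (metis le_imp_power_dvd)
      then show "x = y" using xy(3) by (metis div_mult_mod_eq)
    qed
  qed simp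
  then have "real (card ?S) \<le> 2 ^ (w - ?d)" by (simp flip: of_nat_le_iff)
  then have "real (card ?S) / 2 ^ w \<le> 2 ^ (w - ?d) / 2 ^ w" by (rule divide_right_mono) simp
  also have "(2::real) ^ w = 2 ^ (w - ?d) * 2 ^ ?d" using assms by (simp flip: power_add)
  then have "(2::real) ^ (w - ?d) / 2 ^ w = 1 / 2 ^ ?d" by simp
  also have "real (card ?S) / 2 ^ w =
      measure_pmf.prob (pmf_of_set {..<2 ^ w}) {x. p dvd a + word_poly (x mod 2 ^ N) * b}"
    by (subst measure_pmf_of_set) (auto simp: lessThan_empty_iff)
  finally show ?thesis .
qed

section \<open>Sums over paths in a directed acyclic graph\<close>

fun pth :: "('v \<times> 'v) set \<Rightarrow> 'v \<Rightarrow> ('v \<times> 'v) list \<Rightarrow> 'v \<Rightarrow> bool" where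
  "pth T u [] v \<longleftrightarrow> u = v"
| "pth T u (e # p) v \<longleftrightarrow> e \<in> T \<and> fst e = u \<and> pth T (snd e) p v"

definition paths :: "('v \<times> 'v) set \<Rightarrow> 'v \<Rightarrow> 'v \<Rightarrow> ('v \<times> 'v) list set" where
  "paths T u v = {p. pth T u p v}"

definition path_verts :: "'v \<Rightarrow> ('v \<times> 'v) list \<Rightarrow> 'v set" where
  "path_verts u p = insert u (snd ` set p)"

definition weight :: "('e \<Rightarrow> 'r::comm_ring_1) \<Rightarrow> 'e list \<Rightarrow> 'r" where
  "weight x p = prod_list (map x p)"

definition path_sum :: "('v \<times> 'v) set \<Rightarrow> ('v \<times> 'v \<Rightarrow> 'r::comm_ring_1) \<Rightarrow> 'v \<Rightarrow> 'v \<Rightarrow> 'r" where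
  "path_sum T x u v = (\<Sum>p\<in>paths T u v. weight x p)"

lemma pth_append: "pth T u (p @ q) v \<longleftrightarrow> (\<exists>a. pth T u p a \<and> pth T a q v)"
  by (induction p arbitrary: u) auto

lemma pth_subset: "pth T u p v \<Longrightarrow> set p \<subseteq> T"
  by (induction p arbitrary: u) auto

lemma pth_mono: "pth T u p v \<Longrightarrow> set p \<subseteq> T' \<Longrightarrow> pth T' u p v"
  by (induction p arbitrary: u) auto

lemma pth_end_unique: "pth T u p v \<Longrightarrow> pth T' u p v' \<Longrightarrow> v = v'"
  by (induction p arbitrary: u) auto

lemma path_verts_Nil [simp]: "path_verts u [] = {u}"
  by (simp add: path_verts_def)

lemma path_verts_Cons [simp]: "path_verts u (e # p) = insert u (path_verts (snd e) p)"
  by (auto simp: path_verts_def)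

lemma path_verts_append:
  "pth T u p a \<Longrightarrow> path_verts u (p @ q) = path_verts u p \<union> path_verts a q"
  by (induction p arbitrary: u) (auto simp: path_verts_def)

lemma start_in_path_verts [simp]: "u \<in> path_verts u p"
  by (simp add: path_verts_def)

lemma end_in_path_verts: "pth T u p v \<Longrightarrow> v \<in> path_verts u p"
  by (induction p arbitrary: u) auto

lemma tail_in_path_verts: "pth T u p v \<Longrightarrow> e \<in> set p \<Longrightarrow> fst e \<in> path_verts u p"
  by (induction p arbitrary: u) auto

lemma head_in_path_verts: "e \<in> set p \<Longrightarrow> snd e \<in> path_verts u p"
  by (simp add: path_verts_def)

lemma path_verts_cases:
  "pth T u p v \<Longrightarrow> a \<in> path_verts u p \<Longrightarrow> a = u \<or> (\<exists>e\<in>set p. snd e = a)"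
  by (auto simp: path_verts_def)

lemma path_verts_cases':
  "pth T u p v \<Longrightarrow> a \<in> path_verts u p \<Longrightarrow> a = v \<or> (\<exists>e\<in>set p. fst e = a)"
  by (induction p arbitrary: u) auto

lemma path_split:
  assumes "pth T u p v" "a \<in> path_verts u p"
  obtains q r where "p = q @ r" "pth T u q a" "pth T a r v"
  using assms
proof (induction p arbitrary: u thesis)
  case Nil
  then show ?case by (auto intro: Nil.prems(1)[of "[]" "[]"])
next
  case (Cons e p)
  show ?case
  proof (cases "a = u")
    case True
    then show ?thesis using Cons.prems(1)[of "[]" "e # p"] Cons.prems(2) by auto
  next
    case False
    then have "a \<in> path_verts (snd e) p" using Cons.prems(3) by simp
    from Cons.IH[OF _ _ this] Cons.prems(2) obtain q r where
      "p = q @ r" "pth T (snd e) q a" "pth T a r v" by auto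
    then show ?thesis using Cons.prems(1)[of "e # q" r] Cons.prems(2) by auto
  qed
qed

lemma weight_Nil [simp]: "weight x [] = 1"
  and weight_Cons [simp]: "weight x (e # p) = x e * weight x p"
  and weight_append: "weight x (p @ q) = weight x p * weight x q"
  by (auto simp: weight_def)

lemma weight_cong: "(\<And>e. e \<in> set p \<Longrightarrow> x e = y e) \<Longrightarrow> weight x p = weight y p"
  unfolding weight_def by (intro arg_cong[of _ _ prod_list] map_cong) auto

text \<open>Acyclicity takes the form of a rank that grows along edges; it doubles as an induction
  measure and tells which of several vertices on a path comes first.\<close>

locale dag =
  fixes E :: "('v \<times> 'v) set" and \<rho> :: "'v \<Rightarrow> nat"
  assumes finite_E: "finite E"
    and rank: "e \<in> E \<Longrightarrow> \<rho> (fst e) < \<rho> (snd e)"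
begin

lemma rank_start:
  "pth E u p v \<Longrightarrow> a \<in> path_verts u p \<Longrightarrow> a = u \<or> \<rho> u < \<rho> a"
proof (induction p arbitrary: u)
  case (Cons e p)
  then have "\<rho> u < \<rho> (snd e)" using rank by auto
  with Cons show ?case by fastforce
qed auto

lemma rank_end:
  "pth E u p v \<Longrightarrow> a \<in> path_verts u p \<Longrightarrow> a = v \<or> \<rho> a < \<rho> v"
proof (induction p arbitrary: u)
  case (Cons e p)
  then have "\<rho> u < \<rho> (snd e)" using rank by auto
  moreover have "snd e = v \<or> \<rho> (snd e) < \<rho> v"
    using rank_start[of "snd e" p v v] end_in_path_verts[of E "snd e" p v] Cons.prems by auto
  ultimately show ?case using Cons by fastforce
qed auto

lemma rank_le: "pth E u p v \<Longrightarrow> \<rho> u \<le> \<rho> v"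
  using rank_start end_in_path_verts by fastforce

lemma pth_closed: "pth E u p u \<Longrightarrow> p = []"
proof (cases p)
  case (Cons e q)
  assume "pth E u p u"
  then have "\<rho> (snd e) \<le> \<rho> u" "\<rho> u < \<rho> (snd e)" using Cons rank rank_le by auto
  then show ?thesis by simp
qed

lemma distinct_tails: "pth E u p v \<Longrightarrow> distinct (map fst p)"
proof (induction p arbitrary: u)
  case (Cons e p)
  have "fst e \<noteq> fst e'" if "e' \<in> set p" for e'
  proof -
    have "fst e' \<in> path_verts (snd e) p" using Cons.prems tail_in_path_verts[of E "snd e" p v e'] that by auto
    then have "\<rho> (snd e) \<le> \<rho> (fst e')" using rank_start[of "snd e" p v] Cons.prems by fastforce
    moreover have "\<rho> (fst e) < \<rho> (snd e)" using rank Cons.prems by auto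
    ultimately show ?thesis by auto
  qed
  then show ?case using Cons by auto
qed simp

lemma pth_E: "T \<subseteq> E \<Longrightarrow> pth T u p v \<Longrightarrow> pth E u p v"
  by (rule pth_mono[of T u p v E]) (auto dest: pth_subset)

lemma finite_paths:
  assumes "T \<subseteq> E"
  shows "finite (paths T u v)"
proof -
  have "paths T u v \<subseteq> {p. set p \<subseteq> E \<and> distinct p}"
  proof
    fix p assume "p \<in> paths T u v"
    then have "pth E u p v" using pth_E assms by (auto simp: paths_def)
    then show "p \<in> {p. set p \<subseteq> E \<and> distinct p}"
      using distinct_tails[of u p v] pth_subset[of E u p v] by (simp add: distinct_map)
  qed
  then show ?thesis using finite_subset_distinct[OF finite_E] finite_subset by blast
qed

text \<open>If one prefix were longer, its surplus would be a closed path at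
  \<open>a\<close>.\<close>

lemma split_unique:
  assumes "p @ p' = q @ q'" "pth E u p a" "pth E u q a"
  shows "p = q \<and> p' = q'"
proof -
  from assms(1) consider us where "p = q @ us" | us where "q = p @ us"
    by (auto simp: append_eq_append_conv2)
  then show ?thesis
  proof cases
    case 1
    then have "pth E a us a" using assms pth_end_unique by (fastforce simp: pth_append)
    then show ?thesis using 1 pth_closed assms(1) by auto
  next
    case 2
    then have "pth E a us a" using assms pth_end_unique by (fastforce simp: pth_append)
    then show ?thesis using 2 pth_closed assms(1) by auto
  qed
qed

lemma path_sum_self: "T \<subseteq> E \<Longrightarrow> path_sum T x u u = 1"
proof -
  assume "T \<subseteq> E"
  then have "paths T u u = {[]}" using pth_closed[OF pth_E[of T]] by (auto simp: paths_def)
  then show ?thesis by (simp add: path_sum_def)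
qed

lemma path_sum_eq_0_rank: "T \<subseteq> E \<Longrightarrow> \<rho> v < \<rho> u \<Longrightarrow> path_sum T x u v = 0"
proof -
  assume "T \<subseteq> E" "\<rho> v < \<rho> u"
  then have "\<not> pth T u p v" for p using rank_le[OF pth_E, of T u p v] by auto
  then have "paths T u v = {}" by (simp add: paths_def)
  then show ?thesis by (simp add: path_sum_def)
qed

lemma path_sum_last:
  assumes "T \<subseteq> E"
  shows "path_sum T x u v =
    (if u = v then 1 else 0) + (\<Sum>e\<in>{e \<in> T. snd e = v}. x e * path_sum T x u (fst e))"
proof -
  let ?I = "{e \<in> T. snd e = v}"
  let ?J = "Sigma ?I (\<lambda>e. paths T u (fst e))"
  have fin: "finite ?I" using finite_subset[OF assms finite_E] by simp
  have eq: "paths T u v = (if u = v then {[]} else {}) \<union> (\<lambda>(e, p). p @ [e]) ` ?J"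
  proof (rule Set.set_eqI, rule iffI)
    fix p assume p: "p \<in> paths T u v"
    show "p \<in> (if u = v then {[]} else {}) \<union> (\<lambda>(e, p). p @ [e]) ` ?J"
    proof (cases p rule: rev_cases)
      case Nil then show ?thesis using p by (simp add: paths_def)
    next
      case (snoc q e)
      then show ?thesis using p by (force simp: paths_def pth_append)
    qed
  qed (auto simp: paths_def pth_append split: if_splits)
  have inj: "inj_on (\<lambda>(e, p). p @ [e]) ?J" by (auto simp: inj_on_def)
  have finJ: "finite ?J" using fin finite_paths[OF assms] by (intro finite_SigmaI) auto
  have "path_sum T x u v = (\<Sum>p\<in>(if u = v then {[]} else {}). weight x p) +
      (\<Sum>p\<in>(\<lambda>(e, p). p @ [e]) ` ?J. weight x p)"
    unfolding path_sum_def eq by (rule sum.union_disjoint) (use finJ in auto)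
  also have "(\<Sum>p\<in>(\<lambda>(e, p). p @ [e]) ` ?J. weight x p) = (\<Sum>(e, p)\<in>?J. x e * weight x p)"
    by (subst sum.reindex[OF inj]) (auto simp: weight_append mult.commute intro!: sum.cong)
  also have "\<dots> = (\<Sum>e\<in>?I. x e * path_sum T x u (fst e))"
    unfolding path_sum_def sum_distrib_left
    by (rule sum.Sigma[symmetric]) (use fin finite_paths[OF assms] in auto)
  finally show ?thesis by (simp split: if_splits)
qed

lemma path_sum_first:
  assumes "T \<subseteq> E"
  shows "path_sum T x u v =
    (if u = v then 1 else 0) + (\<Sum>e\<in>{e \<in> T. fst e = u}. x e * path_sum T x (snd e) v)"
proof -
  let ?I = "{e \<in> T. fst e = u}"
  let ?J = "Sigma ?I (\<lambda>e. paths T (snd e) v)"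
  have fin: "finite ?I" using finite_subset[OF assms finite_E] by simp
  have eq: "paths T u v = (if u = v then {[]} else {}) \<union> (\<lambda>(e, p). e # p) ` ?J"
  proof (rule Set.set_eqI, rule iffI)
    fix p assume p: "p \<in> paths T u v"
    show "p \<in> (if u = v then {[]} else {}) \<union> (\<lambda>(e, p). e # p) ` ?J"
      using p by (cases p) (force simp: paths_def)+
  qed (auto simp: paths_def split: if_splits)
  have inj: "inj_on (\<lambda>(e, p). e # p) ?J" by (auto simp: inj_on_def)
  have finJ: "finite ?J" using fin finite_paths[OF assms] by (intro finite_SigmaI) auto
  have "path_sum T x u v = (\<Sum>p\<in>(if u = v then {[]} else {}). weight x p) +
      (\<Sum>p\<in>(\<lambda>(e, p). e # p) ` ?J. weight x p)"
    unfolding path_sum_def eq by (rule sum.union_disjoint) (use finJ in auto)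
  also have "(\<Sum>p\<in>(\<lambda>(e, p). e # p) ` ?J. weight x p) = (\<Sum>(e, p)\<in>?J. x e * weight x p)"
    by (subst sum.reindex[OF inj]) (auto intro!: sum.cong)
  also have "\<dots> = (\<Sum>e\<in>?I. x e * path_sum T x (snd e) v)"
    unfolding path_sum_def sum_distrib_left
    by (rule sum.Sigma[symmetric]) (use fin finite_paths[OF assms] in auto)
  finally show ?thesis by (simp split: if_splits)
qed

text \<open>A path has only one edge out of each of its vertices. Hence \<open>q\<close>, which
  starts on \<open>p\<close> and by the third assumption uses an edge of \<open>p\<close> at every
  vertex of \<open>p\<close>, can never leave it. This is how a path is recovered from its
  monomial.\<close>

lemma path_eqI:
  assumes "pth E s p t" "pth E s q t"
    "\<And>e. e \<in> set q \<Longrightarrow> fst e \<in> path_verts s p \<Longrightarrow> e \<in> set p"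
  shows "p = q"
  using assms
proof (induction p arbitrary: s q)
  case Nil
  then show ?case using pth_closed by auto
next
  case (Cons e p)
  show ?case
  proof (cases q)
    case Nil
    then show ?thesis using Cons.prems pth_closed[of s "e # p"] by auto
  next
    case (Cons e' q')
    have e': "e' \<in> set (e # p)" "fst e' = fst e" "e' \<in> E" using Cons.prems Cons by auto
    have "distinct (map fst (e # p))" using distinct_tails Cons.prems(1) by blast
    then have [simp]: "e' = e" using e' by (auto simp: rev_image_eqI)
    have "p = q'"
    proof (rule Cons.IH)
      show "pth E (snd e) p t" "pth E (snd e) q' t" using Cons.prems Cons by auto
      fix d assume d: "d \<in> set q'" "fst d \<in> path_verts (snd e) p"
      have "distinct (map fst (e # q'))" using distinct_tails[OF Cons.prems(2)] Cons by simp
      then have "d \<noteq> e" using d by auto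
      then show "d \<in> set p" using Cons.prems(3)[of d] d Cons by auto
    qed
    then show ?thesis using Cons by simp
  qed
qed

end

section \<open>Pairs of paths\<close>

lemma char_2_add_self: "(1 :: 'r::comm_ring_1) + 1 = 0 \<Longrightarrow> (a :: 'r) + a = 0"
  by (metis distrib_left mult.right_neutral mult_zero_right)

lemma char_2_square_sum:
  assumes "(1 :: 'r::comm_ring_1) + 1 = 0"
  shows "(\<Sum>i\<in>I. f i :: 'r) * (\<Sum>i\<in>I. f i) = (\<Sum>i\<in>I. f i * f i)"
proof (induction I rule: infinite_finite_induct)
  case (insert i I)
  let ?s = "sum f I"
  have "(f i + ?s) * (f i + ?s) = f i * f i + ?s * ?s + (f i * ?s + f i * ?s)"
    by (simp add: algebra_simps)
  then show ?case using insert char_2_add_self[OF assms, of "f i * ?s"] by simp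
qed auto

text \<open>\<open>T1\<close> and \<open>T2\<close> will be the edges tight for the two sources.
  \<open>no_in\<close> reflects that weights are positive, and \<open>exchange\<close> that between
  two vertices tight paths of either kind have the same length, so each is tight for both
  sources.\<close>

locale two_dags = dag E \<rho> for E :: "('v \<times> 'v) set" and \<rho> +
  fixes T1 T2 :: "('v \<times> 'v) set" and s1 t1 s2 t2 :: 'v and VV :: "'v set"
    and x y :: "'v \<times> 'v \<Rightarrow> 'r::comm_ring_1"
  assumes T1: "T1 \<subseteq> E" and T2: "T2 \<subseteq> E"
    and finite_V: "finite VV" and E_sub: "E \<subseteq> VV \<times> VV"
    and s_in: "s1 \<in> VV" "s2 \<in> VV"
    and char_2: "(1::'r) + 1 = 0"
    and no_in: "e \<in> T1 \<Longrightarrow> snd e \<noteq> s1" "e \<in> T2 \<Longrightarrow> snd e \<noteq> s2"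
    and y_eq_x: "\<not> (s1 = s2 \<and> fst e = s1) \<Longrightarrow> y e = x e"
    and exchange: "pth T1 u p v \<Longrightarrow> pth T2 u q v \<Longrightarrow> u \<noteq> v \<Longrightarrow> pth T2 u p v \<and> pth T1 u q v"
begin

text \<open>The vertices that internally disjoint paths may share: endpoints of both. The remaining
  ones are \<open>bad\<close>.\<close>

definition ends :: "'v set" where
  "ends = {s1, t1} \<inter> {s2, t2}"

definition bad :: "'v set" where
  "bad = VV - ends"

abbreviation "W1 \<equiv> path_sum T1 x"
abbreviation "W2 \<equiv> path_sum T2 y"

definition meets :: "('v \<times> 'v) list \<Rightarrow> ('v \<times> 'v) list \<Rightarrow> 'v set" where
  "meets p q = path_verts s1 p \<inter> path_verts s2 q \<inter> bad"

definition avoiding :: "'v \<Rightarrow> 'v \<Rightarrow> (('v \<times> 'v) list \<times> ('v \<times> 'v) list) set" where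
  "avoiding a b = {(p, q). p \<in> paths T1 s1 a \<and> q \<in> paths T2 s2 b \<and> meets p q = {}}"

text \<open>Pairs of prefixes that lead to a first meeting at \<open>v\<close>.\<close>

definition meeting :: "'v \<Rightarrow> (('v \<times> 'v) list \<times> ('v \<times> 'v) list) set" where
  "meeting v = {(p, q). p \<in> paths T1 s1 v \<and> q \<in> paths T2 s2 v \<and> meets p q \<subseteq> {v}}"

definition avoid_sum :: "'v \<Rightarrow> 'v \<Rightarrow> 'r" where
  "avoid_sum a b = (\<Sum>(p, q)\<in>avoiding a b. weight x p * weight y q)"

definition meet_sum :: "'v \<Rightarrow> 'r" where
  "meet_sum v = (\<Sum>(p, q)\<in>meeting v. weight x p * weight y q)"

lemma finite_bad: "finite bad"
  using finite_V by (simp add: bad_def)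

lemma pth_E1: "pth T1 u p v \<Longrightarrow> pth E u p v" and pth_E2: "pth T2 u p v \<Longrightarrow> pth E u p v"
  using pth_E T1 T2 by auto

lemma finite_meeting: "finite (meeting v)"
proof (rule finite_subset)
  show "meeting v \<subseteq> paths T1 s1 v \<times> paths T2 s2 v" by (auto simp: meeting_def)
qed (use finite_paths T1 T2 in auto)

lemma first_meeting_min:
  assumes "pth T1 s1 p v" "pth T2 s2 q v" "meets p q \<subseteq> {v}"
    "pth T1 v p' a" "pth T2 v q' b" "z \<in> meets (p @ p') (q @ q')"
  shows "z = v \<or> \<rho> v < \<rho> z"
proof -
  have "z \<in> path_verts s1 p \<or> z \<in> path_verts v p'" "z \<in> path_verts s2 q \<or> z \<in> path_verts v q'" "z \<in> bad"
    using assms(6) path_verts_append[OF assms(1)] path_verts_append[OF assms(2)]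
    by (auto simp: meets_def)
  moreover have "z = v \<or> \<rho> v < \<rho> z" if "z \<in> path_verts v p'"
    using rank_start[OF pth_E1[OF assms(4)] that] .
  moreover have "z = v \<or> \<rho> v < \<rho> z" if "z \<in> path_verts v q'"
    using rank_start[OF pth_E2[OF assms(5)] that] .
  ultimately show ?thesis using assms(3) by (auto simp: meets_def)
qed

text \<open>Pairs of paths with a bad common vertex are split at the first one.\<close>

lemma first_meeting_decomposition:
  "W1 s1 a * W2 s2 b = avoid_sum a b + (\<Sum>v\<in>bad. meet_sum v * (W1 v a * W2 v b))"
proof -
  let ?f = "\<lambda>(p, q). weight x p * weight y q"
  let ?P = "paths T1 s1 a \<times> paths T2 s2 b"
  let ?M = "{(p, q) \<in> ?P. meets p q \<noteq> {}}"
  let ?J = "Sigma bad (\<lambda>v. meeting v \<times> (paths T1 v a \<times> paths T2 v b))"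
  let ?h = "\<lambda>(v, (p, q), (p', q')). (p @ p', q @ q')"
  have finP: "finite ?P" using finite_paths T1 T2 by auto
  have "W1 s1 a * W2 s2 b = sum ?f ?P"
    by (simp add: path_sum_def sum_product sum.cartesian_product)
  also have "?P = avoiding a b \<union> ?M" by (auto simp: avoiding_def)
  also have "sum ?f \<dots> = avoid_sum a b + sum ?f ?M"
    unfolding avoid_sum_def
  proof (rule sum.union_disjoint)
    show "finite (avoiding a b)" by (rule finite_subset[OF _ finP]) (auto simp: avoiding_def)
    show "finite ?M" by (rule finite_subset[OF _ finP]) auto
  qed (auto simp: avoiding_def)
  also have "sum ?f ?M = sum (?f \<circ> ?h) ?J"
  proof -
    have inj: "inj_on ?h ?J"
    proof (rule inj_onI)
      fix j k assume jk: "j \<in> ?J" "k \<in> ?J" "?h j = ?h k"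
      obtain v p q p' q' where j: "j = (v, (p, q), (p', q'))" by (cases j) auto
      obtain u r l r' l' where k: "k = (u, (r, l), (r', l'))" by (cases k) auto
      have J: "v \<in> bad" "pth T1 s1 p v" "pth T2 s2 q v" "meets p q \<subseteq> {v}"
        "pth T1 v p' a" "pth T2 v q' b"
        using jk(1) by (auto simp: j meeting_def paths_def)
      have K: "u \<in> bad" "pth T1 s1 r u" "pth T2 s2 l u" "meets r l \<subseteq> {u}"
        "pth T1 u r' a" "pth T2 u l' b"
        using jk(2) by (auto simp: k meeting_def paths_def)
      have eq: "p @ p' = r @ r'" "q @ q' = l @ l'" using jk(3) by (auto simp: j k)
      have "v \<in> meets (p @ p') (q @ q')" "u \<in> meets (r @ r') (l @ l')"
        using J K by (auto simp: meets_def path_verts_append intro: end_in_path_verts)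
      \<comment> \<open>Both have minimal rank among the bad common vertices of the same pair of
        paths.\<close>
      then have "u = v"
        using first_meeting_min[OF J(2-6), of u] first_meeting_min[OF K(2-6), of v] eq by auto
      then have "p = r \<and> p' = r'" "q = l \<and> q' = l'"
        using split_unique[OF eq(1) pth_E1 pth_E1] split_unique[OF eq(2) pth_E2 pth_E2] J K by auto
      then show "j = k" using \<open>u = v\<close> by (simp add: j k)
    qed
    have img: "?h ` ?J = ?M"
    proof (rule Set.set_eqI, rule iffI)
      fix pq assume "pq \<in> ?h ` ?J"
      then obtain v p q p' q' where J: "pq = (p @ p', q @ q')" "v \<in> bad" "pth T1 s1 p v"
        "pth T2 s2 q v" "pth T1 v p' a" "pth T2 v q' b"
        by (auto simp: meeting_def paths_def)
      then have "v \<in> meets (p @ p') (q @ q')"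
        by (auto simp: meets_def path_verts_append intro: end_in_path_verts)
      then show "pq \<in> ?M" using J by (auto simp: paths_def pth_append)
    next
      fix pq assume pq: "pq \<in> ?M"
      obtain p q where [simp]: "pq = (p, q)" by (cases pq)
      have P: "pth T1 s1 p a" "pth T2 s2 q b" "meets p q \<noteq> {}" using pq by (auto simp: paths_def)
      \<comment> \<open>On both paths the rank grows, so the common vertex of least rank is the
        first one on either path.\<close>
      define v where "v = arg_min \<rho> (\<lambda>v. v \<in> meets p q)"
      have v: "v \<in> meets p q" "\<And>u. u \<in> meets p q \<Longrightarrow> \<rho> v \<le> \<rho> u"
        unfolding v_def using arg_min_nat_lemma[of "\<lambda>v. v \<in> meets p q" _ \<rho>] P(3) by auto
      obtain p1 p2 where p: "p = p1 @ p2" "pth T1 s1 p1 v" "pth T1 v p2 a"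
        using path_split[OF P(1), of v] v(1) by (auto simp: meets_def)
      obtain q1 q2 where q: "q = q1 @ q2" "pth T2 s2 q1 v" "pth T2 v q2 b"
        using path_split[OF P(2), of v] v(1) by (auto simp: meets_def)
      have "z = v" if "z \<in> meets p1 q1" for z
      proof -
        have "z \<in> meets p q" using that p q by (auto simp: meets_def path_verts_append)
        then have "\<rho> v \<le> \<rho> z" using v by blast
        moreover have "z = v \<or> \<rho> z < \<rho> v" using rank_end[OF pth_E1[OF p(2)], of z] that
          by (auto simp: meets_def)
        ultimately show ?thesis by auto
      qed
      then have "(v, (p1, q1), (p2, q2)) \<in> ?J"
        using p q v(1) by (auto simp: meeting_def paths_def meets_def)
      then show "pq \<in> ?h ` ?J" using p(1) q(1) by force
    qed
    show ?thesis using sum.reindex[OF inj, of ?f] img by simp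
  qed
  also have "sum (?f \<circ> ?h) ?J = (\<Sum>v\<in>bad. \<Sum>k\<in>meeting v \<times> (paths T1 v a \<times> paths T2 v b). (?f \<circ> ?h) (v, k))"
    by (subst sum.Sigma[OF finite_bad])
      (use finite_meeting finite_paths T1 T2 in \<open>auto intro!: sum.cong\<close>)
  also have "\<dots> = (\<Sum>v\<in>bad. meet_sum v * (W1 v a * W2 v b))"
  proof (rule sum.cong[OF refl])
    fix v
    have "meet_sum v * (W1 v a * W2 v b) =
        (\<Sum>k\<in>meeting v. \<Sum>l\<in>paths T1 v a \<times> paths T2 v b. ?f k * ?f l)"
      by (simp add: meet_sum_def path_sum_def sum_product sum.cartesian_product)
    also have "\<dots> = (\<Sum>k\<in>meeting v \<times> (paths T1 v a \<times> paths T2 v b). (?f \<circ> ?h) (v, k))"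
      unfolding sum.cartesian_product
      by (rule sum.cong) (auto simp: weight_append algebra_simps)
    finally show "(\<Sum>k\<in>meeting v \<times> (paths T1 v a \<times> paths T2 v b). (?f \<circ> ?h) (v, k)) =
        meet_sum v * (W1 v a * W2 v b)" by simp
  qed
  finally show ?thesis .
qed

lemma avoid_sum_bad: "v \<in> bad \<Longrightarrow> avoid_sum v v = 0"
proof -
  assume "v \<in> bad"
  then have "avoiding v v = {}"
    by (auto simp: avoiding_def meets_def paths_def dest: end_in_path_verts)
  then show ?thesis by (simp add: avoid_sum_def)
qed

text \<open>The weights differ only on edges out of a common source. Such a source is in
  \<open>ends\<close>, hence differs from \<open>u\<close>, and cannot be entered by an edge of
  \<open>T2\<close>. With equal weights the two path sums can become equal and their product a
  square.\<close>

lemma W2_eq: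
  assumes "u \<in> bad"
  shows "W2 u v = path_sum T2 x u v"
  unfolding path_sum_def
proof (rule sum.cong[OF refl], rule weight_cong)
  fix p e assume "p \<in> paths T2 u v" "e \<in> set p"
  then have p: "pth T2 u p v" "e \<in> set p" by (auto simp: paths_def)
  have "\<not> (s1 = s2 \<and> fst e = s1)"
  proof
    assume s: "s1 = s2 \<and> fst e = s1"
    then have "s2 \<in> path_verts u p" using tail_in_path_verts[OF p] by simp
    then have "s2 = u \<or> (\<exists>e\<in>set p. snd e = s2)" using path_verts_cases[OF p(1)] by blast
    moreover have "s2 \<in> ends" unfolding ends_def using s by simp
    then have "u \<noteq> s2" using assms by (auto simp: bad_def)
    ultimately show False using no_in(2) pth_subset[OF p(1)] by auto
  qed
  then show "y e = x e" by (rule y_eq_x)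
qed

lemma W1_into_s1: "u \<noteq> s1 \<Longrightarrow> W1 u s1 = 0"
proof -
  assume "u \<noteq> s1"
  moreover have "{e \<in> T1. snd e = s1} = {}" using no_in by auto
  ultimately show ?thesis using path_sum_last[OF T1, of x u s1] by (simp del: Collect_empty_eq)
qed

lemma paths_snoc: "e \<in> T \<Longrightarrow> snd e = v \<Longrightarrow> p @ [e] \<in> paths T u v \<longleftrightarrow> p \<in> paths T u (fst e)"
  by (auto simp: paths_def pth_append)

text \<open>In characteristic 2, squaring is additive. Paths of both shortest path graphs between the
  same two vertices are interchangeable, so the product of the two sums is a square.\<close>

lemma product_rec:
  assumes u: "u \<in> bad" "u \<noteq> v"
  shows "W1 u v * W2 u v =
    (\<Sum>e\<in>{e \<in> T1 \<inter> T2. snd e = v}. x e * x e * (W1 u (fst e) * W2 u (fst e)))"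
proof -
  let ?I = "{e \<in> T1 \<inter> T2. snd e = v}"
  have fin: "finite T1" "finite T2" using T1 T2 finite_E finite_subset by auto
  show ?thesis
  proof (cases "paths T1 u v = {} \<or> paths T2 u v = {}")
    case True
    have "W1 u (fst e) * W2 u (fst e) = 0" if "e \<in> ?I" for e
    proof -
      have "paths T1 u (fst e) = {} \<or> paths T2 u (fst e) = {}"
        using True paths_snoc[of e _ v _ u] that by blast
      then show ?thesis by (auto simp: path_sum_def)
    qed
    then show ?thesis using True by (auto simp: path_sum_def)
  next
    case False
    \<comment> \<open>Given one path of each kind, \<open>exchange\<close> turns every path of one
      kind into a path of the other.\<close>
    then have same: "paths T1 u v = paths T2 u v"
      using exchange u(2) by (auto simp: paths_def)
    have r1: "W1 u v = (\<Sum>e\<in>?I. x e * W1 u (fst e))"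
    proof (subst path_sum_last[OF T1], simp only: u(2) if_False add_0_left, rule sum.mono_neutral_right)
      show "\<forall>e\<in>{e \<in> T1. snd e = v} - ?I. x e * W1 u (fst e) = 0"
      proof
        fix e assume e: "e \<in> {e \<in> T1. snd e = v} - ?I"
        have "paths T1 u (fst e) = {}"
        proof (rule ccontr)
          assume "paths T1 u (fst e) \<noteq> {}"
          then obtain p where "p @ [e] \<in> paths T1 u v" using paths_snoc[of e T1 v _ u] e by auto
          then have "e \<in> T2" unfolding same by (auto simp: paths_def pth_append)
          then show False using e by auto
        qed
        then show "x e * W1 u (fst e) = 0" by (simp add: path_sum_def)
      qed
    qed (use fin in auto)
    have r2: "path_sum T2 x u v = (\<Sum>e\<in>?I. x e * path_sum T2 x u (fst e))"
    proof (subst path_sum_last[OF T2], simp only: u(2) if_False add_0_left, rule sum.mono_neutral_right)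
      show "\<forall>e\<in>{e \<in> T2. snd e = v} - ?I. x e * path_sum T2 x u (fst e) = 0"
      proof
        fix e assume e: "e \<in> {e \<in> T2. snd e = v} - ?I"
        have "paths T2 u (fst e) = {}"
        proof (rule ccontr)
          assume "paths T2 u (fst e) \<noteq> {}"
          then obtain p where "p @ [e] \<in> paths T2 u v" using paths_snoc[of e T2 v _ u] e by auto
          then have "e \<in> T1" unfolding same[symmetric] by (auto simp: paths_def pth_append)
          then show False using e by auto
        qed
        then show "x e * path_sum T2 x u (fst e) = 0" by (simp add: path_sum_def)
      qed
    qed (use fin in auto)
    have eq: "path_sum T2 x u (fst e) = W1 u (fst e)" if "e \<in> ?I" for e
    proof -
      have "paths T1 u (fst e) = paths T2 u (fst e)"
        using same paths_snoc[of e _ v _ u] that by blast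
      then show ?thesis by (simp add: path_sum_def)
    qed
    have "path_sum T2 x u v = W1 u v" unfolding r1 r2 using eq by (intro sum.cong) auto
    then have "W1 u v * W2 u v = (\<Sum>e\<in>?I. x e * W1 u (fst e)) * (\<Sum>e\<in>?I. x e * W1 u (fst e))"
      using r1 W2_eq[OF u(1)] by simp
    also have "\<dots> = (\<Sum>e\<in>?I. x e * x e * (W1 u (fst e) * W2 u (fst e)))"
      unfolding char_2_square_sum[OF char_2]
      by (rule sum.cong) (use eq W2_eq[OF u(1)] in \<open>auto simp: algebra_simps\<close>)
    finally show ?thesis .
  qed
qed

text \<open>What survives the cancellation among pairs that meet before \<open>v\<close>: both paths
  enter \<open>v\<close> by the same edge \<open>e\<close>. Pairs sharing an edge out of a tail in
  \<open>ends\<close> are left out, as meeting there is allowed. In particular the tail is no common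
  source, so \<open>e\<close> has the same weight for both paths.\<close>

definition shared :: "'v \<Rightarrow> 'r" where
  "shared v = (\<Sum>e\<in>{e \<in> T1 \<inter> T2. snd e = v \<and> fst e \<notin> ends}.
     x e * x e * (W1 s1 (fst e) * W2 s2 (fst e)))"

text \<open>Split the pairs that reach \<open>v\<close> at their first meeting \<open>u\<close>. The
  term for \<open>u = v\<close> is the wanted sum. For other \<open>u\<close>,
  \<open>product_rec\<close> turns the product of the two sums from \<open>u\<close> to
  \<open>v\<close> into squares of last edges; summing over \<open>u\<close> again and applying the
  decomposition at the tail of that edge gives \<open>shared v\<close>.\<close>

lemma meet_sum_eq:
  assumes v: "v \<in> bad" and nz: "W1 v t1 \<noteq> 0" "W2 v t2 \<noteq> 0"
  shows "meet_sum v = W1 s1 v * W2 s2 v + shared v"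
proof -
  let ?I = "{e \<in> T1 \<inter> T2. snd e = v}"
  have fin: "finite ?I" by (rule finite_subset[OF _ finite_subset[OF T1 finite_E]]) auto
  have "W1 s1 v * W2 s2 v = (\<Sum>u\<in>bad. meet_sum u * (W1 u v * W2 u v))"
    using first_meeting_decomposition[of v v] avoid_sum_bad[OF v] by simp
  also have "\<dots> = meet_sum v + (\<Sum>u\<in>bad - {v}. meet_sum u * (W1 u v * W2 u v))"
    using sum.remove[OF finite_bad v, of "\<lambda>u. meet_sum u * (W1 u v * W2 u v)"]
    by (simp add: path_sum_self T1 T2)
  also have "(\<Sum>u\<in>bad - {v}. meet_sum u * (W1 u v * W2 u v)) =
      (\<Sum>u\<in>bad - {v}. \<Sum>e\<in>?I. x e * x e * (meet_sum u * (W1 u (fst e) * W2 u (fst e))))"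
    by (rule sum.cong) (auto simp: product_rec sum_distrib_left algebra_simps)
  also have "\<dots> = (\<Sum>e\<in>?I. x e * x e * (\<Sum>u\<in>bad - {v}. meet_sum u * (W1 u (fst e) * W2 u (fst e))))"
    by (subst sum.swap) (simp add: sum_distrib_left)
  also have "\<dots> = (\<Sum>e\<in>?I. if fst e \<in> ends then 0 else x e * x e * (W1 s1 (fst e) * W2 s2 (fst e)))"
  proof (rule sum.cong[OF refl])
    fix e assume e: "e \<in> ?I"
    let ?a = "fst e"
    have r: "\<rho> ?a < \<rho> v" using e rank T1 by auto
    have "(\<Sum>u\<in>bad - {v}. meet_sum u * (W1 u ?a * W2 u ?a)) =
       (if ?a \<in> ends then 0 else W1 s1 ?a * W2 s2 ?a)"
    proof (cases "?a \<in> ends")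
      \<comment> \<open>Since \<open>v\<close> still reaches both targets, the tail has smaller rank
        than either target and can be in \<open>ends\<close> only as a source. No bad vertex has a
        path into it.\<close>
      case True
      have "\<rho> v \<le> \<rho> t1" "\<rho> v \<le> \<rho> t2"
        using nz path_sum_eq_0_rank[OF T1, of t1 v x] path_sum_eq_0_rank[OF T2, of t2 v y]
        by (auto simp: not_less[symmetric])
      then have "?a = s1" using True r by (auto simp: ends_def)
      then have "W1 u ?a = 0" if "u \<in> bad" for u
        using W1_into_s1[of u] that True by (auto simp: bad_def)
      then show ?thesis using True by simp
    next
      case False
      have a: "?a \<in> bad" using False e E_sub T1 by (auto simp: bad_def)
      have "W1 s1 ?a * W2 s2 ?a = (\<Sum>u\<in>bad. meet_sum u * (W1 u ?a * W2 u ?a))"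
        using first_meeting_decomposition[of ?a ?a] avoid_sum_bad[OF a] by simp
      also have "\<dots> = (\<Sum>u\<in>bad - {v}. meet_sum u * (W1 u ?a * W2 u ?a))"
        using sum.remove[OF finite_bad v, of "\<lambda>u. meet_sum u * (W1 u ?a * W2 u ?a)"]
          path_sum_eq_0_rank[OF T1 r, of x] by simp
      finally show ?thesis using False by simp
    qed
    then show "x e * x e * (\<Sum>u\<in>bad - {v}. meet_sum u * (W1 u ?a * W2 u ?a)) =
       (if ?a \<in> ends then 0 else x e * x e * (W1 s1 ?a * W2 s2 ?a))" by simp
  qed
  also have "\<dots> = shared v"
    unfolding shared_def using fin by (intro sum.mono_neutral_cong_right) auto
  finally have "W1 s1 v * W2 s2 v + shared v = meet_sum v + (shared v + shared v)"
    by (simp add: add.assoc)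
  then show ?thesis using char_2_add_self[OF char_2, of "shared v"] by simp
qed

text \<open>Subtraction is addition in characteristic 2. A vertex \<open>v\<close> to which
  \<open>meet_sum_eq\<close> does not apply has a factor 0 in its summand, so its term agrees on
  both sides anyway.\<close>

theorem avoid_sum_formula:
  "avoid_sum t1 t2 = W1 s1 t1 * W2 s2 t2 +
     (\<Sum>v\<in>bad. (W1 s1 v * W2 s2 v + shared v) * (W1 v t1 * W2 v t2))"
proof -
  let ?r = "\<Sum>v\<in>bad. (W1 s1 v * W2 s2 v + shared v) * (W1 v t1 * W2 v t2)"
  have "(\<Sum>v\<in>bad. meet_sum v * (W1 v t1 * W2 v t2)) = ?r"
    by (rule sum.cong[OF refl]) (metis meet_sum_eq mult_zero_left mult_zero_right)
  then have "W1 s1 t1 * W2 s2 t2 + ?r = avoid_sum t1 t2 + (?r + ?r)"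
    using first_meeting_decomposition[of t1 t2] by (simp add: add.assoc)
  then show ?thesis using char_2_add_self[OF char_2, of ?r] by simp
qed

end

section \<open>Monomials of pairs of paths\<close>

lemma (in dag) tail_neq_end: "pth E u p v \<Longrightarrow> e \<in> set p \<Longrightarrow> fst e \<noteq> v"
proof -
  assume p: "pth E u p v" "e \<in> set p"
  then have "\<rho> (fst e) < \<rho> (snd e)" using rank[of e] pth_subset[OF p(1)] by auto
  moreover have "snd e = v \<or> \<rho> (snd e) < \<rho> v"
    using rank_end[OF p(1) head_in_path_verts[OF p(2)]] .
  ultimately show ?thesis by auto
qed

lemma (in dag) weight_eq_prod: "pth E u p v \<Longrightarrow> weight x p = (\<Prod>e\<in>set p. x e)"
  using distinct_tails[of u p v] unfolding weight_def
  by (simp add: distinct_map prod.distinct_set_conv_list)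

text \<open>Edge number \<open>i\<close> owns the variables \<open>2 * i\<close> and
  \<open>2 * i + 1\<close>. The odd one is the weight of edges out of a common source when they are
  used by the second path.\<close>

locale two_dags_indexed = two_dags E \<rho> T1 T2 s1 t1 s2 t2 VV x y
  for E :: "('v \<times> 'v) set" and \<rho> T1 T2 s1 t1 s2 t2 VV and x y :: "'v \<times> 'v \<Rightarrow> 'r::comm_ring_1" +
  fixes r :: "nat \<Rightarrow> 'r" and idx :: "'v \<times> 'v \<Rightarrow> nat"
  assumes inj_idx: "inj_on idx E"
    and x_eq: "e \<in> E \<Longrightarrow> x e = r (2 * idx e)"
    and y_eq: "e \<in> E \<Longrightarrow> y e = r (if s1 = s2 \<and> fst e = s1 then Suc (2 * idx e) else 2 * idx e)"
begin

definition iy :: "'v \<times> 'v \<Rightarrow> nat" where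
  "iy e = (if s1 = s2 \<and> fst e = s1 then Suc (2 * idx e) else 2 * idx e)"

definition index_set :: "('v \<times> 'v) list \<times> ('v \<times> 'v) list \<Rightarrow> nat set" where
  "index_set = (\<lambda>(p, q). (\<lambda>e. 2 * idx e) ` set p \<union> iy ` set q)"

lemma avoiding_pths:
  assumes "(p, q) \<in> avoiding t1 t2"
  shows "pth E s1 p t1" "pth E s2 q t2" "path_verts s1 p \<inter> path_verts s2 q \<subseteq> ends"
proof -
  have "pth T1 s1 p t1" "pth T2 s2 q t2" and m: "meets p q = {}"
    using assms by (auto simp: avoiding_def paths_def)
  then show *: "pth E s1 p t1" "pth E s2 q t2" using pth_E1 pth_E2 by auto
  have "path_verts s1 p \<subseteq> VV"
    using pth_subset[OF *(1)] E_sub s_in by (fastforce simp: path_verts_def)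
  then show "path_verts s1 p \<inter> path_verts s2 q \<subseteq> ends"
    using m by (auto simp: meets_def bad_def)
qed

text \<open>A vertex shared by both paths is in \<open>ends\<close>; having an outgoing edge on each
  path, it is the target of neither, so it is the source of both.\<close>

lemma common_tail:
  assumes "(p, q) \<in> avoiding t1 t2" "e \<in> set p" "e' \<in> set q" "fst e = fst e'"
  shows "s1 = s2 \<and> fst e = s1"
proof -
  note pq = avoiding_pths[OF assms(1)]
  have "fst e \<in> path_verts s1 p" "fst e' \<in> path_verts s2 q"
    using tail_in_path_verts[OF pq(1) assms(2)] tail_in_path_verts[OF pq(2) assms(3)] by auto
  then have "fst e \<in> ends" using pq(3) assms(4) by auto
  then show ?thesis
    using tail_neq_end[OF pq(1) assms(2)] tail_neq_end[OF pq(2) assms(3)] assms(4)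
    by (auto simp: ends_def)
qed

lemma idx_inject: "e \<in> E \<Longrightarrow> e' \<in> E \<Longrightarrow> idx e = idx e' \<Longrightarrow> e = e'"
  using inj_idx by (auto simp: inj_on_def)

lemma iy_inject: "e \<in> E \<Longrightarrow> e' \<in> E \<Longrightarrow> iy e = iy e' \<Longrightarrow> e = e'"
proof -
  assume e: "e \<in> E" "e' \<in> E" and eq: "iy e = iy e'"
  have "iy e div 2 = idx e" "iy e' div 2 = idx e'" by (auto simp: iy_def)
  then show ?thesis using eq idx_inject e by auto
qed

lemma iy_eq_even: "e \<in> E \<Longrightarrow> e' \<in> E \<Longrightarrow> iy e = 2 * idx e' \<Longrightarrow> e = e' \<and> \<not> (s1 = s2 \<and> fst e = s1)"
  using idx_inject by (auto simp: iy_def split: if_splits) presburger+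

text \<open>At a common source the parity of an index tells the path to which the edge belongs. At
  any other vertex of \<open>p\<close> an edge of \<open>q\<close> cannot start, so an edge leaving
  it with index in the set belongs to \<open>p\<close>, and \<open>path_eqI\<close> applies;
  likewise for \<open>q\<close>.\<close>

lemma inj_index_set: "inj_on index_set (avoiding t1 t2)"
proof (rule inj_onI)
  fix P P' assume PP: "P \<in> avoiding t1 t2" "P' \<in> avoiding t1 t2" "index_set P = index_set P'"
  obtain p q p' q' where [simp]: "P = (p, q)" "P' = (p', q')" by (cases P, cases P')
  note pq = avoiding_pths[OF PP(1)[simplified]] and pq' = avoiding_pths[OF PP(2)[simplified]]
  have I: "(\<lambda>e. 2 * idx e) ` set p \<union> iy ` set q = (\<lambda>e. 2 * idx e) ` set p' \<union> iy ` set q'"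
    using PP(3) by (simp add: index_set_def)
  have inE: "e \<in> E" if "e \<in> set p \<union> set q \<union> set p' \<union> set q'" for e
    using that pth_subset[OF pq(1)] pth_subset[OF pq(2)] pth_subset[OF pq'(1)] pth_subset[OF pq'(2)]
    by auto
  have "p = p'"
  proof (rule path_eqI[OF pq(1) pq'(1)])
    fix e assume e: "e \<in> set p'" "fst e \<in> path_verts s1 p"
    have "2 * idx e \<in> (\<lambda>e. 2 * idx e) ` set p \<union> iy ` set q" using e(1) unfolding I by blast
    then consider d where "d \<in> set p" "2 * idx e = 2 * idx d" | d where "d \<in> set q" "iy d = 2 * idx e"
      by fastforce
    then show "e \<in> set p"
    proof cases
      case 1 then show ?thesis using idx_inject[of e d] inE e by auto
    next
      case (2 d)
      then have d: "e \<in> set q" "\<not> (s1 = s2 \<and> fst e = s1)"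
        using iy_eq_even[of d e] inE e by auto
      obtain d' where "d' \<in> set p" "fst d' = fst e"
        using path_verts_cases'[OF pq(1) e(2)] tail_neq_end[OF pq'(1) e(1)] by auto
      then show ?thesis using common_tail[of p q d' e] d PP(1) by auto
    qed
  qed
  moreover have "q = q'"
  proof (rule path_eqI[OF pq(2) pq'(2)])
    fix e assume e: "e \<in> set q'" "fst e \<in> path_verts s2 q"
    have "iy e \<in> (\<lambda>e. 2 * idx e) ` set p \<union> iy ` set q" using e(1) unfolding I by blast
    then consider d where "d \<in> set p" "iy e = 2 * idx d" | d where "d \<in> set q" "iy e = iy d"
      by fastforce
    then show "e \<in> set q"
    proof cases
      case (1 d)
      then have d: "e \<in> set p" "\<not> (s1 = s2 \<and> fst e = s1)"
        using iy_eq_even[of e d] inE e by auto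
      obtain d' where "d' \<in> set q" "fst d' = fst e"
        using path_verts_cases'[OF pq(2) e(2)] tail_neq_end[OF pq'(2) e(1)] by auto
      then show ?thesis using common_tail[of p q e d'] d PP(1) by auto
    next
      case (2 d) then show ?thesis using iy_inject[of e d] inE e by auto
    qed
  qed
  ultimately show "P = P'" by simp
qed

text \<open>The monomial is squarefree: a common index would mean an edge on both paths, which must
  leave a common source, and there the second path uses odd indices.\<close>

lemma weight_index_set:
  assumes "(p, q) \<in> avoiding t1 t2"
  shows "weight x p * weight y q = (\<Prod>i\<in>index_set (p, q). r i)"
proof -
  note pq = avoiding_pths[OF assms]
  have inE: "set p \<subseteq> E" "set q \<subseteq> E"
    using pth_subset[OF pq(1)] pth_subset[OF pq(2)] by auto
  have "weight x p = (\<Prod>e\<in>set p. r (2 * idx e))"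
    unfolding weight_eq_prod[OF pq(1)] using inE x_eq by (intro prod.cong) auto
  also have "\<dots> = (\<Prod>i\<in>(\<lambda>e. 2 * idx e) ` set p. r i)"
  proof (subst prod.reindex)
    show "inj_on (\<lambda>e. 2 * idx e) (set p)" by (rule inj_onI, rule idx_inject) (use inE in auto)
  qed simp
  finally have 1: "weight x p = (\<Prod>i\<in>(\<lambda>e. 2 * idx e) ` set p. r i)" .
  have "weight y q = (\<Prod>e\<in>set q. r (iy e))"
    unfolding weight_eq_prod[OF pq(2)] iy_def using inE y_eq by (intro prod.cong) auto
  also have "\<dots> = (\<Prod>i\<in>iy ` set q. r i)"
  proof (subst prod.reindex)
    show "inj_on iy (set q)" by (rule inj_onI, rule iy_inject) (use inE in auto)
  qed simp
  finally have 2: "weight y q = (\<Prod>i\<in>iy ` set q. r i)" .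
  have "(\<lambda>e. 2 * idx e) ` set p \<inter> iy ` set q = {}"
  proof (rule ccontr)
    assume "\<not> ?thesis"
    then obtain d e where de: "d \<in> set p" "e \<in> set q" "iy e = 2 * idx d" by fastforce
    then have "e = d \<and> \<not> (s1 = s2 \<and> fst e = s1)" using iy_eq_even[of e d] inE by auto
    then show False using common_tail[OF assms, of d e] de by auto
  qed
  then show ?thesis unfolding index_set_def 1 2 by (simp add: prod.union_disjoint)
qed

lemma length_le_card:
  assumes "pth E u p v"
  shows "length p \<le> card VV"
proof -
  have "length p = card (fst ` set p)"
    using distinct_card[OF distinct_tails[OF assms]] by simp
  also have "\<dots> \<le> card VV"
    using pth_subset[OF assms] E_sub finite_V by (intro card_mono) fastforce+
  finally show ?thesis .
qed

lemma card_index_set: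
  assumes "P \<in> avoiding t1 t2"
  shows "card (index_set P) \<le> 2 * card VV"
proof -
  obtain p q where [simp]: "P = (p, q)" by (cases P)
  note pq = avoiding_pths[OF assms[simplified]]
  have "card (index_set P) \<le> card ((\<lambda>e. 2 * idx e) ` set p) + card (iy ` set q)"
    by (simp add: index_set_def card_Un_le)
  also have "\<dots> \<le> length p + length q"
    by (intro add_mono order_trans[OF card_image_le] card_length) auto
  finally show ?thesis using length_le_card[OF pq(1)] length_le_card[OF pq(2)] by simp
qed

lemma index_set_less:
  assumes "P \<in> avoiding t1 t2" "\<And>e. e \<in> E \<Longrightarrow> idx e < m"
  shows "index_set P \<subseteq> {..<2 * m}"
proof -
  obtain p q where [simp]: "P = (p, q)" by (cases P)
  note pq = avoiding_pths[OF assms(1)[simplified]]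
  have "set p \<subseteq> E" "set q \<subseteq> E"
    using pth_subset[OF pq(1)] pth_subset[OF pq(2)] by auto
  then show ?thesis using assms(2) by (fastforce simp: index_set_def iy_def)
qed

lemma avoid_sum_index_sets:
  "avoid_sum t1 t2 = (\<Sum>S\<in>index_set ` avoiding t1 t2. \<Prod>i\<in>S. r i)"
proof -
  have "avoid_sum t1 t2 = (\<Sum>P\<in>avoiding t1 t2. \<Prod>i\<in>index_set P. r i)"
    unfolding avoid_sum_def using weight_index_set by (intro sum.cong) auto
  then show ?thesis by (simp add: sum.reindex[OF inj_index_set])
qed

end

section \<open>Shortest paths and tight edges\<close>

text \<open>Distances are shifted by one, so that 0 can stand for an unreachable vertex.\<close>

definition distances :: "('v \<times> 'v) set \<Rightarrow> ('v \<times> 'v \<Rightarrow> nat) \<Rightarrow> 'v set \<Rightarrow> 'v \<Rightarrow> ('v \<Rightarrow> nat) \<Rightarrow> bool" where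
  "distances E wt VV s d \<longleftrightarrow> d s = 1 \<and>
     (\<forall>e\<in>E. d (fst e) \<noteq> 0 \<longrightarrow> d (snd e) \<noteq> 0 \<and> d (snd e) \<le> d (fst e) + wt e) \<and>
     (\<forall>v\<in>VV. v \<noteq> s \<longrightarrow> d v \<noteq> 0 \<longrightarrow>
        (\<exists>e\<in>E. snd e = v \<and> d (fst e) \<noteq> 0 \<and> d (fst e) + wt e = d v))"

definition tight_edges :: "('v \<times> 'v) set \<Rightarrow> ('v \<times> 'v \<Rightarrow> nat) \<Rightarrow> ('v \<Rightarrow> nat) \<Rightarrow> ('v \<times> 'v) set" where
  "tight_edges E wt d = {e \<in> E. d (fst e) \<noteq> 0 \<and> d (fst e) + wt e = d (snd e)}"

definition cost :: "('e \<Rightarrow> nat) \<Rightarrow> 'e list \<Rightarrow> nat" where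
  "cost wt p = sum_list (map wt p)"

lemma cost_simps [simp]: "cost wt [] = 0" "cost wt (e # p) = wt e + cost wt p"
  by (auto simp: cost_def)

lemma distances_upper:
  assumes "distances E wt VV s d" "pth E u p v" "d u \<noteq> 0"
  shows "d v \<noteq> 0 \<and> d v \<le> d u + cost wt p"
  using assms(2,3)
proof (induction p arbitrary: u)
  case (Cons e p)
  then have "d (snd e) \<noteq> 0 \<and> d (snd e) \<le> d u + wt e" using assms(1) by (auto simp: distances_def)
  with Cons.IH[of "snd e"] Cons.prems show ?case by auto
qed auto

lemma tight_path_cost: "pth (tight_edges E wt d) u p v \<Longrightarrow> d v = d u + cost wt p"
  by (induction p arbitrary: u) (auto simp: tight_edges_def)

text \<open>Each edge obeys the relaxation inequality; if the sum of these inequalities along the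
  path is an equality, then each of them is.\<close>

lemma tight_pathI:
  assumes "distances E wt VV s d" "pth E u p v" "d u \<noteq> 0" "d v = d u + cost wt p"
  shows "pth (tight_edges E wt d) u p v"
  using assms(2-4)
proof (induction p arbitrary: u)
  case (Cons e p)
  have 1: "d (snd e) \<noteq> 0 \<and> d (snd e) \<le> d u + wt e"
    using Cons.prems assms(1) by (auto simp: distances_def)
  have 2: "d v \<le> d (snd e) + cost wt p"
    using distances_upper[OF assms(1), of "snd e" p v] Cons.prems 1 by auto
  have 3: "d (snd e) = d u + wt e" using 1 2 Cons.prems by auto
  have "pth (tight_edges E wt d) (snd e) p v"
    by (rule Cons.IH) (use Cons.prems 1 3 in auto)
  moreover have "fst e = u" "e \<in> E" using Cons.prems(1) by auto
  moreover from this have "e \<in> tight_edges E wt d"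
    using Cons.prems(2) 3[symmetric] unfolding tight_edges_def by blast
  ultimately show ?case by simp
next
  case Nil
  show ?case using Nil(1) by simp
qed

lemma (in dag) tight_path_exists:
  assumes "distances E wt VV s d" "E \<subseteq> VV \<times> VV" "v \<in> VV" "d v \<noteq> 0"
  shows "\<exists>p. pth (tight_edges E wt d) s p v"
  using assms(3,4)
proof (induction "\<rho> v" arbitrary: v rule: less_induct)
  case less
  show ?case
  proof (cases "v = s")
    case True then show ?thesis by (auto intro: exI[of _ "[]"])
  next
    case False
    then obtain e where e: "e \<in> E" "snd e = v" "d (fst e) \<noteq> 0" "d (fst e) + wt e = d v"
      using assms(1) less.prems by (auto simp: distances_def)
    then obtain p where "pth (tight_edges E wt d) s p (fst e)"
      using less.hyps[of "fst e"] rank assms(2) by fastforce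
    then have "pth (tight_edges E wt d) s (p @ [e]) v" using e by (auto simp: pth_append tight_edges_def)
    then show ?thesis ..
  qed
qed

text \<open>The source has the least possible nonzero label 1, and a tight edge of positive weight
  leads to a larger label.\<close>

lemma tight_into_source:
  assumes "distances E wt VV s d" "\<And>e. e \<in> E \<Longrightarrow> wt e > 0" "e \<in> tight_edges E wt d"
  shows "snd e \<noteq> s"
proof
  assume "snd e = s"
  then have "d (fst e) + wt e = 1" "d (fst e) \<noteq> 0" "wt e > 0"
    using assms by (auto simp: tight_edges_def distances_def)
  then show False by simp
qed

text \<open>A path tight for one source costs as much as the difference of the labels, which bounds
  the cost of every path from \<open>u\<close> to \<open>v\<close> from below. So \<open>p\<close>
  and \<open>q\<close> cost the same, and each attains the bound for the other source.\<close>

lemma tight_exchange: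
  assumes d1: "distances E wt VV s1 d1" and d2: "distances E wt VV s2 d2"
    and p: "pth (tight_edges E wt d1) u p v" and q: "pth (tight_edges E wt d2) u q v" and "u \<noteq> v"
  shows "pth (tight_edges E wt d2) u p v \<and> pth (tight_edges E wt d1) u q v"
proof -
  have sub: "tight_edges E wt d \<subseteq> E" for d by (auto simp: tight_edges_def)
  have pE: "pth E u p v" "pth E u q v"
    using pth_mono[OF p] pth_mono[OF q] pth_subset[OF p] pth_subset[OF q] sub[of d1] sub[of d2]
    by auto
  have "d1 u \<noteq> 0" "d2 u \<noteq> 0" using p q \<open>u \<noteq> v\<close> by (cases p; cases q; auto simp: tight_edges_def)+
  moreover have "d1 v = d1 u + cost wt p" "d2 v = d2 u + cost wt q"
    using tight_path_cost[OF p] tight_path_cost[OF q] by auto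
  moreover have "d1 v \<le> d1 u + cost wt q" "d2 v \<le> d2 u + cost wt p"
    using distances_upper[OF d1 pE(2)] distances_upper[OF d2 pE(1)] calculation by auto
  ultimately show ?thesis using tight_pathI[OF d1 pE(2)] tight_pathI[OF d2 pE(1)] by simp
qed

text \<open>The rank of a vertex is the number of its proper ancestors.\<close>

lemma acyclic_rank:
  assumes "finite E" "acyclic E"
  obtains \<rho> :: "'v \<Rightarrow> nat" where "\<And>e. e \<in> E \<Longrightarrow> \<rho> (fst e) < \<rho> (snd e)"
proof
  define \<rho> where "\<rho> v = card {u. (u, v) \<in> E\<^sup>+}" for v
  fix e assume e: "e \<in> E"
  have fin: "finite {u. (u, v) \<in> E\<^sup>+}" for v
  proof (rule finite_subset)
    show "{u. (u, v) \<in> E\<^sup>+} \<subseteq> fst ` (E\<^sup>+)" by force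
  qed (simp add: assms(1) finite_trancl)
  have "fst e \<in> {u. (u, snd e) \<in> E\<^sup>+}" using r_into_trancl[of "fst e" "snd e" E] e by simp
  moreover have "fst e \<notin> {u. (u, fst e) \<in> E\<^sup>+}" using assms(2) by (auto simp: acyclic_def)
  moreover have "{u. (u, fst e) \<in> E\<^sup>+} \<subseteq> {u. (u, snd e) \<in> E\<^sup>+}"
    using e by (auto intro: trancl_into_trancl)
  ultimately show "\<rho> (fst e) < \<rho> (snd e)" unfolding \<rho>_def by (intro psubset_card_mono[OF fin]) blast
qed

lemma trancl_pth: "(u, v) \<in> E\<^sup>+ \<Longrightarrow> \<exists>p. p \<noteq> [] \<and> pth E u p v"
proof (induction rule: trancl_induct)
  case (base v)
  then show ?case by (intro exI[of _ "[(u, v)]"]) auto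
next
  case (step v x)
  then obtain p where "pth E u p v" by auto
  then show ?case using step by (intro exI[of _ "p @ [(v, x)]"]) (auto simp: pth_append)
qed

section \<open>Tight paths as shortest paths of a digraph\<close>

locale dag_graph = pair_digraph G + dag "parcs G" \<rho> for G :: "nat pair_pre_digraph" and \<rho> +
  fixes wt :: "nat \<times> nat \<Rightarrow> nat"
begin

lemma awalk_iff_pth: "awalk u p v \<longleftrightarrow> u \<in> pverts G \<and> pth (parcs G) u p v"
proof -
  have "cas u p v \<and> set p \<subseteq> parcs G \<longleftrightarrow> pth (parcs G) u p v"
    by (induction p arbitrary: u) auto
  then show ?thesis by (auto simp: awalk_def)
qed

lemma set_awalk_verts: "pth (parcs G) u p v \<Longrightarrow> set (awalk_verts u p) = path_verts u p"
  by (induction p arbitrary: u) auto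

lemma distinct_awalk_verts: "pth (parcs G) u p v \<Longrightarrow> distinct (awalk_verts u p)"
proof (induction p arbitrary: u)
  case (Cons e p)
  have "fst e \<notin> path_verts (snd e) p"
    using rank[of e] rank_start[of "snd e" p v "fst e"] Cons.prems by auto
  then show ?case using Cons set_awalk_verts by auto
qed simp

lemma set_inner_verts:
  assumes "pth (parcs G) u p v"
  shows "set (inner_verts p) = path_verts u p - {u, v}"
proof (cases p)
  case Nil then show ?thesis using assms by (simp add: inner_verts_def)
next
  case (Cons e q)
  have q: "pth (parcs G) (snd e) q v" "fst e = u" using assms Cons by auto
  have "path_verts (snd e) q = insert v (fst ` set q)"
    using path_verts_cases'[OF q(1)] tail_in_path_verts[OF q(1)] end_in_path_verts[OF q(1)] by blast
  moreover have "v \<notin> fst ` set q" using tail_neq_end[OF q(1)] by auto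
  moreover have "u \<notin> fst ` set q" using distinct_tails[OF assms] Cons q(2) by auto
  ultimately show ?thesis using Cons by (auto simp: inner_verts_def)
qed

lemma awalk_cost_eq: "awalk_cost (\<lambda>e. real (wt e)) p = real (cost wt p)"
  by (induction p) (auto simp: awalk_cost_def)

text \<open>The labels bound the cost of every walk from \<open>s\<close> from below. Tight paths
  attain this bound, and since some tight path to \<open>t\<close> exists, so must every shortest
  path.\<close>

lemma shortest_path_iff:
  assumes d: "distances (parcs G) wt (pverts G) s d" and s: "s \<in> pverts G"
  shows "shortest_path (\<lambda>e. real (wt e)) s p t \<longleftrightarrow> pth (tight_edges (parcs G) wt d) s p t"
proof
  let ?f = "\<lambda>e. real (wt e)"
  have ds: "d s = 1" using d by (simp add: distances_def)
  have sub: "parcs G \<subseteq> pverts G \<times> pverts G" by (auto dest: in_arcsD1 in_arcsD2)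
  {
    assume "shortest_path ?f s p t"
    then have p: "pth (parcs G) s p t" "t \<in> pverts G" and mu: "ereal (real (cost wt p)) = \<mu> ?f s t"
      by (auto simp: shortest_path_def apath_def awalk_iff_pth awalk_cost_eq dest: awalk_last_in_verts)
        (use awalk_iff_pth awalk_last_in_verts in auto)
    have up: "d t \<noteq> 0" "d t \<le> d s + cost wt p" using distances_upper[OF d p(1)] ds by auto
    obtain q where q: "pth (tight_edges (parcs G) wt d) s q t"
      using tight_path_exists[OF d sub p(2) up(1)] by blast
    have "pth (parcs G) s q t" by (rule pth_E[OF _ q]) (auto simp: tight_edges_def)
    then have "\<mu> ?f s t \<le> real (cost wt q)"
      using min_cost_le_walk_cost[of s q t ?f] s by (simp add: awalk_iff_pth awalk_cost_eq)
    then have "cost wt p \<le> cost wt q" by (simp flip: mu)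
    then show "pth (tight_edges (parcs G) wt d) s p t"
      using tight_pathI[OF d p(1)] tight_path_cost[OF q] up ds by simp
  }
  {
    assume t: "pth (tight_edges (parcs G) wt d) s p t"
    have p: "pth (parcs G) s p t" by (rule pth_E[OF _ t]) (auto simp: tight_edges_def)
    have "\<mu> ?f s t = ereal (awalk_cost ?f p)"
    proof (rule antisym)
      show "\<mu> ?f s t \<le> ereal (awalk_cost ?f p)"
        by (rule min_cost_le_walk_cost) (use p s in \<open>simp add: awalk_iff_pth\<close>)
      show "ereal (awalk_cost ?f p) \<le> \<mu> ?f s t"
        unfolding \<mu>_def
      proof (rule INF_greatest)
        fix q assume "q \<in> {p. awalk s p t}"
        then have "d t \<le> d s + cost wt q"
          using distances_upper[OF d, of s q t] ds by (simp add: awalk_iff_pth)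
        then show "ereal (awalk_cost ?f p) \<le> ereal (awalk_cost ?f q)"
          using tight_path_cost[OF t] by (simp add: awalk_cost_eq)
      qed
    qed
    then show "shortest_path ?f s p t"
      using p s distinct_awalk_verts[OF p] by (simp add: shortest_path_def apath_def awalk_iff_pth)
  }
qed

lemma internally_disjoint_iff:
  assumes p: "pth (parcs G) s1 p t1" and q: "pth (parcs G) s2 q t2"
  shows "internally_disjoint s1 p s2 q \<longleftrightarrow>
    path_verts s1 p \<inter> path_verts s2 q \<subseteq> {s1, t1} \<inter> {s2, t2}"
  unfolding internally_disjoint_def set_inner_verts[OF p] set_inner_verts[OF q]
    set_awalk_verts[OF p] set_awalk_verts[OF q]
  by blast

lemma disjoint_shortest_paths_iff:
  assumes "distances (parcs G) wt (pverts G) s1 d1" "distances (parcs G) wt (pverts G) s2 d2"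
    "s1 \<in> pverts G" "s2 \<in> pverts G"
  shows "disjoint_shortest_paths (\<lambda>e. real (wt e)) [s1, s2] [t1, t2] \<longleftrightarrow>
    (\<exists>p q. pth (tight_edges (parcs G) wt d1) s1 p t1 \<and> pth (tight_edges (parcs G) wt d2) s2 q t2 \<and>
      path_verts s1 p \<inter> path_verts s2 q \<subseteq> {s1, t1} \<inter> {s2, t2})"
    (is "?l \<longleftrightarrow> ?r")
proof -
  let ?f = "\<lambda>e. real (wt e)"
  have all2: "(\<forall>i<Suc (Suc 0). Q i) \<longleftrightarrow> Q 0 \<and> Q 1" for Q :: "nat \<Rightarrow> bool"
    by (auto simp: less_Suc_eq)
  have sub: "tight_edges (parcs G) wt d \<subseteq> parcs G" for d by (auto simp: tight_edges_def)
  have "?l \<longleftrightarrow> (\<exists>p q. shortest_path ?f s1 p t1 \<and> shortest_path ?f s2 q t2 \<and>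
      internally_disjoint s1 p s2 q \<and> internally_disjoint s2 q s1 p)" (is "_ \<longleftrightarrow> ?m")
  proof
    assume ?l
    then show ?m unfolding disjoint_shortest_paths_def by (auto simp: all2)
  next
    assume ?m
    then obtain p q where "shortest_path ?f s1 p t1" "shortest_path ?f s2 q t2"
      "internally_disjoint s1 p s2 q" "internally_disjoint s2 q s1 p" by blast
    then show ?l unfolding disjoint_shortest_paths_def
      by (intro conjI exI[of _ "[p, q]"]) (auto simp: all2)
  qed
  also have "\<dots> \<longleftrightarrow> ?r"
    unfolding shortest_path_iff[OF assms(1,3)] shortest_path_iff[OF assms(2,4)]
    using internally_disjoint_iff pth_E[OF sub] by (metis Int_commute)
  finally show ?thesis .
qed

end

lemma (in pair_digraph) acyclic_if_no_cycle:
  assumes "\<nexists>p. cycle p"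
  shows "acyclic (parcs G)"
proof (rule acyclicI, intro allI notI)
  fix u assume "(u, u) \<in> (parcs G)\<^sup>+"
  from trancl_pth[OF this] obtain p where p: "p \<noteq> []" "pth (parcs G) u p u" by (elim exE conjE)
  have "pth (parcs G) u' p v \<Longrightarrow> cas u' p v \<and> set p \<subseteq> parcs G" for u' v
    by (induction p arbitrary: u') auto
  from this[OF p(2)] have c: "cas u p u" "set p \<subseteq> parcs G" by auto
  have "u \<in> pverts G"
    using p by (cases p) (auto dest: arc_fst_in_verts)
  then have "awalk u p u" using c by (simp add: awalk_def)
  then have "closed_w p" using p(1) by (auto simp: closed_w_def)
  from closed_w_imp_cycle[OF this] show False using assms by contradiction
qed

lemma weighted_dag_rank:
  assumes "weighted_dag G wt"
  obtains \<rho> where "dag_graph G \<rho>"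
proof -
  have G: "pair_digraph G"
    using assms unfolding weighted_dag_def by (rule conjunct1)
  have nc: "\<nexists>p. pre_digraph.cycle (with_proj G) p"
    using assms unfolding weighted_dag_def by (rule conjunct1[OF conjunct2])
  have fin: "finite (parcs G)" using pair_fin_digraph.pair_finite_arcs[OF pair_digraph.axioms(1)[OF G]] .
  obtain \<rho> :: "nat \<Rightarrow> nat" where "\<And>e. e \<in> parcs G \<Longrightarrow> \<rho> (fst e) < \<rho> (snd e)"
    using acyclic_rank[OF fin pair_digraph.acyclic_if_no_cycle[OF G nc]] by metis
  then have "dag (parcs G) \<rho>" by (intro dag.intro fin)
  then show ?thesis using that[of \<rho>] G by (simp add: dag_graph_def)
qed

section \<open>The program\<close>

abbreviation (input) "vRES \<equiv> 0 :: nat"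
abbreviation (input) "vN \<equiv> 1 :: nat"
abbreviation (input) "vM \<equiv> 2 :: nat"
abbreviation (input) "vS1 \<equiv> 3 :: nat"
abbreviation (input) "vT1 \<equiv> 4 :: nat"
abbreviation (input) "vS2 \<equiv> 5 :: nat"
abbreviation (input) "vT2 \<equiv> 6 :: nat"
abbreviation (input) "vLF \<equiv> 7 :: nat"
abbreviation (input) "vH \<equiv> 8 :: nat"
abbreviation (input) "vNB \<equiv> 9 :: nat"
abbreviation (input) "vMASK \<equiv> 10 :: nat"
abbreviation (input) "vHM \<equiv> 11 :: nat"
abbreviation (input) "vI \<equiv> 12 :: nat"
abbreviation (input) "vJ \<equiv> 13 :: nat"
abbreviation (input) "vE \<equiv> 14 :: nat"
abbreviation (input) "vU \<equiv> 15 :: nat"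
abbreviation (input) "vV \<equiv> 16 :: nat"
abbreviation (input) "vP \<equiv> 17 :: nat"
abbreviation (input) "vMA \<equiv> 18 :: nat"
abbreviation (input) "vMB \<equiv> 19 :: nat"
abbreviation (input) "vMC \<equiv> 20 :: nat"
abbreviation (input) "vMI \<equiv> 21 :: nat"
abbreviation (input) "vMJ \<equiv> 22 :: nat"
abbreviation (input) "vMD \<equiv> 23 :: nat"
abbreviation (input) "vME \<equiv> 24 :: nat"
abbreviation (input) "vQL \<equiv> 25 :: nat"
abbreviation (input) "vK \<equiv> 26 :: nat"
abbreviation (input) "vTMP \<equiv> 27 :: nat"

abbreviation (input) "aHEAD \<equiv> 0 :: nat"
abbreviation (input) "aNEXT \<equiv> 1 :: nat"
abbreviation (input) "aIN \<equiv> 2 :: nat"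
abbreviation (input) "aQ \<equiv> 3 :: nat"
abbreviation (input) "aORD \<equiv> 4 :: nat"
abbreviation (input) "aX \<equiv> 5 :: nat"
abbreviation (input) "aY \<equiv> 6 :: nat"
abbreviation (input) "aTAB \<equiv> 7 :: nat"
abbreviation (input) "aD1 \<equiv> 8 :: nat"
abbreviation (input) "aD2 \<equiv> 9 :: nat"
abbreviation (input) "aL1 \<equiv> 10 :: nat"
abbreviation (input) "aL2 \<equiv> 11 :: nat"
abbreviation (input) "aSH \<equiv> 12 :: nat"
abbreviation (input) "aR1 \<equiv> 13 :: nat"
abbreviation (input) "aR2 \<equiv> 14 :: nat"

definition skip_c :: com where
  "skip_c = Assign vTMP (Cst 0)"

definition for_c :: "nat \<Rightarrow> nat \<Rightarrow> com \<Rightarrow> com" where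
  "for_c J M c = Assign J (Cst 0) ;;
     Loop (Bin Less (Var J) (Var M)) (c ;; Assign J (Bin Add (Var J) (Cst 1)))"

definition src_e :: "expr \<Rightarrow> expr" where
  "src_e e = Inp (Bin Add (Bin Mul (Cst 3) e) (Cst 6))"

definition tgt_e :: "expr \<Rightarrow> expr" where
  "tgt_e e = Inp (Bin Add (Bin Mul (Cst 3) e) (Cst 7))"

definition wgt_e :: "expr \<Rightarrow> expr" where
  "wgt_e e = Inp (Bin Add (Bin Mul (Cst 3) e) (Cst 8))"

subsection \<open>Multiplication of polynomials modulo \<open>z\<^sup>N + 1\<close>\<close>

text \<open>Words are cut into chunks of \<open>h\<close> bits; products of two chunks are looked up in a table.
  Both loops follow Horner's rule, from the most significant chunk down.\<close>

definition chunk_c :: "nat \<Rightarrow> com" where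
  "chunk_c B =
     Assign vME (Cst 0) ;; Assign vMJ (Cst B) ;;
     Loop (Var vMJ)
       (Assign vMJ (Bin Sub (Var vMJ) (Cst 1)) ;;
        Assign vME (Bin Xor (Bin Shl (Var vME) (Var vH))
          (Arr aTAB (Bin Add (Bin Shl (Var vMD) (Var vH))
             (Bin And (Bin Shr (Var vMB) (Bin Mul (Var vMJ) (Var vH))) (Var vHM))))))"

definition mult_c :: "nat \<Rightarrow> com" where
  "mult_c B =
     Assign vMC (Cst 0) ;; Assign vMI (Cst B) ;;
     Loop (Var vMI)
       (Assign vMI (Bin Sub (Var vMI) (Cst 1)) ;;
        Assign vMD (Bin And (Bin Shr (Var vMA) (Bin Mul (Var vMI) (Var vH))) (Var vHM)) ;;
        chunk_c B ;;
        Assign vMC (Bin Xor (Bin Shl (Var vMC) (Var vH)) (Var vME))) ;;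
     Assign vMC (Bin Xor (Bin And (Var vMC) (Var vMASK)) (Bin Shr (Var vMC) (Var vNB)))"

text \<open>The product of the chunks \<open>u\<close> and \<open>v\<close> is stored at
  \<open>u * 2 ^ h + v\<close>. It arises from the product of \<open>u div 2\<close> and
  \<open>v\<close> by a shift and, for odd \<open>u\<close>, the addition of \<open>v\<close>, so
  that each entry takes constant time.\<close>

definition table_c :: com where
  "table_c =
     Assign vP (Bin Shl (Cst 1) (Bin Add (Var vH) (Var vH))) ;;
     for_c vJ vP
       (Assign vU (Bin Shr (Var vJ) (Var vH)) ;;
        Assign vV (Bin And (Var vJ) (Var vHM)) ;;
        Assign vE (Arr aTAB (Bin Add (Bin Shl (Bin Shr (Var vU) (Cst 1)) (Var vH)) (Var vV))) ;;
        Put aTAB (Var vJ) (Bin Xor (Bin Shl (Var vE) (Cst 1))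
          (Bin Mul (Bin And (Var vU) (Cst 1)) (Var vV))))"

lemma vmods_c [simp]:
  "vmods skip_c = {vTMP}" "vmods (for_c J M c) = insert J (vmods c)"
  "vmods (chunk_c B) = {vME, vMJ}" "vmods (mult_c B) = {vMC, vMI, vMD, vME, vMJ}"
  "vmods table_c = {vP, vJ, vU, vV, vE}"
  by (auto simp: skip_c_def for_c_def chunk_c_def mult_c_def table_c_def)

lemma amods_c [simp]:
  "amods skip_c = {}" "amods (for_c J M c) = amods c"
  "amods (chunk_c B) = {}" "amods (mult_c B) = {}" "amods table_c = {aTAB}"
  by (auto simp: skip_c_def for_c_def chunk_c_def mult_c_def table_c_def)

lemma wf_c [simp]:
  "wf_expr (src_e e) = wf_expr e" "wf_expr (tgt_e e) = wf_expr e" "wf_expr (wgt_e e) = wf_expr e"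
  "wf_com skip_c" "wf_com (for_c J M c) \<longleftrightarrow> J < nvar \<and> M < nvar \<and> wf_com c"
  "wf_com (chunk_c B)" "wf_com (mult_c B)" "wf_com table_c"
  by (auto simp: skip_c_def for_c_def chunk_c_def mult_c_def table_c_def src_e_def tgt_e_def wgt_e_def)

context ram
begin

lemma wp_skip: "wp skip_c Q V A j t \<longleftrightarrow> Q (V(vTMP := 0)) A j (Suc t)"
  by (simp add: skip_c_def wp_Assign)

lemma frameD:
  "frame c V A V' A' \<Longrightarrow> x \<notin> vmods c \<Longrightarrow> V' x = V x"
  "frame c V A V' A' \<Longrightarrow> k \<notin> amods c \<Longrightarrow> A' k = A k"
  by (auto simp: frame_def)

lemma frame_no_amods: "frame c V A V' A' \<Longrightarrow> amods c = {} \<Longrightarrow> A' = A"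
  by (auto simp: frame_def)

text \<open>The two extra ticks per round are the test and the increment, and the two outside are
  the initial assignment and the last test. \<open>stable\<close> makes the invariant independent of
  the counter, whose value is passed as a parameter instead.\<close>

lemma wp_for:
  assumes M: "V M = m" "m < 2 ^ w" "M \<noteq> J" "J \<notin> vmods c" "M \<notin> vmods c"
    and init: "I 0 V A j"
    and stable: "\<And>k V A j x. I k V A j \<Longrightarrow> I k (V(J := x)) A j"
    and step: "\<And>k V' A' j' t'. k < m \<Longrightarrow> I k V' A' j' \<Longrightarrow> V' J = k \<Longrightarrow>
      frame (for_c J M c) V A V' A' \<Longrightarrow>
      wp c (\<lambda>V'' A'' j'' t''. I (Suc k) V'' A'' j'' \<and> t'' \<le> t' + \<kappa>) V' A' j' t'"
    and post: "\<And>V' A' j' t'. I m V' A' j' \<Longrightarrow> frame (for_c J M c) V A V' A' \<Longrightarrow>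
      t' \<le> t + 2 + m * (\<kappa> + 2) \<Longrightarrow> Q V' A' j' t'"
  shows "wp (for_c J M c) Q V A j t"
proof -
  let ?body = "c ;; Assign J (Bin Add (Var J) (Cst 1))"
  have fr: "frame (for_c J M c) V A V' A'" if "frame ?body (V(J := 0)) A V' A'" for V' A'
  proof -
    have "bounded_state V A \<Longrightarrow> bounded_state (V(J := 0)) A" by (simp add: bounded_state_def)
    then show ?thesis using that by (auto simp: frame_def)
  qed
  have one: "1 < (2::nat) ^ w" using w_pos by (rule one_less_power[rotated]) simp
  have "wp (Loop (Bin Less (Var J) (Var M)) ?body) Q (V(J := 0)) A j (Suc t)"
  proof (rule wp_loop_rule[where \<mu> = "\<lambda>V A. m - V J" and
        I = "\<lambda>V' A' j' t'. V' J \<le> m \<and> I (V' J) V' A' j' \<and> t' \<le> t + 1 + V' J * (\<kappa> + 2)"])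
    fix V' A' j' t'
    assume I: "V' J \<le> m \<and> I (V' J) V' A' j' \<and> t' \<le> t + 1 + V' J * (\<kappa> + 2)"
      and f: "frame ?body (V(J := 0)) A V' A'"
    have M': "V' M = m" using frameD(1)[OF f, of M] M by auto
    show "ok V' A' (Bin Less (Var J) (Var M))" by simp
    {
      assume "ev V' A' (Bin Less (Var J) (Var M)) \<noteq> 0"
      then have lt: "V' J < m" using M' by simp
      show "wp ?body (\<lambda>V'' A'' j'' t''. (V'' J \<le> m \<and> I (V'' J) V'' A'' j'' \<and>
          t'' \<le> t + 1 + V'' J * (\<kappa> + 2)) \<and> m - V'' J < m - V' J) V' A' j' (Suc t')"
        unfolding wp_Then
      proof (rule wp_conseq[OF step[OF lt _ refl fr[OF f]]])
        show "I (V' J) V' A' j'" using I by simp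
        fix V'' A'' j'' t''
        assume 1: "I (Suc (V' J)) V'' A'' j'' \<and> t'' \<le> Suc t' + \<kappa>" and 2: "frame c V' A' V'' A''"
        have "V'' J = V' J" using frameD(1)[OF 2] M(4) by auto
        then show "wp (Assign J (Bin Add (Var J) (Cst 1))) (\<lambda>V'' A'' j'' t''.
            (V'' J \<le> m \<and> I (V'' J) V'' A'' j'' \<and> t'' \<le> t + 1 + V'' J * (\<kappa> + 2)) \<and>
            m - V'' J < m - V' J) V'' A'' j'' t''"
          using 1 I lt M(2) one stable by (simp add: wp_Assign)
      qed
    }
    {
      assume "ev V' A' (Bin Less (Var J) (Var M)) = 0"
      then have "V' J = m" using M' I by simp
      then show "Q V' A' j' (Suc t')" using I by (intro post fr[OF f]) auto
    }
  qed (use init stable in auto)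
  then show ?thesis by (simp add: for_c_def wp_Then wp_Assign)
qed

end

text \<open>\<open>B\<close> chunks of \<open>h\<close> bits cover an element of \<open>N\<close>
  bits. \<open>room\<close> leaves space for an unreduced product of up to \<open>2 * N\<close> bits
  that is shifted by one more chunk, and \<open>B * h \<le> w\<close> keeps all shift distances
  representable.\<close>

locale field_ram = ram +
  fixes B N h :: nat
  assumes chunks: "N \<le> B * h" "B * h \<le> w" "0 < h"
    and N_pos: "0 < N"
    and room: "2 * N + 2 * h \<le> w"
    and table_room: "2 ^ (2 * h) \<le> lim"
begin

definition params :: "env \<Rightarrow> bool" where
  "params V \<longleftrightarrow> V vH = h \<and> V vNB = N \<and> V vMASK = 2 ^ N - 1 \<and> V vHM = 2 ^ h - 1"

definition table :: "arrs \<Rightarrow> bool" where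
  "table A \<longleftrightarrow> (\<forall>i < 2 ^ (2 * h).
     word_poly (A aTAB i) = word_poly (i div 2 ^ h) * word_poly (i mod 2 ^ h))"

lemma less_pow_w: "x < 2 ^ k \<Longrightarrow> k \<le> w \<Longrightarrow> x < (2::nat) ^ w"
  using power_increasing[of k w "2::nat"] by linarith

lemma less_w: "x \<le> w \<Longrightarrow> x < (2::nat) ^ w"
  by (rule le_less_trans[of _ w]) auto

lemma shift_less: "x < 2 ^ a \<Longrightarrow> x * 2 ^ b < (2::nat) ^ (a + b)"
  by (simp add: power_add)

lemma chunk_index:
  fixes a b :: nat
  assumes "a < 2 ^ h" "b < 2 ^ h"
  shows "a * 2 ^ h + b < 2 ^ (2 * h)" "(a * 2 ^ h + b) div 2 ^ h = a" "(a * 2 ^ h + b) mod 2 ^ h = b"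
proof -
  have "a * 2 ^ h + b < (a + 1) * 2 ^ h" using assms by simp
  also have "\<dots> \<le> 2 ^ h * 2 ^ h" using assms by (intro mult_right_mono) auto
  finally show "a * 2 ^ h + b < 2 ^ (2 * h)" by (simp add: power_add mult_2)
qed (use assms in auto)

lemma one_less_w: "1 < (2::nat) ^ w"
  using w_pos by (rule one_less_power[rotated]) simp

lemma B_bounds: "B < 2 ^ w" "i < B \<Longrightarrow> i * h < 2 ^ w"
proof -
  have "B \<le> B * h" using chunks(3) by simp
  then show "B < 2 ^ w" using chunks(2) by (intro less_w) (rule order_trans)
  assume "i < B"
  then have "i * h \<le> B * h" by (intro mult_right_mono) auto
  then show "i * h < 2 ^ w" using chunks(2) by (intro less_w) (rule order_trans)
qed

lemma wp_chunk:
  assumes g: "params V" "table A" and d: "V vMD < 2 ^ h" and b: "V vMB < 2 ^ N"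
    and post: "\<And>V' t'. frame (chunk_c B) V A V' A \<Longrightarrow> V' vME < 2 ^ (h + N) \<Longrightarrow>
      word_poly (V' vME) = word_poly (V vMD) * word_poly (V vMB) \<Longrightarrow>
      t' \<le> t + 3 * B + 3 \<Longrightarrow> Q V' A j t'"
  shows "wp (chunk_c B) Q V A j t"
proof -
  let ?body = "Assign vMJ (Bin Sub (Var vMJ) (Cst 1)) ;;
        Assign vME (Bin Xor (Bin Shl (Var vME) (Var vH))
          (Arr aTAB (Bin Add (Bin Shl (Var vMD) (Var vH))
             (Bin And (Bin Shr (Var vMB) (Bin Mul (Var vMJ) (Var vH))) (Var vHM)))))"
  let ?V = "V(vME := 0, vMJ := B)"
  have fr: "frame (chunk_c B) V A V' A \<and> A' = A" if "frame ?body ?V A V' A'" for V' A'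
  proof -
    have "bounded_state V A \<Longrightarrow> bounded_state ?V A" using B_bounds(1) by (simp add: bounded_state_def)
    moreover have "A' = A" using that by (rule frame_no_amods) simp
    ultimately show ?thesis using that by (auto simp: frame_def)
  qed
  have "wp (Loop (Var vMJ) ?body) Q ?V A j (Suc (Suc t))"
  proof (rule wp_loop_rule[where \<mu> = "\<lambda>V A. V vMJ" and
        I = "\<lambda>V' A' j' t'. j' = j \<and> V' vMJ \<le> B \<and> t' + 3 * V' vMJ \<le> t + 2 + 3 * B \<and>
          word_poly (V' vME) = word_poly (V vMD) * word_poly (V vMB div 2 ^ (V' vMJ * h))"])
    show "j = j \<and> ?V vMJ \<le> B \<and> Suc (Suc t) + 3 * ?V vMJ \<le> t + 2 + 3 * B \<and>
       word_poly (?V vME) = word_poly (V vMD) * word_poly (V vMB div 2 ^ (?V vMJ * h))"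
    proof -
      have "V vMB < 2 ^ (B * h)" using b chunks(1) power_increasing[of N "B * h" "2::nat"] by linarith
      then show ?thesis by simp
    qed
    fix V' A' j' t'
    assume I: "j' = j \<and> V' vMJ \<le> B \<and> t' + 3 * V' vMJ \<le> t + 2 + 3 * B \<and>
          word_poly (V' vME) = word_poly (V vMD) * word_poly (V vMB div 2 ^ (V' vMJ * h))"
      and f: "frame ?body ?V A V' A'"
    have [simp]: "A' = A" using fr[OF f] by simp
    have eqs: "V' vMD = V vMD" "V' vMB = V vMB" "V' vH = h" "V' vHM = 2 ^ h - 1"
      using frameD(1)[OF f] g by (auto simp: params_def)
    \<comment> \<open>The size follows from the invariant, which gives the accumulator as a product
      of polynomials.\<close>
    have lt: "V' vME < 2 ^ (h + N)"
    proof (rule less_power_of_word_poly_mult)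
      show "word_poly (V' vME) = word_poly (V vMD) * word_poly (V vMB div 2 ^ (V' vMJ * h))" using I by simp
      show "V vMB div 2 ^ (V' vMJ * h) < 2 ^ N" using b by (meson div_le_dividend le_less_trans)
    qed (rule d)
    show "ok V' A' (Var vMJ)" by simp
    {
      assume nz: "ev V' A' (Var vMJ) \<noteq> 0"
      define i where "i = V' vMJ - 1"
      have i: "V' vMJ = Suc i" "i < B" using nz I by (auto simp: i_def)
      define c where "c = (V vMB div 2 ^ (i * h)) mod 2 ^ h"
      have c: "c < 2 ^ h" by (simp add: c_def)
      note ci = chunk_index[OF d c]
      have s1: "V' vME * 2 ^ h < 2 ^ w"
        using less_pow_w[OF shift_less[OF lt, of h]] room by simp
      have s2: "V vMD * 2 ^ h + c < 2 ^ w" using less_pow_w[OF ci(1)] room by simp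
      have s3: "V vMD * 2 ^ h + c < lim" using ci(1) table_room by simp
      have s4: "i * h < 2 ^ w" using B_bounds(2)[OF i(2)] .
      have tb: "word_poly (A aTAB (V vMD * 2 ^ h + c)) = word_poly (V vMD) * word_poly c"
        using g(2) ci by (simp add: table_def)
      have dd: "V vMB div 2 ^ (i * h) div 2 ^ h = V vMB div 2 ^ (Suc i * h)"
        by (simp add: div_mult2_eq[symmetric] power_add[symmetric] add.commute)
      have me: "word_poly (V' vME) = word_poly (V vMD) * word_poly (V vMB div 2 ^ (i * h) div 2 ^ h)"
        using I i(1) dd by simp
      have new: "word_poly (Bit_Operations.xor (V' vME * 2 ^ h) (A aTAB (V vMD * 2 ^ h + c))) =
          word_poly (V vMD) * word_poly (V vMB div 2 ^ (i * h))"
      proof -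
        have "word_poly (Bit_Operations.xor (V' vME * 2 ^ h) (A aTAB (V vMD * 2 ^ h + c))) =
            word_poly (V vMD) * (monom 1 h * word_poly (V vMB div 2 ^ (i * h) div 2 ^ h) + word_poly c)"
          unfolding word_poly_xor word_poly_mult_power tb me distrib_left
            mult.left_commute[of "monom 1 h" "word_poly (V vMD)"] ..
        also have "\<dots> = word_poly (V vMD) * word_poly (V vMB div 2 ^ (i * h))"
          unfolding c_def word_poly_div_mod[of "V vMB div 2 ^ (i * h)" h, symmetric] ..
        finally show ?thesis .
      qed
      show "wp ?body (\<lambda>V'' A'' j'' t''. (j'' = j \<and> V'' vMJ \<le> B \<and> t'' + 3 * V'' vMJ \<le> t + 2 + 3 * B \<and>
          word_poly (V'' vME) = word_poly (V vMD) * word_poly (V vMB div 2 ^ (V'' vMJ * h))) \<and>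
          V'' vMJ < V' vMJ) V' A' j' (Suc t')"
        using I s1 s2 s3 s4 new i one_less_w
        by (simp add: wp_simps eqs and_mask_mod[unfolded One_nat_def] c_def[symmetric] add_lessD1)
    }
    {
      assume z: "ev V' A' (Var vMJ) = 0"
      show "Q V' A' j' (Suc t')" using I z lt fr[OF f] by (auto intro!: post)
    }
  qed
  then show ?thesis using B_bounds(1) by (simp add: chunk_c_def wp_simps)
qed

text \<open>Quadratic in the number of chunks, which does not grow with the input; so a
  multiplication takes constant time.\<close>

definition mult_time :: nat where
  "mult_time = B * (3 * B + 8) + 5"

lemma wp_mult:
  assumes g: "params V" "table A" and a: "V vMA < 2 ^ N" and b: "V vMB < 2 ^ N"
    and post: "\<And>V' t'. frame (mult_c B) V A V' A \<Longrightarrow> V' vMC < 2 ^ N \<Longrightarrow>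
      pcong (cyc N) (word_poly (V' vMC)) (word_poly (V vMA) * word_poly (V vMB)) \<Longrightarrow>
      t' \<le> t + mult_time \<Longrightarrow> Q V' A j t'"
  shows "wp (mult_c B) Q V A j t"
proof -
  let ?body = "Assign vMI (Bin Sub (Var vMI) (Cst 1)) ;;
        Assign vMD (Bin And (Bin Shr (Var vMA) (Bin Mul (Var vMI) (Var vH))) (Var vHM)) ;;
        chunk_c B ;;
        Assign vMC (Bin Xor (Bin Shl (Var vMC) (Var vH)) (Var vME))"
  let ?V = "V(vMC := 0, vMI := B)"
  let ?last = "Assign vMC (Bin Xor (Bin And (Var vMC) (Var vMASK)) (Bin Shr (Var vMC) (Var vNB)))"
  have fr: "frame (mult_c B) V A V' A \<and> A' = A" if "frame ?body ?V A V' A'" for V' A'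
  proof -
    have "bounded_state V A \<Longrightarrow> bounded_state ?V A" using B_bounds(1) by (simp add: bounded_state_def)
    moreover have "A' = A" using that by (rule frame_no_amods) simp
    ultimately show ?thesis using that by (auto simp: frame_def)
  qed
  have "wp (Loop (Var vMI) ?body) (wp ?last Q) ?V A j (Suc (Suc t))"
  proof (rule wp_loop_rule[where \<mu> = "\<lambda>V A. V vMI" and
        I = "\<lambda>V' A' j' t'. j' = j \<and> V' vMI \<le> B \<and> t' + V' vMI * (3 * B + 8) \<le> t + 2 + B * (3 * B + 8) \<and>
          word_poly (V' vMC) = word_poly (V vMA div 2 ^ (V' vMI * h)) * word_poly (V vMB)"])
    show "j = j \<and> ?V vMI \<le> B \<and> Suc (Suc t) + ?V vMI * (3 * B + 8) \<le> t + 2 + B * (3 * B + 8) \<and>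
          word_poly (?V vMC) = word_poly (V vMA div 2 ^ (?V vMI * h)) * word_poly (V vMB)"
    proof -
      have "V vMA < 2 ^ (B * h)" using a chunks(1) power_increasing[of N "B * h" "2::nat"] by linarith
      then show ?thesis by simp
    qed
    fix V' A' j' t'
    assume I: "j' = j \<and> V' vMI \<le> B \<and> t' + V' vMI * (3 * B + 8) \<le> t + 2 + B * (3 * B + 8) \<and>
          word_poly (V' vMC) = word_poly (V vMA div 2 ^ (V' vMI * h)) * word_poly (V vMB)"
      and f: "frame ?body ?V A V' A'"
    have [simp]: "A' = A" using fr[OF f] by simp
    have eqs: "V' vMA = V vMA" "V' vMB = V vMB" "V' vH = h" "V' vHM = 2 ^ h - 1" "V' vNB = N"
        "V' vMASK = 2 ^ N - 1"
      using frameD(1)[OF f] g by (auto simp: params_def)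
    have lt: "V' vMC < 2 ^ (N + N)"
    proof (rule less_power_of_word_poly_mult)
      show "word_poly (V' vMC) = word_poly (V vMA div 2 ^ (V' vMI * h)) * word_poly (V vMB)" using I by simp
      show "V vMA div 2 ^ (V' vMI * h) < 2 ^ N" using a by (meson div_le_dividend le_less_trans)
    qed (rule b)
    show "ok V' A' (Var vMI)" by simp
    {
      assume nz: "ev V' A' (Var vMI) \<noteq> 0"
      define i where "i = V' vMI - 1"
      have i: "V' vMI = Suc i" "i < B" using nz I by (auto simp: i_def)
      define c where "c = (V vMA div 2 ^ (i * h)) mod 2 ^ h"
      have c: "c < 2 ^ h" by (simp add: c_def)
      have s1: "V' vMC * 2 ^ h < 2 ^ w"
        using less_pow_w[OF shift_less[OF lt, of h]] room by simp
      have s4: "i * h < 2 ^ w" using B_bounds(2)[OF i(2)] .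
      have dd: "V vMA div 2 ^ (i * h) div 2 ^ h = V vMA div 2 ^ (Suc i * h)"
        by (simp add: div_mult2_eq[symmetric] power_add[symmetric] add.commute)
      let ?V1 = "V'(vMI := i, vMD := c)"
      let ?R = "\<lambda>V'' A'' j'' t''. (j'' = j \<and> V'' vMI \<le> B \<and> t'' + V'' vMI * (3 * B + 8) \<le> t + 2 + B * (3 * B + 8) \<and>
          word_poly (V'' vMC) = word_poly (V vMA div 2 ^ (V'' vMI * h)) * word_poly (V vMB)) \<and>
          V'' vMI < V' vMI"
      have "wp (chunk_c B) (wp (Assign vMC (Bin Xor (Bin Shl (Var vMC) (Var vH)) (Var vME))) ?R)
          ?V1 A j (Suc (Suc (Suc t')))"
      proof (rule wp_chunk)
        show "params ?V1" using eqs by (simp add: params_def)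
        fix V2 t2
        assume f2: "frame (chunk_c B) ?V1 A V2 A" and
          p2: "word_poly (V2 vME) = word_poly (?V1 vMD) * word_poly (?V1 vMB)" and
          t2: "t2 \<le> Suc (Suc (Suc t')) + 3 * B + 3"
        have e2: "V2 vMC = V' vMC" "V2 vH = h" "V2 vMI = i"
          using frameD(1)[OF f2] eqs by auto
        have mc: "word_poly (V' vMC) = word_poly (V vMA div 2 ^ (i * h) div 2 ^ h) * word_poly (V vMB)"
          using I i(1) dd by simp
        have me: "word_poly (V2 vME) = word_poly c * word_poly (V vMB)" using p2 eqs by simp
        have "word_poly (Bit_Operations.xor (V' vMC * 2 ^ h) (V2 vME)) =
           word_poly (V vMA div 2 ^ (i * h)) * word_poly (V vMB)"
        proof -
          have "word_poly (Bit_Operations.xor (V' vMC * 2 ^ h) (V2 vME)) =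
             (monom 1 h * word_poly (V vMA div 2 ^ (i * h) div 2 ^ h) + word_poly c) * word_poly (V vMB)"
            unfolding word_poly_xor word_poly_mult_power mc me distrib_right mult.assoc ..
          also have "\<dots> = word_poly (V vMA div 2 ^ (i * h)) * word_poly (V vMB)"
            unfolding c_def word_poly_div_mod[of "V vMA div 2 ^ (i * h)" h, symmetric] ..
          finally show ?thesis .
        qed
        then show "wp (Assign vMC (Bin Xor (Bin Shl (Var vMC) (Var vH)) (Var vME))) ?R V2 A j t2"
          using I s1 i t2 by (simp add: wp_simps e2)
      qed (use g c b eqs in auto)
      then show "wp ?body ?R V' A' j' (Suc t')"
        using I s4 i one_less_w by (simp add: wp_simps eqs and_mask_mod[unfolded One_nat_def] c_def[symmetric])
    }
    {
      assume z: "ev V' A' (Var vMI) = 0"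
      let ?r = "Bit_Operations.xor (V' vMC mod 2 ^ N) (V' vMC div 2 ^ N)"
      have "V' vMC div 2 ^ N < 2 ^ N" using lt by (simp add: less_mult_imp_div_less power_add)
      then have r: "?r < 2 ^ N" by (intro xor_less_power) auto
      have "Q (V'(vMC := ?r)) A j (Suc (Suc t'))"
      proof (rule post)
        have f1: "frame (mult_c B) V A V' A" using fr[OF f] by simp
        have "?r < 2 ^ w" using r room by (intro less_pow_w[OF r]) simp
        then show "frame (mult_c B) V A (V'(vMC := ?r)) A"
          using f1 by (auto simp: frame_def bounded_state_def)
        show "pcong (cyc N) (word_poly ((V'(vMC := ?r)) vMC)) (word_poly (V vMA) * word_poly (V vMB))"
          using word_poly_fold[of N "V' vMC"] I z by simp
      qed (use r I z in \<open>auto simp: mult_time_def\<close>)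
      then show "wp ?last Q V' A' j' (Suc t')"
        using I by (simp add: wp_simps eqs and_mask_mod[unfolded One_nat_def])
    }
  qed
  then show ?thesis using B_bounds(1) by (simp add: mult_c_def wp_simps)
qed

lemma wp_table:
  assumes g: "params V" and z: "\<And>i. A aTAB i = 0"
    and post: "\<And>V' A' t'. frame table_c V A V' A' \<Longrightarrow> table A' \<Longrightarrow>
      t' \<le> t + 3 + 2 ^ (2 * h) * 6 \<Longrightarrow> Q V' A' j t'"
  shows "wp table_c Q V A j t"
proof -
  let ?n = "2 ^ (2 * h) :: nat"
  let ?c = "Assign vU (Bin Shr (Var vJ) (Var vH)) ;;
        Assign vV (Bin And (Var vJ) (Var vHM)) ;;
        Assign vE (Arr aTAB (Bin Add (Bin Shl (Bin Shr (Var vU) (Cst 1)) (Var vH)) (Var vV))) ;;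
        Put aTAB (Var vJ) (Bin Xor (Bin Shl (Var vE) (Cst 1))
          (Bin Mul (Bin And (Var vU) (Cst 1)) (Var vV)))"
  have nw: "?n < 2 ^ w" using room N_pos by (intro power_strict_increasing) auto
  have g1: "V vH = h" "V vHM = 2 ^ h - 1" using g by (auto simp: params_def)
  have hh: "h + h < 2 ^ w" using room N_pos by (intro less_w) simp
  have "wp (for_c vJ vP ?c) Q (V(vP := ?n)) A j (Suc t)"
  proof (rule wp_for[where m = ?n and \<kappa> = 4 and
        I = "\<lambda>k V' A' j'. j' = j \<and> (\<forall>i. k \<le> i \<longrightarrow> A' aTAB i = 0) \<and>
          (\<forall>i<k. word_poly (A' aTAB i) = word_poly (i div 2 ^ h) * word_poly (i mod 2 ^ h))"])
    fix k V' A' j' t'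
    assume k: "k < ?n" and I: "j' = j \<and> (\<forall>i. k \<le> i \<longrightarrow> A' aTAB i = 0) \<and>
          (\<forall>i<k. word_poly (A' aTAB i) = word_poly (i div 2 ^ h) * word_poly (i mod 2 ^ h))"
      and J: "V' vJ = k" and f: "frame (for_c vJ vP ?c) (V(vP := ?n)) A V' A'"
    have eqs: "V' vH = h" "V' vHM = 2 ^ h - 1" using frameD(1)[OF f] g1 by auto
    define a b where "a = k div 2 ^ h" and "b = k mod 2 ^ h"
    have ab: "a < 2 ^ h" "b < 2 ^ h"
      using k by (auto simp: a_def b_def mult_2 power_add less_mult_imp_div_less)
    have kab: "k = a * 2 ^ h + b" unfolding a_def b_def by (rule div_mult_mod_eq[symmetric])
    have a2: "a div 2 < 2 ^ h" using ab(1) by (rule le_less_trans[rotated]) simp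
    note ci = chunk_index[OF a2 ab(2)]
    let ?o = "A' aTAB (a div 2 * 2 ^ h + b)"
    \<comment> \<open>For \<open>a = 0\<close> the entry consulted is the one about to be written;
      its initial value 0 is the correct product.\<close>
    have old: "word_poly ?o = word_poly (a div 2) * word_poly b"
    proof (cases "a = 0")
      case True
      then show ?thesis using I kab by simp
    next
      case False
      then have "a div 2 * 2 ^ h + b < k" unfolding kab by simp
      then show ?thesis using I ci(2,3) by auto
    qed
    have "?o < 2 ^ (h + h)" using less_power_of_word_poly_mult[OF old a2 ab(2)] .
    then have s1: "?o * 2 ^ 1 < 2 ^ w"
      using less_pow_w[OF shift_less[of ?o "h + h" 1]] room N_pos by simp
    have s2: "a div 2 * 2 ^ h + b < 2 ^ w" using less_pow_w[OF ci(1)] room by simp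
    have s3: "a div 2 * 2 ^ h + b < lim" "k < lim" using ci(1) k table_room by auto
    have s4: "a mod 2 * b < 2 ^ w"
    proof -
      have "a mod 2 * b \<le> 1 * b" by (rule mult_right_mono) auto
      also have "1 * b < 2 ^ w" using less_pow_w[OF ab(2)] room by simp
      finally show ?thesis .
    qed
    have "word_poly (a mod 2 * b) = word_poly (a mod 2) * word_poly b"
    proof (cases "even a")
      case False
      then have "a mod 2 = 1" by presburger
      then show ?thesis using word_poly_1 by simp
    qed (simp add: even_iff_mod_2_eq_zero)
    then have "word_poly (Bit_Operations.xor (?o * 2 ^ 1) (a mod 2 * b)) =
        (monom 1 1 * word_poly (a div 2 ^ 1) + word_poly (a mod 2 ^ 1)) * word_poly b"
      unfolding word_poly_xor word_poly_mult_power old distrib_right mult.assoc by simp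
    then have new: "word_poly (Bit_Operations.xor (?o * 2 ^ 1) (a mod 2 * b)) = word_poly a * word_poly b"
      unfolding word_poly_div_mod[of a 1, symmetric] .
    then show "wp ?c (\<lambda>V'' A'' j'' t''. (j'' = j \<and> (\<forall>i. Suc k \<le> i \<longrightarrow> A'' aTAB i = 0) \<and>
          (\<forall>i<Suc k. word_poly (A'' aTAB i) = word_poly (i div 2 ^ h) * word_poly (i mod 2 ^ h))) \<and>
          t'' \<le> t' + 4) V' A' j' t'"
      using I s1 s2 s3 s4 one_less_w add_lessD1[OF s2]
      by (simp add: wp_simps eqs J and_mask_mod[unfolded One_nat_def] a_def[symmetric] b_def[symmetric] and_one_eq less_Suc_eq)
  next
    fix V' A' j' t'
    assume I: "j' = j \<and> (\<forall>i. ?n \<le> i \<longrightarrow> A' aTAB i = 0) \<and>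
          (\<forall>i<?n. word_poly (A' aTAB i) = word_poly (i div 2 ^ h) * word_poly (i mod 2 ^ h))"
      and f: "frame (for_c vJ vP ?c) (V(vP := ?n)) A V' A'" and t: "t' \<le> Suc t + 2 + ?n * (4 + 2)"
    have "bounded_state V A \<Longrightarrow> bounded_state (V(vP := ?n)) A" using nw by (simp add: bounded_state_def)
    then have "frame table_c V A V' A'" using f by (auto simp: frame_def)
    then have "Q V' A' j t'" by (rule post) (use I t in \<open>auto simp: table_def\<close>)
    then show "Q V' A' j' t'" using I by simp
  qed (use nw z in auto)
  then show ?thesis using hh nw one_less_w
    by (simp add: table_c_def wp_simps g1 mult_2)
qed

end

subsection \<open>Parameters and random weights\<close>

text \<open>Doubling yields the bit length \<open>vLF\<close> of \<open>n\<close>. Chunks have about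
  half that length, so the table has O(n) entries. \<open>vP\<close> becomes the least power of 3
  whose double is at least \<open>a\<close> times the bit length; that double bounds the degree of a
  prime factor from below. \<open>Bin Eq _ (Cst 0)\<close> serves as negation.\<close>

definition setup_c :: "nat \<Rightarrow> com" where
  "setup_c a =
     Assign vN (Inp (Cst 0)) ;; Assign vM (Inp (Cst 1)) ;;
     Assign vS1 (Inp (Cst 2)) ;; Assign vT1 (Inp (Cst 3)) ;;
     Assign vS2 (Inp (Cst 4)) ;; Assign vT2 (Inp (Cst 5)) ;;
     Assign vP (Cst 1) ;; Assign vLF (Cst 0) ;;
     Loop (Bin Eq (Bin Less (Var vN) (Var vP)) (Cst 0))
       (Assign vP (Bin Add (Var vP) (Var vP)) ;; Assign vLF (Bin Add (Var vLF) (Cst 1))) ;;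
     Assign vH (Bin Add (Bin Div (Var vLF) (Cst 2)) (Cst 1)) ;;
     Assign vP (Cst 1) ;;
     Loop (Bin Less (Bin Mul (Cst 2) (Var vP)) (Bin Mul (Cst a) (Var vLF)))
       (Assign vP (Bin Mul (Cst 3) (Var vP))) ;;
     Assign vNB (Bin Mul (Cst 3) (Var vP)) ;;
     Assign vMASK (Bin Sub (Bin Shl (Cst 1) (Var vNB)) (Cst 1)) ;;
     Assign vHM (Bin Sub (Bin Shl (Cst 1) (Var vH)) (Cst 1))"

text \<open>Two words are drawn for every edge, even if both paths get the same weight. Thus edge
  \<open>i\<close> always owns the tape entries \<open>2 * i\<close> and
  \<open>2 * i + 1\<close>.\<close>

definition random_c :: com where
  "random_c = for_c vJ vM
     (Draw vK ;; Put aX (Var vJ) (Bin And (Var vK) (Var vMASK)) ;; Draw vK ;;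
      Cond (Bin And (Bin Eq (Var vS1) (Var vS2)) (Bin Eq (src_e (Var vJ)) (Var vS1)))
        (Put aY (Var vJ) (Bin And (Var vK) (Var vMASK)))
        (Put aY (Var vJ) (Arr aX (Var vJ))))"

definition adjacency_c :: com where
  "adjacency_c = for_c vJ vM
     (Assign vU (src_e (Var vJ)) ;; Assign vV (tgt_e (Var vJ)) ;;
      Put aNEXT (Var vJ) (Arr aHEAD (Var vU)) ;;
      Put aHEAD (Var vU) (Bin Add (Var vJ) (Cst 1)) ;;
      Put aIN (Var vV) (Bin Add (Arr aIN (Var vV)) (Cst 1)))"

definition queue_c :: com where
  "queue_c = Assign vQL (Cst 0) ;;
     for_c vJ vN
       (Cond (Arr aIN (Var vJ)) skip_c
          (Put aQ (Var vQL) (Var vJ) ;; Assign vQL (Bin Add (Var vQL) (Cst 1))))"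

definition emit_c :: com where
  "emit_c =
     Assign vE (Bin Sub (Var vE) (Cst 1)) ;; Put aORD (Var vK) (Var vE) ;;
     Assign vK (Bin Add (Var vK) (Cst 1)) ;; Assign vV (tgt_e (Var vE)) ;;
     Put aIN (Var vV) (Bin Sub (Arr aIN (Var vV)) (Cst 1)) ;;
     Cond (Arr aIN (Var vV)) skip_c
       (Put aQ (Var vQL) (Var vV) ;; Assign vQL (Bin Add (Var vQL) (Cst 1))) ;;
     Assign vE (Arr aNEXT (Var vE))"

text \<open>Kahn's algorithm with edges as output: an edge is emitted when its tail is taken from
  the queue. The pointer \<open>vE\<close> is one more than the edge, 0 marking the end of the
  list.\<close>

definition kahn_c :: com where
  "kahn_c = Assign vI (Cst 0) ;; Assign vK (Cst 0) ;;
     Loop (Bin Less (Var vI) (Var vQL))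
       (Assign vU (Arr aQ (Var vI)) ;; Assign vE (Arr aHEAD (Var vU)) ;;
        Loop (Var vE) emit_c ;;
        Assign vI (Bin Add (Var vI) (Cst 1)))"

lemma vmods_prepare [simp]:
  "vmods (setup_c a) = {vN, vM, vS1, vT1, vS2, vT2, vP, vLF, vH, vNB, vMASK, vHM}"
  "vmods random_c = {vJ, vK}" "vmods adjacency_c = {vJ, vU, vV}" "vmods queue_c = {vQL, vJ, vTMP}"
  "vmods emit_c = {vE, vK, vV, vQL, vTMP}" "vmods kahn_c = {vI, vK, vU, vE, vV, vQL, vTMP}"
  by (auto simp: setup_c_def random_c_def adjacency_c_def queue_c_def emit_c_def kahn_c_def)

lemma amods_prepare [simp]:
  "amods (setup_c a) = {}" "amods random_c = {aX, aY}" "amods adjacency_c = {aHEAD, aNEXT, aIN}"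
  "amods queue_c = {aQ}" "amods emit_c = {aORD, aIN, aQ}" "amods kahn_c = {aORD, aIN, aQ}"
  by (auto simp: setup_c_def random_c_def adjacency_c_def queue_c_def emit_c_def kahn_c_def)

lemma wf_prepare [simp]:
  "wf_com (setup_c a)" "wf_com random_c" "wf_com adjacency_c" "wf_com queue_c" "wf_com kahn_c"
  by (auto simp: setup_c_def random_c_def adjacency_c_def queue_c_def emit_c_def kahn_c_def)

lemma and_of_bool [simp]: "Bit_Operations.and (of_bool a) (of_bool b) = (of_bool (a \<and> b) :: nat)"
  by (cases a; cases b) auto

text \<open>\<open>2 * 3 ^ k\<close> is the degree guaranteed by
  \<open>cyc_large_prime_factor\<close>.\<close>

definition field_exp :: "nat \<Rightarrow> nat \<Rightarrow> nat" where
  "field_exp a l = (LEAST k. a * l \<le> 2 * 3 ^ k)"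

lemma field_exp: "a * l \<le> 2 * 3 ^ field_exp a l" "k < field_exp a l \<Longrightarrow> 2 * 3 ^ k < a * l"
proof -
  have "a * l \<le> 2 * 3 ^ (a * l)" using less_exp[of "a * l"] power_mono[of 2 "3::nat" "a * l"] by linarith
  then show "a * l \<le> 2 * 3 ^ field_exp a l" unfolding field_exp_def by (rule LeastI)
  show "k < field_exp a l \<Longrightarrow> 2 * 3 ^ k < a * l"
    unfolding field_exp_def using not_less_Least not_le by blast
qed

lemma field_exp_le: "field_exp a l \<le> a * l"
proof (cases "field_exp a l")
  case (Suc k)
  have "k < 3 ^ k" using less_exp[of k] power_mono[of 2 "3::nat" k] by linarith
  then show ?thesis using field_exp(2)[of k a l] Suc by simp
qed simp

text \<open>\<open>2 * n < 2 ^ w\<close> covers the last doubling, which may pass \<open>n\<close>.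
  The doubling loop takes \<open>l\<close> rounds of three ticks; the rounds of the second loop, of
  two ticks each, are crudely bounded by \<open>a * l\<close>.\<close>

lemma (in ram) wp_setup:
  fixes n a :: nat
  defines "l \<equiv> floorlog 2 n"
  defines "N \<equiv> 3 * 3 ^ field_exp a l" and "h \<equiv> l div 2 + 1"
  assumes n: "n = inp 0" "0 < n" and base: "6 \<le> base" and room: "2 * n < 2 ^ w" "N < w" "h < w"
    "a < 2 ^ w"
    and post: "\<And>V' t'. frame (setup_c a) V A V' A \<Longrightarrow> V' vN = n \<Longrightarrow> V' vM = inp 1 \<Longrightarrow>
      V' vS1 = inp 2 \<Longrightarrow> V' vT1 = inp 3 \<Longrightarrow> V' vS2 = inp 4 \<Longrightarrow> V' vT2 = inp 5 \<Longrightarrow>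
      V' vH = h \<Longrightarrow> V' vNB = N \<Longrightarrow> V' vMASK = 2 ^ N - 1 \<Longrightarrow> V' vHM = 2 ^ h - 1 \<Longrightarrow>
      t' \<le> t + 15 + 3 * l + 2 * (a * l) \<Longrightarrow> Q V' A j t'"
  shows "wp (setup_c a) Q V A j t"
proof -
  let ?g = "\<lambda>V'. V' vN = n \<and> V' vM = inp 1 \<and> V' vS1 = inp 2 \<and> V' vT1 = inp 3 \<and> V' vS2 = inp 4 \<and> V' vT2 = inp 5"
  let ?k = "field_exp a l"
  have l: "2 ^ (l - 1) \<le> n" "n < 2 ^ l" "0 < l"
    using floorlog_bounds[of n 2] n floorlog_eq_zero_iff[of 2 n] by (auto simp: l_def)
  have less_w: "x \<le> w \<Longrightarrow> x < (2::nat) ^ w" for x by (rule le_less_trans[of _ w]) auto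
  have al: "a * l \<le> N" using field_exp(1)[of a l] by (simp add: N_def)
  have pN: "2 * 3 ^ k < (2::nat) ^ w" "3 * 3 ^ k < (2::nat) ^ w" if "k \<le> ?k" for k
  proof -
    have *: "(3::nat) ^ k \<le> 3 ^ ?k" using that by (rule power_increasing) simp
    have "2 * 3 ^ k \<le> N" using * unfolding N_def by linarith
    moreover have "3 * 3 ^ k \<le> N" using * unfolding N_def by linarith
    ultimately
    show "2 * 3 ^ k < (2::nat) ^ w" "3 * 3 ^ k < (2::nat) ^ w"
      using less_w room(2) by (meson le_trans less_imp_le)+
  qed
  have c: "k < 2 ^ w" if "k \<le> 3" for k :: nat
  proof -
    have "3 \<le> N" by (simp add: N_def)
    then show ?thesis using that less_w room(2) by (meson le_trans less_imp_le)
  qed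
  have c': "k < 2 ^ w" if "k < 6" for k :: nat using that base space by linarith
  have pows: "2 ^ N < (2::nat) ^ w" "2 ^ h < (2::nat) ^ w" using room by (auto intro: power_strict_increasing)
  have lw: "l < 2 ^ w" "h < 2 ^ w"
  proof -
    have "l - 1 < 2 ^ (l - 1)" by simp
    then show "l < 2 ^ w" using l room by linarith
    show "h < 2 ^ w" using less_w room by simp
  qed
  define fin where "fin = (Assign vNB (Bin Mul (Cst 3) (Var vP)) ;;
     Assign vMASK (Bin Sub (Bin Shl (Cst 1) (Var vNB)) (Cst 1)) ;;
     Assign vHM (Bin Sub (Bin Shl (Cst 1) (Var vH)) (Cst 1)))"
  define b1 where "b1 = (Assign vP (Bin Add (Var vP) (Var vP)) ;; Assign vLF (Bin Add (Var vLF) (Cst 1)))"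
  define b2 where "b2 = Assign vP (Bin Mul (Cst 3) (Var vP))"
  let ?fin = "\<lambda>Q V' t'. wp fin Q V' A j t'"
  let ?Q = "\<lambda>V' A' j' t'. A' = A \<and> j' = j \<and> ?g V' \<and> V' vH = h \<and> V' vNB = N \<and> V' vMASK = 2 ^ N - 1 \<and>
     V' vHM = 2 ^ h - 1 \<and> t' \<le> t + 15 + 3 * l + 2 * (a * l)"
  have s3: "wp fin ?Q V' A j t'" if "?g V'" "V' vH = h" "3 * V' vP = N" "t' \<le> t + 12 + 3 * l + 2 * (a * l)" for V' t'
    using that pows c less_w[of N] room(2) by (simp add: fin_def wp_simps)
  have s2: "wp (Loop (Bin Less (Bin Mul (Cst 2) (Var vP)) (Bin Mul (Cst a) (Var vLF))) b2)
      (wp fin ?Q) V1 A j t1"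
    if V1: "?g V1" "V1 vH = h" "V1 vLF = l" "V1 vP = 1" "t1 \<le> t + 11 + 3 * l" for V1 t1
  proof (rule wp_loop_rule[where \<mu> = "\<lambda>V' A'. a * l - V' vP" and
        I = "\<lambda>V' A' j' t'. A' = A \<and> j' = j \<and> (\<exists>k \<le> ?k. V' vP = 3 ^ k \<and> t' \<le> t + 11 + 3 * l + 2 * k)"])
    show "A = A \<and> j = j \<and> (\<exists>k \<le> ?k. V1 vP = 3 ^ k \<and> t1 \<le> t + 11 + 3 * l + 2 * k)"
      using V1 by (auto intro!: exI[of _ 0])
    fix V' A' j' t'
    assume I: "A' = A \<and> j' = j \<and> (\<exists>k \<le> ?k. V' vP = 3 ^ k \<and> t' \<le> t + 11 + 3 * l + 2 * k)"
      and f: "frame b2 V1 A V' A'"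
    obtain k where k: "k \<le> ?k" "V' vP = 3 ^ k" "t' \<le> t + 11 + 3 * l + 2 * k" using I by blast
    have g: "?g V'" "V' vH = h" "V' vLF = l" using frameD(1)[OF f] V1 by (auto simp: b2_def)
    have alw: "a * l < 2 ^ w" using less_w al room(2) by simp
    show "ok V' A' (Bin Less (Bin Mul (Cst 2) (Var vP)) (Bin Mul (Cst a) (Var vLF)))"
      using pN(1)[OF k(1)] alw room(4) c by (simp add: g k(2))
    {
      assume "ev V' A' (Bin Less (Bin Mul (Cst 2) (Var vP)) (Bin Mul (Cst a) (Var vLF))) \<noteq> 0"
      then have lt: "2 * 3 ^ k < a * l" by (simp add: g k(2) split: if_splits)
      then have "k \<noteq> ?k" using field_exp(1)[of a l] by auto
      then have k': "Suc k \<le> ?k" using k(1) by simp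
      show "wp b2 (\<lambda>V'' A'' j'' t''. (A'' = A \<and> j'' = j \<and> (\<exists>k \<le> ?k. V'' vP = 3 ^ k \<and> t'' \<le> t + 11 + 3 * l + 2 * k)) \<and>
         a * l - V'' vP < a * l - V' vP) V' A' j' (Suc t')"
        using I k k' pN(2)[OF k(1)] c lt
        by (auto simp: b2_def wp_simps intro!: exI[of _ "Suc k"] diff_less_mono2)
    }
    {
      assume "ev V' A' (Bin Less (Bin Mul (Cst 2) (Var vP)) (Bin Mul (Cst a) (Var vLF))) = 0"
      then have "\<not> 2 * 3 ^ k < a * l" by (simp add: g k(2) split: if_splits)
      then have "k = ?k" using field_exp(2)[of k a l] k(1) by fastforce
      then show "wp fin ?Q V' A' j' (Suc t')"
        using I s3[of V' "Suc t'"] g k field_exp_le[of a l] by (simp add: N_def)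
    }
  qed
  let ?V = "V(vN := n, vM := inp 1, vS1 := inp 2, vT1 := inp 3, vS2 := inp 4, vT2 := inp 5, vP := 1, vLF := 0)"
  let ?mid = "wp (Assign vH (Bin Add (Bin Div (Var vLF) (Cst 2)) (Cst 1)) ;; Assign vP (Cst 1) ;;
     Loop (Bin Less (Bin Mul (Cst 2) (Var vP)) (Bin Mul (Cst a) (Var vLF))) b2 ;; fin) ?Q"
  have s1: "wp (Loop (Bin Eq (Bin Less (Var vN) (Var vP)) (Cst 0)) b1) ?mid ?V A j (t + 8)"
  proof (rule wp_loop_rule[where \<mu> = "\<lambda>V' A'. Suc n - V' vP" and
        I = "\<lambda>V' A' j' t'. A' = A \<and> j' = j \<and> V' vP = 2 ^ V' vLF \<and> V' vLF \<le> l \<and> t' \<le> t + 8 + 3 * V' vLF"])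
    show "A = A \<and> j = j \<and> ?V vP = 2 ^ ?V vLF \<and> ?V vLF \<le> l \<and> t + 8 \<le> t + 8 + 3 * ?V vLF" by simp
    fix V' A' j' t'
    assume I: "A' = A \<and> j' = j \<and> V' vP = 2 ^ V' vLF \<and> V' vLF \<le> l \<and> t' \<le> t + 8 + 3 * V' vLF"
      and f: "frame b1 ?V A V' A'"
    have g: "?g V'" using frameD(1)[OF f] by (auto simp: b1_def)
    show "ok V' A' (Bin Eq (Bin Less (Var vN) (Var vP)) (Cst 0))" by simp
    {
      assume "ev V' A' (Bin Eq (Bin Less (Var vN) (Var vP)) (Cst 0)) \<noteq> 0"
      then have le: "2 ^ V' vLF \<le> n" using I g by (simp split: if_splits)
      then have "(2::nat) ^ V' vLF < 2 ^ l" using l(2) by linarith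
      then have lt: "V' vLF < l" by simp
      show "wp b1 (\<lambda>V'' A'' j'' t''. (A'' = A \<and> j'' = j \<and> V'' vP = 2 ^ V'' vLF \<and> V'' vLF \<le> l \<and>
          t'' \<le> t + 8 + 3 * V'' vLF) \<and> Suc n - V'' vP < Suc n - V' vP) V' A' j' (Suc t')"
        using I le lt room(1) lw c by (auto simp: b1_def wp_simps intro!: diff_less_mono2)
    }
    {
      assume "ev V' A' (Bin Eq (Bin Less (Var vN) (Var vP)) (Cst 0)) = 0"
      then have "n < 2 ^ V' vLF" using I g by (simp split: if_splits)
      then have "(2::nat) ^ (l - 1) < 2 ^ V' vLF" using l(1) by linarith
      then have "l - 1 < V' vLF" by simp
      then have lf: "V' vLF = l" using I l(3) by linarith
      show "?mid V' A' j' (Suc t')"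
        using I lf lw c s2[of "V'(vH := h, vP := 1)" "Suc (Suc (Suc t'))"] g
        by (simp add: wp_simps h_def)
    }
  qed
  have t8: "t + 8 = Suc (Suc (Suc (Suc (Suc (Suc (Suc (Suc t)))))))" by simp
  have "wp (setup_c a) ?Q V A j t"
    using s1[unfolded t8] c c' base unfolding setup_c_def fin_def[symmetric] b1_def[symmetric] b2_def[symmetric]
    by (simp add: wp_Assign wp_Then n(1)[symmetric])
  then show ?thesis
    by (rule wp_conseq) (auto intro!: post)
qed

text \<open>After \<open>k\<close> relaxations the labels are at most \<open>1 + k * Wm\<close>.
  \<open>dist_room\<close> adds one more weight for the sum formed before a comparison. The rank
  witnesses acyclicity in terms of the input cells.\<close>

locale graph_ram = field_ram w lim base inp \<omega> B N h
  for w lim base inp \<omega> B N h +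
  fixes n m Wm :: nat and \<rho> :: "nat \<Rightarrow> nat"
  assumes base_eq: "base = 6 + 3 * m"
    and nm_lim: "n \<le> lim" "m \<le> lim"
    and ends_less: "inp (3 * e + 6) < n \<or> m \<le> e" "inp (3 * e + 7) < n \<or> m \<le> e"
    and weight_le: "e < m \<Longrightarrow> inp (3 * e + 8) \<le> Wm"
    and weight_pos: "e < m \<Longrightarrow> 0 < inp (3 * e + 8)"
    and dist_room: "1 + m * Wm + Wm < 2 ^ w"
    and rank: "e < m \<Longrightarrow> \<rho> (inp (3 * e + 6)) < \<rho> (inp (3 * e + 7))"
    and terminals: "inp 2 < n" "inp 3 < n" "inp 4 < n" "inp 5 < n"
begin

definition src :: "nat \<Rightarrow> nat" where "src e = inp (3 * e + 6)"
definition tgt :: "nat \<Rightarrow> nat" where "tgt e = inp (3 * e + 7)"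
definition wgt :: "nat \<Rightarrow> nat" where "wgt e = inp (3 * e + 8)"

definition globals :: "env \<Rightarrow> bool" where
  "globals V \<longleftrightarrow> params V \<and> V vN = n \<and> V vM = m \<and> V vS1 = inp 2 \<and> V vT1 = inp 3 \<and>
     V vS2 = inp 4 \<and> V vT2 = inp 5"

text \<open>Variables 1 to 11 hold parameters and are written by \<open>setup_c\<close> alone; 0 is
  the result, and those from 12 on are scratch.\<close>

lemma globals_frame:
  assumes "globals V" "frame c V A V' A'" "\<forall>x\<in>vmods c. x = 0 \<or> 12 \<le> x"
  shows "globals V'"
proof -
  have "V' x = V x" if "0 < x" "x < 12" for x
  proof (rule frameD(1)[OF assms(2)], rule notI)
    assume "x \<in> vmods c"
    then have "x = 0 \<or> 12 \<le> x" using assms(3) by blast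
    then show False using that by simp
  qed
  then show ?thesis using assms(1) by (simp add: globals_def params_def)
qed

lemma src_less: "e < m \<Longrightarrow> src e < n" and tgt_less: "e < m \<Longrightarrow> tgt e < n"
  using ends_less[of e] by (auto simp: src_def tgt_def)

lemma src_lim: "e < m \<Longrightarrow> src e < lim" and tgt_lim: "e < m \<Longrightarrow> tgt e < lim"
  using src_less[of e] tgt_less[of e] nm_lim by auto

lemma less_lim_w: "x < lim \<Longrightarrow> Suc x < 2 ^ w"
  using space by linarith

lemma m_less_w: "m < 2 ^ w"
  using space base_eq by linarith

lemma n_less_w: "n < 2 ^ w"
proof -
  have "16 * n \<le> 2 ^ w" using space nm_lim(1) by linarith
  then show ?thesis using one_less_w by (cases n) auto
qed

lemma address_bounds:
  "x < m \<Longrightarrow> (8 :: nat) < 2 ^ w \<and> 3 * x + 8 < 2 ^ w \<and> 3 * x + 8 < base"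
  using space base_eq by linarith

lemma src_e [simp]:
  "ev V A (src_e e) = src (ev V A e)" "ok V A e \<Longrightarrow> ev V A e < m \<Longrightarrow> ok V A (src_e e)"
  using address_bounds[of "ev V A e"] by (auto simp: src_e_def src_def)

lemma tgt_e [simp]:
  "ev V A (tgt_e e) = tgt (ev V A e)" "ok V A e \<Longrightarrow> ev V A e < m \<Longrightarrow> ok V A (tgt_e e)"
  using address_bounds[of "ev V A e"] by (auto simp: tgt_e_def tgt_def)

lemma wgt_e [simp]:
  "ev V A (wgt_e e) = wgt (ev V A e)" "ok V A e \<Longrightarrow> ev V A e < m \<Longrightarrow> ok V A (wgt_e e)"
  using address_bounds[of "ev V A e"] by (auto simp: wgt_e_def wgt_def)

definition random_weights :: "nat \<Rightarrow> arrs \<Rightarrow> bool" where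
  "random_weights j A \<longleftrightarrow> (\<forall>i<m. A aX i = \<omega> (j + 2 * i) mod 2 ^ N \<and>
     A aY i = \<omega> (if inp 2 = inp 4 \<and> src i = inp 2 then Suc (j + 2 * i) else j + 2 * i) mod 2 ^ N)"

lemma wp_random:
  assumes g: "globals V"
    and post: "\<And>V' A' t'. frame random_c V A V' A' \<Longrightarrow> random_weights j A' \<Longrightarrow>
      t' \<le> t + 2 + m * 7 \<Longrightarrow> Q V' A' (j + 2 * m) t'"
  shows "wp random_c Q V A j t"
  unfolding random_c_def
proof (rule wp_for[where m = m and \<kappa> = 5 and I = "\<lambda>k V' A' j'. j' = j + 2 * k \<and> (\<forall>i<k. A' aX i = \<omega> (j + 2 * i) mod 2 ^ N \<and>
     A' aY i = \<omega> (if inp 2 = inp 4 \<and> src i = inp 2 then Suc (j + 2 * i) else j + 2 * i) mod 2 ^ N)"],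
     goal_cases)
  case (8 k V' A' j' t')
  then have "globals V'" by (intro globals_frame[OF g]) auto
  then have eqs: "V' vMASK = 2 ^ N - 1" "V' vS1 = inp 2" "V' vS2 = inp 4"
    by (auto simp: globals_def params_def)
  have "k < lim" using 8 nm_lim by simp
  then show ?case using 8 by (auto simp: wp_simps eqs and_mask_mod[unfolded One_nat_def] less_Suc_eq)
next
  case (9 V' A' j' t')
  have "Q V' A' (j + 2 * m) t'"
    by (rule post) (use 9 in \<open>auto simp: random_weights_def random_c_def\<close>)
  then show ?case using 9 by simp
qed (use g m_less_w in \<open>auto simp: globals_def\<close>)

subsection \<open>Topological order of the edges\<close>

text \<open>\<open>prev_edge u k\<close> is one more than the last edge before \<open>k\<close> that leaves \<open>u\<close>, or 0. The
  adjacency lists consist of such pointers.\<close>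

fun prev_edge :: "nat \<Rightarrow> nat \<Rightarrow> nat" where
  "prev_edge u 0 = 0"
| "prev_edge u (Suc k) = (if src k = u then Suc k else prev_edge u k)"

lemma prev_edge_le: "prev_edge u k \<le> k"
  by (induction k) auto

lemma prev_edge_Suc: "prev_edge u k = Suc e \<Longrightarrow> src e = u"
  by (induction k) (auto split: if_splits)

lemma prev_edge_between: "prev_edge u k \<le> e \<Longrightarrow> e < k \<Longrightarrow> src e \<noteq> u"
  by (induction k) (auto split: if_splits simp: less_Suc_eq)

definition adjacency :: "arrs \<Rightarrow> bool" where
  "adjacency A \<longleftrightarrow> (\<forall>u. A aHEAD u = prev_edge u m) \<and> (\<forall>e<m. A aNEXT e = prev_edge (src e) e)"

definition indegree :: "nat \<Rightarrow> nat set \<Rightarrow> nat" where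
  "indegree v X = card {e. e < m \<and> tgt e = v \<and> e \<notin> X}"

lemma wp_adjacency:
  assumes g: "globals V" and z: "\<And>i. A aHEAD i = 0" "\<And>i. A aIN i = 0"
    and post: "\<And>V' A' t'. frame adjacency_c V A V' A' \<Longrightarrow> adjacency A' \<Longrightarrow>
      (\<forall>v. A' aIN v = indegree v {}) \<Longrightarrow> t' \<le> t + 2 + m * 7 \<Longrightarrow> Q V' A' j t'"
  shows "wp adjacency_c Q V A j t"
  unfolding adjacency_c_def
proof (rule wp_for[where m = m and \<kappa> = 5 and I = "\<lambda>k V' A' j'. j' = j \<and> (\<forall>u. A' aHEAD u = prev_edge u k) \<and>
     (\<forall>e<k. A' aNEXT e = prev_edge (src e) e) \<and> (\<forall>v. A' aIN v = card {e. e < k \<and> tgt e = v})"],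
     goal_cases)
  case (8 k V' A' j' t')
  have "k < lim" using 8 nm_lim by simp
  have card: "card {e. e < k \<and> tgt e = v} \<le> k" for v
    using card_mono[of "{..<k}" "{e. e < k \<and> tgt e = v}"] by auto
  have "{e. e < Suc k \<and> tgt e = tgt k} = insert k {e. e < k \<and> tgt e = tgt k}" by auto
  then have c1: "card {e. e < Suc k \<and> tgt e = tgt k} = Suc (card {e. e < k \<and> tgt e = tgt k})" by simp
  have c2: "{e. e < Suc k \<and> tgt e = v} = {e. e < k \<and> tgt e = v}" if "v \<noteq> tgt k" for v
    using that by (auto simp: less_Suc_eq)
  have w: "Suc k < 2 ^ w" "Suc (card {e. e < k \<and> tgt e = tgt k}) < 2 ^ w"
    using less_lim_w[OF \<open>k < lim\<close>] card[of "tgt k"] by linarith+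
  show ?case using 8 \<open>k < lim\<close> w src_lim[of k] tgt_lim[of k] one_less_w
    by (auto simp: wp_simps less_Suc_eq c1[unfolded less_Suc_eq] c2[unfolded less_Suc_eq])
next
  case (9 V' A' j' t')
  have "Q V' A' j t'"
    by (rule post) (use 9 in \<open>auto simp: adjacency_def adjacency_c_def indegree_def\<close>)
  then show ?case using 9 by simp
qed (use g z m_less_w in \<open>auto simp: globals_def\<close>)

text \<open>When an edge is processed, all listed edges into its tail have been processed
  before.\<close>

definition topo :: "(nat \<Rightarrow> nat) \<Rightarrow> nat \<Rightarrow> bool" where
  "topo f k \<longleftrightarrow> (\<forall>a b. a \<le> b \<longrightarrow> b < k \<longrightarrow> src (f a) \<noteq> tgt (f b))"

text \<open>The state of Kahn's algorithm after the edges in \<open>X\<close> have been output: \<open>q\<close> and \<open>ql\<close> are the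
  queue and its length, \<open>d\<close> and \<open>k\<close> the output and its length, and \<open>f\<close> the remaining in-degrees.\<close>

definition kahn :: "nat set \<Rightarrow> (nat \<Rightarrow> nat) \<Rightarrow> nat \<Rightarrow> (nat \<Rightarrow> nat) \<Rightarrow> nat \<Rightarrow> (nat \<Rightarrow> nat) \<Rightarrow> bool" where
  "kahn X q ql d k f \<longleftrightarrow> X \<subseteq> {..<m} \<and> bij_betw q {..<ql} {v. v < n \<and> f v = 0} \<and>
     bij_betw d {..<k} X \<and> (\<forall>v<n. f v = indegree v X) \<and> topo d k \<and> (\<forall>i<k. src (d i) \<in> q ` {..<ql})"

lemma bij_betw_snoc:
  assumes "bij_betw f {..<k} S" "x \<notin> S"
  shows "bij_betw (f(k := x)) {..<Suc k} (insert x S)"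
proof -
  have "bij_betw (f(k := x)) {..<k} S"
    using assms(1) by (subst bij_betw_cong[of _ _ f]) auto
  then have "bij_betw (f(k := x)) ({..<k} \<union> {k}) (S \<union> {x})"
    using assms(2) by (intro bij_betw_combine) auto
  moreover have "{..<k} \<union> {k} = {..<Suc k}" "S \<union> {x} = insert x S" by auto
  ultimately show ?thesis by simp
qed

lemma bij_betw_length: "bij_betw f {..<k} S \<Longrightarrow> card S = k"
  using bij_betw_same_card by fastforce

text \<open>The tails of emitted edges, including \<open>e\<close>, are queued and have no incoming
  edge left, whereas \<open>e\<close> itself still enters its head. So the head differs from all
  these tails, which is what \<open>topo\<close> demands of a new last edge. If \<open>e\<close> was
  the last edge into its head, the head joins the queue.\<close>

lemma kahn_emit:
  assumes K: "kahn X q ql d k f" and e: "e < m" "e \<notin> X" "src e \<in> q ` {..<ql}"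
  shows "0 < f (tgt e)" "k < m"
    "f (tgt e) \<noteq> 1 \<Longrightarrow> kahn (insert e X) q ql (d(k := e)) (Suc k) (f(tgt e := f (tgt e) - 1))"
    "f (tgt e) = 1 \<Longrightarrow> ql < n \<and>
      kahn (insert e X) (q(ql := tgt e)) (Suc ql) (d(k := e)) (Suc k) (f(tgt e := f (tgt e) - 1))"
proof -
  let ?v = "tgt e" let ?f = "f(tgt e := f (tgt e) - 1)" let ?d = "d(k := e)"
  note K' = K[unfolded kahn_def]
  have v: "?v < n" using e tgt_less by simp
  have fin: "finite X" using K' finite_subset by blast
  have ins: "{e'. e' < m \<and> tgt e' = ?v \<and> e' \<notin> X} = insert e {e'. e' < m \<and> tgt e' = ?v \<and> e' \<notin> insert e X}"
    using e by auto
  have d1: "indegree ?v X = Suc (indegree ?v (insert e X))"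
    unfolding indegree_def ins by (subst card_insert_disjoint) auto
  have d2: "indegree u (insert e X) = indegree u X" if "u \<noteq> ?v" for u
    unfolding indegree_def using that by (intro arg_cong[of _ _ card]) auto
  have fv: "f ?v = indegree ?v X" using K' v by auto
  then show pos: "0 < f ?v" using d1 by simp
  have kX: "card X = k" using K' bij_betw_length by blast
  have "card (insert e X) \<le> card {..<m}" using K' e by (intro card_mono) auto
  then show "k < m" using kX fin e by simp
  have qset: "q ` {..<ql} = {v. v < n \<and> f v = 0}" using K' by (auto simp: bij_betw_def)
  have deg: "\<forall>v<n. ?f v = indegree v (insert e X)"
    using K' d1 d2 fv by auto
  have bd: "bij_betw ?d {..<Suc k} (insert e X)" using K' e(2) by (intro bij_betw_snoc) auto
  have srcs: "src (?d i) \<in> q ` {..<ql}" if "i < Suc k" for i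
    using that K' e(3) by (cases "i = k") auto
  have tp: "topo ?d (Suc k)"
    unfolding topo_def
  proof (intro allI impI)
    fix a b assume ab: "a \<le> b" "b < Suc k"
    show "src (?d a) \<noteq> tgt (?d b)"
    proof (cases "b = k")
      case True
      have "src (?d a) \<in> q ` {..<ql}" using srcs ab by simp
      then have "f (src (?d a)) = 0" using qset by auto
      then show ?thesis using pos True by auto
    next
      case False
      then show ?thesis using ab K' by (auto simp: topo_def)
    qed
  qed
  {
    assume "f ?v \<noteq> 1"
    then have "{v. v < n \<and> ?f v = 0} = {v. v < n \<and> f v = 0}" using pos by auto
    then show "kahn (insert e X) q ql ?d (Suc k) ?f"
      unfolding kahn_def using K' e deg bd tp srcs by auto
  }
  {
    assume f1: "f ?v = 1"
    then have set: "{v. v < n \<and> ?f v = 0} = insert ?v {v. v < n \<and> f v = 0}" using v by auto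
    have nv: "?v \<notin> {v. v < n \<and> f v = 0}" using f1 by simp
    have bq: "bij_betw (q(ql := ?v)) {..<Suc ql} {v. v < n \<and> ?f v = 0}"
      unfolding set using K' nv by (intro bij_betw_snoc) auto
    have "card {v. v < n \<and> ?f v = 0} \<le> card {..<n}" by (intro card_mono) auto
    then have "ql < n" using bij_betw_length[OF bq] by simp
    moreover have "q ` {..<ql} \<subseteq> (q(ql := ?v)) ` {..<Suc ql}" by fastforce
    then have "src (?d i) \<in> (q(ql := ?v)) ` {..<Suc ql}" if "i < Suc k" for i
      using srcs[OF that] by blast
    moreover have "insert e X \<subseteq> {..<m}" using K' e by auto
    ultimately show "ql < n \<and> kahn (insert e X) (q(ql := ?v)) (Suc ql) ?d (Suc k) ?f"
      unfolding kahn_def using deg bd tp bq by blast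
  }
qed

lemma bij_betw_empty_left: "bij_betw d {} {}"
  by (simp add: bij_betw_def)

lemma wp_queue:
  assumes g: "globals V" and d: "\<forall>v. A aIN v = indegree v {}"
    and post: "\<And>V' A' t'. frame queue_c V A V' A' \<Longrightarrow> kahn {} (A' aQ) (V' vQL) d 0 (A' aIN) \<Longrightarrow>
      t' \<le> t + 3 + n * 5 \<Longrightarrow> Q V' A' j t'"
  shows "wp queue_c Q V A j t"
proof -
  let ?c = "Cond (Arr aIN (Var vJ)) skip_c
          (Put aQ (Var vQL) (Var vJ) ;; Assign vQL (Bin Add (Var vQL) (Cst 1)))"
  have "wp (for_c vJ vN ?c) Q (V(vQL := 0)) A j (Suc t)"
  proof (rule wp_for[where m = n and \<kappa> = 3 and I = "\<lambda>k V' A' j'. j' = j \<and>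
      bij_betw (A' aQ) {..<V' vQL} {v. v < k \<and> A aIN v = 0}"], goal_cases)
    case (8 k V' A' j' t')
    have eq: "A' aIN = A aIN" using frameD(2)[OF 8(4)] by simp
    have "card {v. v < k \<and> A aIN v = 0} \<le> card {..<k}" by (intro card_mono) auto
    then have ql: "V' vQL \<le> k" using 8(2) bij_betw_length by fastforce
    have k: "k < lim" using 8(1) nm_lim by simp
    have s: "Suc (V' vQL) < 2 ^ w" using less_lim_w[OF k] ql by linarith
    show ?case
    proof (cases "A aIN k = 0")
      case True
      then have "{v. v < Suc k \<and> A aIN v = 0} = insert k {v. v < k \<and> A aIN v = 0}"
        by (auto simp: less_Suc_eq)
      then show ?thesis using 8 True k s ql bij_betw_snoc[of "A' aQ" "V' vQL" "{v. v < k \<and> A aIN v = 0}" k] one_less_w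
        by (simp add: wp_simps eq)
    next
      case False
      then have "{v. v < Suc k \<and> A aIN v = 0} = {v. v < k \<and> A aIN v = 0}"
        by (auto simp: less_Suc_eq)
      then show ?thesis using 8 False k by (simp add: wp_simps wp_skip eq)
    qed
  next
    case (9 V' A' j' t')
    have eq: "A' aIN = A aIN" using frameD(2)[OF 9(2)] by simp
    have "bounded_state V A \<Longrightarrow> bounded_state (V(vQL := 0)) A" by (simp add: bounded_state_def)
    then have fr: "frame queue_c V A V' A'" using 9(2) by (auto simp: frame_def)
    have "Q V' A' j t'"
      by (rule post[OF fr]) (use 9 d in \<open>auto simp: kahn_def eq topo_def bij_betw_empty_left\<close>)
    then show ?case using 9 by simp
  qed (use g n_less_w in \<open>auto simp: globals_def bij_betw_empty_left\<close>)
  then show ?thesis using one_less_w by (simp add: queue_c_def wp_simps)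
qed

definition edge_order :: "(nat \<Rightarrow> nat) \<Rightarrow> bool" where
  "edge_order f \<longleftrightarrow> bij_betw f {..<m} {..<m} \<and> topo f m"

text \<open>Acyclicity enters here: by induction on the rank every vertex is queued, because once
  all its predecessors are, the edges out of them have been emitted and its remaining in-degree is
  0.\<close>

lemma kahn_complete:
  assumes K: "kahn {e. e < m \<and> src e \<in> q ` {..<ql}} q ql d k f"
  shows "k = m \<and> edge_order d"
proof -
  let ?X = "{e. e < m \<and> src e \<in> q ` {..<ql}}"
  note K' = K[unfolded kahn_def]
  have qset: "q ` {..<ql} = {v. v < n \<and> f v = 0}" using K' by (auto simp: bij_betw_def)
  have all: "v < n \<Longrightarrow> v \<in> q ` {..<ql}" for v
  proof (induction "\<rho> v" arbitrary: v rule: less_induct)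
    case less
    have "{e. e < m \<and> tgt e = v \<and> e \<notin> ?X} = {}"
    proof (rule ccontr)
      assume "\<not> ?thesis"
      then obtain e where e: "e < m" "tgt e = v" "src e \<notin> q ` {..<ql}" by auto
      then have "\<rho> (src e) < \<rho> v" using rank[of e] by (auto simp: src_def tgt_def)
      then show False using less.hyps[of "src e"] src_less e by auto
    qed
    then have "indegree v ?X = 0" unfolding indegree_def by (metis card.empty)
    then show ?case using K' less.prems qset by auto
  qed
  then have X: "?X = {..<m}" using src_less by auto
  then have bij: "bij_betw d {..<k} {..<m}" using K' by simp
  then have "k = m" using bij_betw_length by fastforce
  then show ?thesis using bij K' by (simp add: edge_order_def)
qed

lemma wp_kahn:
  assumes g: "globals V" and adj: "adjacency A"
    and K: "kahn {} (A aQ) (V vQL) (A aORD) 0 (A aIN)"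
    and post: "\<And>V' A' t'. frame kahn_c V A V' A' \<Longrightarrow> edge_order (A' aORD) \<Longrightarrow>
      t' \<le> t + 3 + n * 5 + m * 11 \<Longrightarrow> Q V' A' j t'"
  shows "wp kahn_c Q V A j t"
proof -
  let ?body = "Assign vU (Arr aQ (Var vI)) ;; Assign vE (Arr aHEAD (Var vU)) ;;
        Loop (Var vE) emit_c ;; Assign vI (Bin Add (Var vI) (Cst 1))"
  let ?V = "V(vI := 0, vK := 0)"
  let ?K = "\<lambda>X V A. kahn X (A aQ) (V vQL) (A aORD) (V vK) (A aIN)"
  let ?X = "\<lambda>i A. {e. e < m \<and> src e \<in> A aQ ` {..<i}}"
  have lens: "V' vQL \<le> n" "V' vK \<le> m" if "?K X V' A'" for X V' A'
  proof -
    have "card {v. v < n \<and> A' aIN v = 0} \<le> card {..<n}" by (intro card_mono) auto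
    moreover have "card X \<le> card {..<m}" using that by (intro card_mono) (auto simp: kahn_def)
    ultimately show "V' vQL \<le> n" "V' vK \<le> m" using that bij_betw_length[of "A' aQ"] bij_betw_length[of "A' aORD"]
      unfolding kahn_def by fastforce+
  qed
  have "wp (Loop (Bin Less (Var vI) (Var vQL)) ?body) Q ?V A j (Suc (Suc t))"
  \<comment> \<open>The queue may grow during the loop, so the variant compares \<open>vI\<close>
    with the bound \<open>n\<close> on its length. Time is charged to vertices taken from the queue
    and to edges emitted.\<close>
  proof (rule wp_loop_rule[where \<mu> = "\<lambda>V A. n - V vI" and
      I = "\<lambda>V' A' j' t'. j' = j \<and> V' vI \<le> V' vQL \<and> ?K (?X (V' vI) A') V' A' \<and>
        t' \<le> t + 2 + V' vI * 5 + V' vK * 11"], goal_cases)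
    case 1
    then show ?case using K by simp
  next
    case (3 V1 A1 j1 t1)
    define i where "i = V1 vI"
    define u where "u = A1 aQ i"
    have i: "i < V1 vQL" using 3 by (simp add: i_def split: if_splits)
    have K1: "?K (?X i A1) V1 A1" and t1: "t1 \<le> t + 2 + i * 5 + V1 vK * 11" and j1: "j1 = j"
      using 3(1) by (auto simp: i_def)
    have un: "u < n" using K1 i by (auto simp: u_def kahn_def bij_betw_def)
    have adj1: "A1 aHEAD = A aHEAD" "A1 aNEXT = A aNEXT" using frameD(2)[OF 3(2)] by auto
    have head: "A1 aHEAD u = prev_edge u m" using adj adj1 by (simp add: adjacency_def)
    have il: "i < lim" using i lens(1)[OF K1] nm_lim by simp
    have ul: "u < lim" using un nm_lim by simp
    have inj: "inj_on (A1 aQ) {..<V1 vQL}" using K1 by (auto simp: kahn_def bij_betw_def)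
    let ?V1 = "V1(vU := u, vE := prev_edge u m)"
    let ?R = "\<lambda>V' A' j' t'. (j' = j \<and> V' vI \<le> V' vQL \<and> ?K (?X (V' vI) A') V' A' \<and>
        t' \<le> t + 2 + V' vI * 5 + V' vK * 11) \<and> n - V' vI < n - V1 vI"
    have "wp (Loop (Var vE) emit_c) (wp (Assign vI (Bin Add (Var vI) (Cst 1))) ?R) ?V1 A1 j (Suc (Suc (Suc t1)))"
    \<comment> \<open>The list runs through the edges out of \<open>u\<close> in decreasing order,
      and \<open>vE\<close> is one more than the next edge, so those already emitted are the ones
      from \<open>vE\<close> on. The queue is fixed up to position \<open>i\<close> but may grow
      behind it.\<close>
    proof (rule wp_loop_rule[where \<mu> = "\<lambda>V A. V vE" and
        I = "\<lambda>V' A' j' t'. j' = j \<and> V' vE \<le> m \<and> (V' vE \<noteq> 0 \<longrightarrow> src (V' vE - 1) = u) \<and>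
          (\<forall>k \<le> i. A' aQ k = A1 aQ k) \<and> i < V' vQL \<and>
          ?K (?X i A1 \<union> {e. e < m \<and> src e = u \<and> V' vE \<le> e}) V' A' \<and>
          t' \<le> t + 5 + i * 5 + V' vK * 11"], goal_cases)
      case 1
      have emp: "{e. e < m \<and> src e = u \<and> prev_edge u m \<le> e} = {}" using prev_edge_between by auto
      have "?K (?X i A1 \<union> {e. e < m \<and> src e = u \<and> prev_edge u m \<le> e}) V1 A1"
        unfolding emp Un_empty_right by (rule K1)
      then show ?case using i t1 prev_edge_le[of u m] prev_edge_Suc[of u m "prev_edge u m - 1"]
        by (auto simp: less_imp_le)
    next
      case (2 V2 A2 j2 t2) then show ?case by simp
    next
      case (3 V2 A2 j2 t2)
      define e where "e = V2 vE - 1"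
      have E: "V2 vE = Suc e" using 3 by (simp add: e_def)
      have e: "e < m" "src e = u" using 3(1) E by auto
      let ?X2 = "?X i A1 \<union> {e. e < m \<and> src e = u \<and> V2 vE \<le> e}"
      have K2: "?K ?X2 V2 A2" using 3(1) by simp
      have "src e \<notin> A1 aQ ` {..<i}" using inj i unfolding e u_def by (fastforce simp: inj_on_def)
      then have eX: "e \<notin> ?X2" using E by simp
      have "src e = A2 aQ i" using 3(1) e by (simp add: u_def)
      moreover have "A2 aQ i \<in> A2 aQ ` {..<V2 vQL}" using 3(1) by (intro imageI) simp
      ultimately have eq: "src e \<in> A2 aQ ` {..<V2 vQL}" by simp
      note emit = kahn_emit[OF K2 e(1) eX eq]
      have nx: "A2 aNEXT e = prev_edge u e"
        using frameD(2)[OF 3(2), of aNEXT] adj adj1 e by (simp add: adjacency_def)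
      have pe: "prev_edge u e \<le> e" using prev_edge_le .
      have X3: "insert e ?X2 = ?X i A1 \<union> {e'. e' < m \<and> src e' = u \<and> prev_edge u e \<le> e'}"
      proof -
        have "{e'. e' < m \<and> src e' = u \<and> prev_edge u e \<le> e'} =
            insert e {e'. e' < m \<and> src e' = u \<and> Suc e \<le> e'}"
        proof (rule Set.set_eqI)
          fix x
          show "x \<in> {e'. e' < m \<and> src e' = u \<and> prev_edge u e \<le> e'} \<longleftrightarrow>
              x \<in> insert e {e'. e' < m \<and> src e' = u \<and> Suc e \<le> e'}"
            using e pe prev_edge_between[of u e x] by (cases x e rule: linorder_cases) auto
        qed
        then show ?thesis using E by auto
      qed
      have bounds: "e < lim" "V2 vK < lim" "tgt e < lim" "Suc (V2 vK) < 2 ^ w" "Suc (V2 vQL) < 2 ^ w"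
        using e emit(2) nm_lim tgt_lim less_lim_w[of "V2 vK"] lens(1)[OF K2] n_less_w space by auto
      have ps: "prev_edge u e \<noteq> 0 \<Longrightarrow> src (prev_edge u e - 1) = u"
        using prev_edge_Suc[of u e "prev_edge u e - 1"] by simp
      show ?case
      proof (cases "A2 aIN (tgt e) = 1")
        case True
        then have "V2 vQL < lim" using emit(4) nm_lim by auto
        then show ?thesis using True 3(1) emit(1) emit(4)[unfolded X3] bounds e E nx ps pe one_less_w
          by (simp add: emit_c_def wp_simps)
      next
        case False
        then have "A2 aIN (tgt e) - Suc 0 \<noteq> 0" using emit(1) by simp
        then show ?thesis using False 3(1) emit(1) emit(3)[unfolded X3] bounds e E nx ps pe one_less_w
          by (simp add: emit_c_def wp_simps wp_skip)
      qed
    next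
      case (4 V2 A2 j2 t2)
      have eqs: "V2 vI = i" using frameD(1)[OF 4(2), of vI] by (simp add: i_def)
      have "?X (Suc i) A2 = ?X i A1 \<union> {e. e < m \<and> src e = u \<and> V2 vE \<le> e}"
      proof -
        have "A2 aQ ` {..<Suc i} = insert u (A1 aQ ` {..<i})"
          using 4(1) by (auto simp: u_def lessThan_Suc image_iff)
        then show ?thesis using 4(3) by auto
      qed
      moreover have "V1 vI < n" using i lens(1)[OF K1] by (simp add: i_def)
      ultimately show ?case using 4 eqs i less_lim_w[OF il] one_less_w
        by (auto simp: wp_simps i_def)
    qed
    then show ?case using 3 il ul head j1 by (simp add: wp_simps u_def[symmetric] i_def[symmetric])
  next
    case (4 V' A' j' t')
    then have "V' vI = V' vQL" by (simp split: if_splits)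
    then have ko: "V' vK = m \<and> edge_order (A' aORD)" and ql: "V' vQL \<le> n"
      using 4(1) kahn_complete lens(1) by auto
    have "bounded_state V A \<Longrightarrow> bounded_state ?V A" by (simp add: bounded_state_def)
    then have fr: "frame kahn_c V A V' A'" using 4(2) by (auto simp: frame_def)
    have "Q V' A' j (Suc t')"
      by (rule post[OF fr]) (use ko ql 4 \<open>V' vI = V' vQL\<close> in auto)
    then show ?case using 4 by simp
  qed simp
  then show ?thesis using one_less_w by (simp add: kahn_c_def wp_simps)
qed

end

subsection \<open>Distances and path sums\<close>

definition dist_c :: "nat \<Rightarrow> nat \<Rightarrow> com" where
  "dist_c D s = Put D (Var s) (Cst 1) ;;
     for_c vJ vM
       (Assign vE (Arr aORD (Var vJ)) ;; Assign vU (src_e (Var vE)) ;; Assign vV (tgt_e (Var vE)) ;;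
        Cond (Arr D (Var vU))
          (Assign vP (Bin Add (Arr D (Var vU)) (wgt_e (Var vE))) ;;
           Cond (Bin Or (Bin Eq (Arr D (Var vV)) (Cst 0)) (Bin Less (Var vP) (Arr D (Var vV))))
             (Put D (Var vV) (Var vP)) skip_c)
          skip_c)"

definition prod_c :: "nat \<Rightarrow> expr \<Rightarrow> expr \<Rightarrow> com" where
  "prod_c B a b = Assign vMA a ;; Assign vMB b ;; mult_c B"

definition tight_e :: "nat \<Rightarrow> expr \<Rightarrow> expr" where
  "tight_e D e = Bin And (Bin Less (Cst 0) (Arr D (src_e e)))
     (Bin Eq (Bin Add (Arr D (src_e e)) (wgt_e e)) (Arr D (tgt_e e)))"

text \<open>With \<open>bwd\<close> set, sums over the paths to a target are computed, from the last edge backwards.\<close>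

definition path_sum_c :: "nat \<Rightarrow> bool \<Rightarrow> nat \<Rightarrow> nat \<Rightarrow> nat \<Rightarrow> nat \<Rightarrow> com" where
  "path_sum_c B bwd D X Z s = Put Z (Var s) (Cst 1) ;;
     for_c vJ vM
       (Assign vE (Arr aORD (if bwd then Bin Sub (Bin Sub (Var vM) (Cst 1)) (Var vJ) else Var vJ)) ;;
        Assign vU ((if bwd then tgt_e else src_e) (Var vE)) ;;
        Assign vV ((if bwd then src_e else tgt_e) (Var vE)) ;;
        Cond (tight_e D (Var vE))
          (prod_c B (Arr X (Var vE)) (Arr Z (Var vU)) ;;
           Put Z (Var vV) (Bin Xor (Arr Z (Var vV)) (Var vMC)))
          skip_c)"

definition ends_e :: "expr \<Rightarrow> expr" where
  "ends_e v = Bin And (Bin Or (Bin Eq v (Var vS1)) (Bin Eq v (Var vT1)))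
     (Bin Or (Bin Eq v (Var vS2)) (Bin Eq v (Var vT2)))"

definition shared_c :: "nat \<Rightarrow> com" where
  "shared_c B = for_c vJ vM
     (Assign vU (src_e (Var vJ)) ;; Assign vV (tgt_e (Var vJ)) ;;
      Cond (Bin And (Bin And (tight_e aD1 (Var vJ)) (tight_e aD2 (Var vJ)))
             (Bin Eq (ends_e (Var vU)) (Cst 0)))
        (prod_c B (Arr aL1 (Var vU)) (Arr aL2 (Var vU)) ;; Assign vTMP (Var vMC) ;;
         prod_c B (Arr aX (Var vJ)) (Arr aX (Var vJ)) ;;
         prod_c B (Var vMC) (Var vTMP) ;;
         Put aSH (Var vV) (Bin Xor (Arr aSH (Var vV)) (Var vMC)))
        skip_c)"

text \<open>Evaluates \<open>avoid_sum_formula\<close>, with xor as addition.\<close>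

definition result_c :: "nat \<Rightarrow> com" where
  "result_c B = prod_c B (Arr aL1 (Var vT1)) (Arr aL2 (Var vT2)) ;; Assign vRES (Var vMC) ;;
     for_c vJ vN
       (Cond (ends_e (Var vJ)) skip_c
         (prod_c B (Arr aL1 (Var vJ)) (Arr aL2 (Var vJ)) ;;
          Assign vTMP (Bin Xor (Var vMC) (Arr aSH (Var vJ))) ;;
          prod_c B (Arr aR1 (Var vJ)) (Arr aR2 (Var vJ)) ;;
          prod_c B (Var vTMP) (Var vMC) ;;
          Assign vRES (Bin Xor (Var vRES) (Var vMC))))"

lemma vmods_sums [simp]:
  "vmods (dist_c D s) = {vJ, vE, vU, vV, vP, vTMP}"
  "vmods (prod_c B a b) = {vMA, vMB, vMC, vMI, vMD, vME, vMJ}"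
  "vmods (path_sum_c B bwd D X Z s) = {vJ, vE, vU, vV, vMA, vMB, vMC, vMI, vMD, vME, vMJ, vTMP}"
  "vmods (shared_c B) = {vJ, vU, vV, vMA, vMB, vMC, vMI, vMD, vME, vMJ, vTMP}"
  "vmods (result_c B) = {vRES, vJ, vMA, vMB, vMC, vMI, vMD, vME, vMJ, vTMP}"
  by (auto simp: dist_c_def prod_c_def path_sum_c_def shared_c_def result_c_def)

lemma amods_sums [simp]:
  "amods (dist_c D s) = {D}" "amods (prod_c B a b) = {}" "amods (path_sum_c B bwd D X Z s) = {Z}"
  "amods (shared_c B) = {aSH}" "amods (result_c B) = {}"
  by (auto simp: dist_c_def prod_c_def path_sum_c_def shared_c_def result_c_def)

lemma wf_sums [simp]:
  "wf_com (dist_c D s) \<longleftrightarrow> D < narr \<and> s < nvar"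
  "wf_com (prod_c B a b) \<longleftrightarrow> wf_expr a \<and> wf_expr b"
  "wf_com (path_sum_c B bwd D X Z s) \<longleftrightarrow> D < narr \<and> X < narr \<and> Z < narr \<and> s < nvar"
  "wf_com (shared_c B)" "wf_com (result_c B)"
  by (auto simp: dist_c_def prod_c_def path_sum_c_def shared_c_def result_c_def tight_e_def ends_e_def)

lemma or_of_bool [simp]: "Bit_Operations.or (of_bool a) (of_bool b) = (of_bool (a \<or> b) :: nat)"
  by (cases a; cases b) auto

lemma (in ram) wp_Assign_Then:
  "wp (Assign x e ;; c) Q V A j t \<longleftrightarrow> ok V A e \<and> wp c Q (V(x := ev V A e)) A j (Suc t)"
  by (simp add: wp_Then wp_Assign)

section \<open>Relaxation and path sums in topological order\<close>

context graph_ram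
begin

definition relaxed :: "(nat \<Rightarrow> nat) \<Rightarrow> nat \<Rightarrow> nat \<Rightarrow> (nat \<Rightarrow> nat) \<Rightarrow> bool" where
  "relaxed f s k d \<longleftrightarrow> d s = 1 \<and>
     (\<forall>i<k. d (src (f i)) \<noteq> 0 \<longrightarrow> d (tgt (f i)) \<noteq> 0 \<and> d (tgt (f i)) \<le> d (src (f i)) + wgt (f i)) \<and>
     (\<forall>v. v \<noteq> s \<longrightarrow> d v \<noteq> 0 \<longrightarrow>
        (\<exists>i<k. tgt (f i) = v \<and> d (src (f i)) \<noteq> 0 \<and> d (src (f i)) + wgt (f i) = d v)) \<and>
     (\<forall>v. d v \<le> 1 + k * Wm)"

text \<open>By the topological order the head of \<open>e\<close> is not the tail of any edge
  processed so far, nor of \<open>e\<close>. Changing its label therefore leaves all earlier tails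
  alone, and lowering it preserves the earlier inequalities.\<close>

lemma relaxed_step:
  assumes f: "edge_order f" and r: "relaxed f s k d" and k: "k < m"
  defines "e \<equiv> f k"
  shows "d (src e) \<noteq> 0 \<Longrightarrow> d (tgt e) = 0 \<or> d (src e) + wgt e < d (tgt e) \<Longrightarrow>
      relaxed f s (Suc k) (d(tgt e := d (src e) + wgt e))"
    and "\<not> (d (src e) \<noteq> 0 \<and> (d (tgt e) = 0 \<or> d (src e) + wgt e < d (tgt e))) \<Longrightarrow>
      relaxed f s (Suc k) d"
proof -
  have fm: "f k < m" using f k by (auto simp: edge_order_def bij_betw_def)
  have tp: "src (f i) \<noteq> tgt e" if "i \<le> k" for i
    using f k that by (auto simp: edge_order_def topo_def e_def)
  note R = r[unfolded relaxed_def]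
  have le: "d v \<le> 1 + Suc k * Wm" for v
  proof -
    have "d v \<le> 1 + k * Wm" using R by blast
    then show ?thesis by simp
  qed
  {
    assume u: "d (src e) \<noteq> 0" and lt: "d (tgt e) = 0 \<or> d (src e) + wgt e < d (tgt e)"
    have we: "0 < wgt e" "wgt e \<le> Wm"
      using weight_pos weight_le fm by (auto simp: e_def wgt_def)
    \<comment> \<open>The label 1 of the source cannot be improved, as tail label and weight are
      both positive.\<close>
    have vs: "tgt e \<noteq> s" using lt we R u by auto
    let ?d = "d(tgt e := d (src e) + wgt e)"
    have sd: "?d (src (f i)) = d (src (f i))" if "i \<le> k" for i using tp[OF that] by simp
    show "relaxed f s (Suc k) ?d"
      unfolding relaxed_def
    proof (intro conjI allI impI)
      show "?d s = 1" using vs R by simp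
    next
      fix i assume i: "i < Suc k" and nz: "?d (src (f i)) \<noteq> 0"
      have "?d (tgt (f i)) \<noteq> 0 \<and> ?d (tgt (f i)) \<le> d (src (f i)) + wgt (f i)"
      proof (cases "i = k")
        case True then show ?thesis using u by (simp add: e_def)
      next
        case False
        then have "d (tgt (f i)) \<noteq> 0 \<and> d (tgt (f i)) \<le> d (src (f i)) + wgt (f i)"
          using R i nz sd[of i] by auto
        then show ?thesis using lt u by auto
      qed
      then show "?d (tgt (f i)) \<noteq> 0" "?d (tgt (f i)) \<le> ?d (src (f i)) + wgt (f i)"
        using sd[of i] i by auto
    next
      fix v assume v: "v \<noteq> s" "?d v \<noteq> 0"
      show "\<exists>i<Suc k. tgt (f i) = v \<and> ?d (src (f i)) \<noteq> 0 \<and> ?d (src (f i)) + wgt (f i) = ?d v"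
      proof (cases "v = tgt e")
        case True
        then show ?thesis using u sd[of k] by (intro exI[of _ k]) (auto simp: e_def)
      next
        case False
        then obtain i where "i < k" "tgt (f i) = v" "d (src (f i)) \<noteq> 0" "d (src (f i)) + wgt (f i) = d v"
          using R v by auto
        then show ?thesis using sd[of i] False by (intro exI[of _ i]) auto
      qed
    next
      fix v
      have "d (src e) \<le> 1 + k * Wm" using R by blast
      then have "d (src e) + wgt e \<le> 1 + Suc k * Wm" using we by simp
      then show "?d v \<le> 1 + Suc k * Wm" using le[of v] by simp
    qed
  }
  {
    assume nu: "\<not> (d (src e) \<noteq> 0 \<and> (d (tgt e) = 0 \<or> d (src e) + wgt e < d (tgt e)))"
    show "relaxed f s (Suc k) d"
      unfolding relaxed_def
    proof (intro conjI allI impI)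
      fix i assume i: "i < Suc k" and nz: "d (src (f i)) \<noteq> 0"
      show "d (tgt (f i)) \<noteq> 0" "d (tgt (f i)) \<le> d (src (f i)) + wgt (f i)"
        using R i nz nu by (cases "i = k"; auto simp: e_def)+
    next
      fix v assume "v \<noteq> s" "d v \<noteq> 0"
      then obtain i where "i < k" "tgt (f i) = v" "d (src (f i)) \<noteq> 0" "d (src (f i)) + wgt (f i) = d v"
        using R by auto
      then show "\<exists>i<Suc k. tgt (f i) = v \<and> d (src (f i)) \<noteq> 0 \<and> d (src (f i)) + wgt (f i) = d v"
        by (intro exI[of _ i]) auto
    qed (use R le in auto)
  }
qed

definition dists :: "nat \<Rightarrow> (nat \<Rightarrow> nat) \<Rightarrow> bool" where
  "dists s d \<longleftrightarrow> d s = 1 \<and>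
     (\<forall>e<m. d (src e) \<noteq> 0 \<longrightarrow> d (tgt e) \<noteq> 0 \<and> d (tgt e) \<le> d (src e) + wgt e) \<and>
     (\<forall>v. v \<noteq> s \<longrightarrow> d v \<noteq> 0 \<longrightarrow> (\<exists>e<m. tgt e = v \<and> d (src e) \<noteq> 0 \<and> d (src e) + wgt e = d v)) \<and>
     (\<forall>v. d v \<le> 1 + m * Wm)"

lemma edge_order_less: "edge_order f \<Longrightarrow> i < m \<Longrightarrow> f i < m"
  by (auto simp: edge_order_def bij_betw_def)

lemma edge_order_surj: "edge_order f \<Longrightarrow> e < m \<Longrightarrow> \<exists>i<m. f i = e"
  unfolding edge_order_def bij_betw_def by (metis imageE lessThan_iff)

lemma dists_add_less: "dists s d \<Longrightarrow> e < m \<Longrightarrow> d v + wgt e < 2 ^ w"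
  using dist_room weight_le[of e] by (fastforce simp: dists_def wgt_def dest: spec[of _ v])

lemma wp_dist:
  assumes g: "globals V" and f: "edge_order (A aORD)" and z: "\<And>i. A D i = 0" and D: "D \<noteq> aORD"
    and s: "3 \<le> s" "s \<le> 6"
    and post: "\<And>V' A' t'. frame (dist_c D s) V A V' A' \<Longrightarrow> dists (V s) (A' D) \<Longrightarrow>
      t' \<le> t + 3 + m * 9 \<Longrightarrow> Q V' A' j t'"
  shows "wp (dist_c D s) Q V A j t"
proof -
  let ?c = "Assign vE (Arr aORD (Var vJ)) ;; Assign vU (src_e (Var vE)) ;; Assign vV (tgt_e (Var vE)) ;;
        Cond (Arr D (Var vU))
          (Assign vP (Bin Add (Arr D (Var vU)) (wgt_e (Var vE))) ;;
           Cond (Bin Or (Bin Eq (Arr D (Var vV)) (Cst 0)) (Bin Less (Var vP) (Arr D (Var vV))))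
             (Put D (Var vV) (Var vP)) skip_c)
          skip_c"
  let ?A = "A(D := (A D)(V s := 1))" let ?f = "A aORD"
  have sn: "V s < n"
  proof -
    have "s = 3 \<or> s = 4 \<or> s = 5 \<or> s = 6" using s by auto
    then show ?thesis using g terminals by (auto simp: globals_def)
  qed
  have "wp (for_c vJ vM ?c) Q V ?A j (Suc t)"
  proof (rule wp_for[where m = m and \<kappa> = 7 and I = "\<lambda>k V' A' j'. j' = j \<and> relaxed ?f (V s) k (A' D)"], goal_cases)
    case (8 k V' A' j' t')
    have ord: "A' aORD = ?f" using frameD(2)[OF 8(4), of aORD] D by simp
    let ?e = "?f k" let ?d = "A' D"
    have e: "?e < m" "?e < lim" "k < lim" using edge_order_less[OF f 8(1)] nm_lim 8(1) by auto
    have lims: "src ?e < lim" "tgt ?e < lim" using src_lim tgt_lim e by auto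
    have R: "relaxed ?f (V s) k ?d" using 8(2) by simp
    have "?d (src ?e) \<le> 1 + k * Wm" using R by (simp add: relaxed_def)
    moreover have "k * Wm \<le> m * Wm" using 8(1) by (intro mult_right_mono) auto
    moreover have "wgt ?e \<le> Wm" using weight_le e by (simp add: wgt_def)
    ultimately have b: "?d (src ?e) + wgt ?e < 2 ^ w" using dist_room by linarith
    note st = relaxed_step[OF f R 8(1)]
    show ?case
    proof (cases "?d (src ?e) \<noteq> 0 \<and> (?d (tgt ?e) = 0 \<or> ?d (src ?e) + wgt ?e < ?d (tgt ?e))")
      case True
      then show ?thesis using st(1) e lims b 8 by (simp add: wp_simps wp_skip ord)
    next
      case False
      then show ?thesis using st(2) e lims b 8 by (auto simp add: wp_simps wp_skip ord)
    qed
  next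
    case (9 V' A' j' t')
    have "relaxed ?f (V s) m (A' D)" using 9 by simp
    then have "dists (V s) (A' D)"
      unfolding dists_def relaxed_def using edge_order_surj[OF f] edge_order_less[OF f] by metis
    moreover have "frame (dist_c D s) V A V' A'"
      using 9(2) one_less_w by (auto simp: frame_def bounded_state_def)
    ultimately have "Q V' A' j t'" using 9 by (intro post) auto
    then show ?case using 9 by simp
  qed (use g m_less_w z in \<open>auto simp: globals_def relaxed_def\<close>)
  then show ?thesis using one_less_w sn nm_lim by (simp add: dist_c_def wp_simps)
qed

lemma wp_prod:
  assumes g: "params V" "table A"
    and a: "ok V A a" "ev V A a < 2 ^ N"
    and b: "ok (V(vMA := ev V A a)) A b" "ev (V(vMA := ev V A a)) A b < 2 ^ N"
    and post: "\<And>V' t'. frame (prod_c B a b) V A V' A \<Longrightarrow> V' vMC < 2 ^ N \<Longrightarrow>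
      pcong (cyc N) (word_poly (V' vMC)) (word_poly (ev V A a) * word_poly (ev (V(vMA := ev V A a)) A b)) \<Longrightarrow>
      t' \<le> t + mult_time + 2 \<Longrightarrow> Q V' A j t'"
  shows "wp (prod_c B a b) Q V A j t"
proof -
  let ?V = "V(vMA := ev V A a, vMB := ev (V(vMA := ev V A a)) A b)"
  have "wp (mult_c B) Q ?V A j (Suc (Suc t))"
  proof (rule wp_mult)
    show "params ?V" using g by (simp add: params_def)
    fix V' t'
    assume f: "frame (mult_c B) ?V A V' A" and "V' vMC < 2 ^ N"
      "pcong (cyc N) (word_poly (V' vMC)) (word_poly (?V vMA) * word_poly (?V vMB))"
      "t' \<le> Suc (Suc t) + mult_time"
    moreover have "bounded_state V A \<Longrightarrow> bounded_state ?V A"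
      using a b room less_pow_w[of _ N] by (auto simp: bounded_state_def)
    then have "frame (prod_c B a b) V A V' A" using f by (auto simp: frame_def)
    ultimately show "Q V' A j t'" by (intro post) auto
  qed (use g a b in auto)
  then show ?thesis using a b by (simp add: prod_c_def wp_simps)
qed

definition tight :: "(nat \<Rightarrow> nat) \<Rightarrow> nat \<Rightarrow> bool" where
  "tight d e \<longleftrightarrow> d (src e) \<noteq> 0 \<and> d (src e) + wgt e = d (tgt e)"

lemma tight_e:
  assumes "ok V A e" "ev V A e < m" "dists s (A D)"
  shows "ok V A (tight_e D e)" "ev V A (tight_e D e) = of_bool (tight (A D) (ev V A e))"
  using assms src_lim tgt_lim dists_add_less[OF assms(3,2)] by (auto simp: tight_e_def tight_def)

definition from_v :: "bool \<Rightarrow> nat \<Rightarrow> nat" where "from_v bwd = (if bwd then tgt else src)"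
definition to_v :: "bool \<Rightarrow> nat \<Rightarrow> nat" where "to_v bwd = (if bwd then src else tgt)"

text \<open>The recurrence for path sums, up to congruence. In a directed acyclic graph it has only
  one solution modulo \<open>cyc N\<close>, so it pins down \<open>z\<close> there.\<close>

definition solves :: "bool \<Rightarrow> (nat \<Rightarrow> nat) \<Rightarrow> (nat \<Rightarrow> nat) \<Rightarrow> nat \<Rightarrow> (nat \<Rightarrow> nat) \<Rightarrow> bool" where
  "solves bwd d x s z \<longleftrightarrow> (\<forall>v. z v < 2 ^ N \<and> pcong (cyc N) (word_poly (z v))
     ((if v = s then 1 else 0) + (\<Sum>e\<in>{e. e < m \<and> tight d e \<and> to_v bwd e = v}.
        word_poly (x e) * word_poly (z (from_v bwd e)))))"

lemma one_less_pow_N: "1 < (2::nat) ^ N"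
  using N_pos by (rule one_less_power[rotated]) simp

text \<open>\<open>dists\<close> guards the test for tightness against overflow. Its source
  \<open>sd\<close> may differ from the start \<open>V s\<close> of the sums, since the backward
  sums start at a target. The bounds on \<open>s\<close> select one of the four variables holding
  terminals.\<close>

lemma wp_path_sum:
  assumes g: "globals V" "table A" and f: "edge_order (A aORD)" and z: "\<And>i. A Z i = 0"
    and x: "\<And>e. e < m \<Longrightarrow> A X e < 2 ^ N" and d: "dists sd (A D)"
    and Z: "Z \<noteq> aORD" "Z \<noteq> D" "Z \<noteq> X" "Z \<noteq> aTAB" and s: "3 \<le> s" "s \<le> 6"
    and post: "\<And>V' A' t'. frame (path_sum_c B bwd D X Z s) V A V' A' \<Longrightarrow>
      solves bwd (A D) (A X) (V s) (A' Z) \<Longrightarrow>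
      t' \<le> t + 3 + m * (mult_time + 9) \<Longrightarrow> Q V' A' j t'"
  shows "wp (path_sum_c B bwd D X Z s) Q V A j t"
proof -
  let ?ix = "if bwd then Bin Sub (Bin Sub (Var vM) (Cst 1)) (Var vJ) else Var vJ"
  let ?p = "prod_c B (Arr X (Var vE)) (Arr Z (Var vU))"
  let ?put = "Put Z (Var vV) (Bin Xor (Arr Z (Var vV)) (Var vMC))"
  let ?c = "Assign vE (Arr aORD ?ix) ;; Assign vU ((if bwd then tgt_e else src_e) (Var vE)) ;;
        Assign vV ((if bwd then src_e else tgt_e) (Var vE)) ;;
        Cond (tight_e D (Var vE)) (?p ;; ?put) skip_c"
  let ?A = "A(Z := (A Z)(V s := 1))"
  \<comment> \<open>Reversing the order exchanges the roles of heads and tails. In either direction,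
    an edge reads the value at \<open>from_v\<close> only after the last write to it.\<close>
  define og where "og i = A aORD (if bwd then m - 1 - i else i)" for i
  define trm where "trm zz e = word_poly (A X e) * word_poly (zz (from_v bwd e))" for zz e
  define S where "S k v = {i. i < k \<and> tight (A D) (og i) \<and> to_v bwd (og i) = v}" for k v
  define I where "I k zz \<longleftrightarrow> (\<forall>v. zz v < 2 ^ N \<and> pcong (cyc N) (word_poly (zz v))
     ((if v = V s then 1 else 0) + (\<Sum>i\<in>S k v. trm zz (og i))))" for k and zz :: "nat \<Rightarrow> nat"
  have finS: "finite (S k v)" for k v by (rule finite_subset[of _ "{..<k}"]) (auto simp: S_def)
  have bij: "bij_betw og {..<m} {..<m}"
  proof (cases bwd)
    case True
    have "bij_betw (\<lambda>i. m - 1 - i) {..<m} {..<m}"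
      by (rule bij_betw_byWitness[where f' = "\<lambda>i. m - 1 - i"]) auto
    then have "bij_betw (A aORD \<circ> (\<lambda>i. m - 1 - i)) {..<m} {..<m}"
      using f by (intro bij_betw_trans) (auto simp: edge_order_def)
    moreover have "og = A aORD \<circ> (\<lambda>i. m - 1 - i)" using True by (simp add: og_def fun_eq_iff)
    ultimately show ?thesis by simp
  next
    case False
    then have "og = A aORD" by (simp add: og_def fun_eq_iff)
    then show ?thesis using f by (simp add: edge_order_def)
  qed
  have om: "og k < m" if "k < m" for k using bij that by (auto simp: bij_betw_def)
  have tp: "from_v bwd (og i) \<noteq> to_v bwd (og k)" if "i \<le> k" "k < m" for i k
  proof (cases bwd)
    case True
    have "m - 1 - k \<le> m - 1 - i" "m - 1 - i < m" using that by auto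
    then have "src (A aORD (m - 1 - k)) \<noteq> tgt (A aORD (m - 1 - i))"
      using f by (auto simp: edge_order_def topo_def)
    then show ?thesis using True by (auto simp: og_def from_v_def to_v_def)
  next
    case False
    then show ?thesis using f that by (auto simp: og_def from_v_def to_v_def edge_order_def topo_def)
  qed
  have sn: "V s < n"
  proof -
    have "s = 3 \<or> s = 4 \<or> s = 5 \<or> s = 6" using s by auto
    then show ?thesis using g terminals by (auto simp: globals_def)
  qed
  have "wp (for_c vJ vM ?c) Q V ?A j (Suc t)"
  proof (rule wp_for[where m = m and \<kappa> = "mult_time + 7" and I = "\<lambda>k V' A' j'. j' = j \<and> I k (A' Z)"], goal_cases)
    case 6
    have "I 0 (?A Z)" using one_less_pow_N z by (auto simp: I_def S_def word_poly_1[unfolded One_nat_def])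
    then show ?case by simp
  next
    case (8 k V' A' j' t')
    have same: "A' aORD = A aORD" "A' D = A D" "A' X = A X" "A' aTAB = A aTAB"
      using frameD(2)[OF 8(4)] Z by auto
    have gV: "globals V'" by (rule globals_frame[OF g(1) 8(4)]) (auto simp: prod_c_def)
    have Mm: "V' vM = m" using gV by (simp add: globals_def)
    let ?e = "og k" let ?z = "A' Z"
    have e: "?e < m" "?e < lim" "k < lim" using om[OF 8(1)] nm_lim 8(1) by auto
    have vs: "from_v bwd ?e < lim" "to_v bwd ?e < lim"
      using src_lim tgt_lim e by (auto simp: from_v_def to_v_def)
    have II: "I k ?z" using 8 by simp
    have ixo: "ok V' A' (Arr aORD ?ix)" "ev V' A' (Arr aORD ?ix) = ?e"
      using 8(1,3) one_less_w nm_lim by (auto simp: og_def Mm same)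
    let ?V = "V'(vE := ?e, vU := from_v bwd ?e, vV := to_v bwd ?e)"
    let ?R = "\<lambda>V'' A'' j'' t''. (j'' = j \<and> I (Suc k) (A'' Z)) \<and> t'' \<le> t' + (mult_time + 7)"
    have oks: "ok (V'(vE := ?e)) A' ((if bwd then tgt_e else src_e) (Var vE))"
      "ev (V'(vE := ?e)) A' ((if bwd then tgt_e else src_e) (Var vE)) = from_v bwd ?e"
      "ok (V'(vE := ?e, vU := from_v bwd ?e)) A' ((if bwd then src_e else tgt_e) (Var vE))"
      "ev (V'(vE := ?e, vU := from_v bwd ?e)) A' ((if bwd then src_e else tgt_e) (Var vE)) = to_v bwd ?e"
      using e by (auto simp: from_v_def to_v_def)
    have te: "ok ?V A' (tight_e D (Var vE))" "ev ?V A' (tight_e D (Var vE)) = of_bool (tight (A D) ?e)"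
      using tight_e[of ?V A' "Var vE" sd D] e d same by auto
    show ?case
    proof (cases "tight (A D) ?e")
      case True
      have "wp ?p (wp ?put ?R) ?V A' j' (t' + 4)"
      proof (rule wp_prod, goal_cases)
        case 1 then show ?case using gV by (simp add: globals_def params_def)
      next
        case 2 then show ?case using g(2) same by (simp add: table_def)
      next
        case (7 V2 t2)
        have eqs: "V2 vV = to_v bwd ?e" using frameD(1)[OF 7(1), of vV] by simp
        let ?z' = "?z(to_v bwd ?e := Bit_Operations.xor (?z (to_v bwd ?e)) (V2 vMC))"
        have I': "I (Suc k) ?z'"
          unfolding I_def
        proof (intro allI conjI)
          fix v
          have terms: "trm ?z' (og i) = trm ?z (og i)" if "i \<le> k" for i
            using tp[OF that 8(1)] by (simp add: trm_def)
          have sums: "(\<Sum>i\<in>S k v. trm ?z' (og i)) = (\<Sum>i\<in>S k v. trm ?z (og i))"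
            by (rule sum.cong) (auto simp: S_def terms)
          have Iv: "?z v < 2 ^ N" "pcong (cyc N) (word_poly (?z v))
            ((if v = V s then 1 else 0) + (\<Sum>i\<in>S k v. trm ?z (og i)))"
            using II by (auto simp: I_def)
          show "?z' v < 2 ^ N" using Iv(1) 7(2) by (auto intro: xor_less_power)
          show "pcong (cyc N) (word_poly (?z' v)) ((if v = V s then 1 else 0) + (\<Sum>i\<in>S (Suc k) v. trm ?z' (og i)))"
          proof (cases "v = to_v bwd ?e")
            case eq: True
            have "S (Suc k) v = insert k (S k v)" using True eq by (auto simp: S_def less_Suc_eq)
            moreover have "k \<notin> S k v" by (simp add: S_def)
            ultimately have "(\<Sum>i\<in>S (Suc k) v. trm ?z' (og i)) = trm ?z ?e + (\<Sum>i\<in>S k v. trm ?z (og i))"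
              using finS terms[of k] sums by simp
            moreover have "pcong (cyc N) (word_poly (V2 vMC)) (trm ?z ?e)"
              using 7(3) same by (simp add: trm_def)
            ultimately show ?thesis
              using pcong_add[OF Iv(2), of "word_poly (V2 vMC)" "trm ?z ?e"] eq
              by (simp add: word_poly_xor ac_simps)
          next
            case ne: False
            then have "S (Suc k) v = S k v" by (auto simp: S_def less_Suc_eq)
            then show ?thesis using Iv sums ne by simp
          qed
        qed
        then show ?case using 7 8 vs by (simp add: wp_Put eqs)
      qed (use e vs x II same in \<open>auto simp: I_def\<close>)
      then show ?thesis using True te oks ixo 8
        by (simp add: wp_Then wp_Assign wp_Cond del: ok.simps ev.simps)
          (simp add: numeral_eq_Suc)
    next
      case False
      have "I (Suc k) ?z"
      proof -
        have "S (Suc k) v = S k v" for v using False by (auto simp: S_def less_Suc_eq)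
        then show ?thesis using II by (simp add: I_def)
      qed
      then show ?thesis using False te oks ixo 8
        by (simp add: wp_Then wp_Assign wp_Cond wp_skip del: ok.simps ev.simps)
    qed
  next
    case (9 V' A' j' t')
    have "I m (A' Z)" using 9 by simp
    have "solves bwd (A D) (A X) (V s) (A' Z)"
    proof -
      have "(\<Sum>i\<in>S m v. trm zz (og i)) = (\<Sum>e\<in>{e. e < m \<and> tight (A D) e \<and> to_v bwd e = v}. trm zz e)" for v zz
      proof -
        have "inj_on og (S m v)" using bij by (auto simp: bij_betw_def inj_on_def S_def)
        moreover have "og ` S m v = {e. e < m \<and> tight (A D) e \<and> to_v bwd e = v}"
        proof (rule Set.set_eqI, rule iffI)
          fix e assume e: "e \<in> {e. e < m \<and> tight (A D) e \<and> to_v bwd e = v}"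
          then have "e \<in> og ` {..<m}" using bij by (simp add: bij_betw_def)
          then obtain i where "i < m" "og i = e" by auto
          then show "e \<in> og ` S m v" using e by (auto simp: S_def)
        qed (auto simp: S_def om)
        ultimately show ?thesis using sum.reindex[of og "S m v" "trm zz"] by simp
      qed
      then show ?thesis using \<open>I m (A' Z)\<close> by (simp add: solves_def I_def trm_def)
    qed
    moreover have "frame (path_sum_c B bwd D X Z s) V A V' A'"
      using 9(2) one_less_w by (auto simp: frame_def bounded_state_def path_sum_c_def prod_c_def)
    ultimately have "Q V' A' j t'" using 9 by (intro post) (auto simp: algebra_simps)
    then show ?case using 9 by simp
  qed (use g m_less_w in \<open>auto simp: globals_def prod_c_def\<close>)
  then show ?thesis using one_less_w sn nm_lim by (simp add: path_sum_c_def wp_Then wp_Put)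
qed

definition at_ends :: "nat \<Rightarrow> bool" where
  "at_ends v \<longleftrightarrow> (v = inp 2 \<or> v = inp 3) \<and> (v = inp 4 \<or> v = inp 5)"

lemma ends_e:
  assumes "globals V" "ok V A v"
  shows "ok V A (ends_e v)" "ev V A (ends_e v) = of_bool (at_ends (ev V A v))"
  using assms by (auto simp: ends_e_def at_ends_def globals_def)

definition words :: "(nat \<Rightarrow> nat) \<Rightarrow> bool" where
  "words z \<longleftrightarrow> (\<forall>v. z v < 2 ^ N)"

lemma wp_shared:
  assumes g: "globals V" "table A" and d: "dists sa (A aD1)" "dists sb (A aD2)"
    and x: "\<And>e. e < m \<Longrightarrow> A aX e < 2 ^ N" and l: "words (A aL1)" "words (A aL2)"
    and z: "\<And>i. A aSH i = 0"
    and post: "\<And>V' A' t'. frame (shared_c B) V A V' A' \<Longrightarrow> words (A' aSH) \<Longrightarrow>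
      (\<And>v. pcong (cyc N) (word_poly (A' aSH v))
        (\<Sum>e\<in>{e. e < m \<and> tight (A aD1) e \<and> tight (A aD2) e \<and> \<not> at_ends (src e) \<and> tgt e = v}.
          word_poly (A aX e) * word_poly (A aX e) * (word_poly (A aL1 (src e)) * word_poly (A aL2 (src e))))) \<Longrightarrow>
      t' \<le> t + 2 + m * (3 * mult_time + 13) \<Longrightarrow> Q V' A' j t'"
  shows "wp (shared_c B) Q V A j t"
proof -
  let ?q3 = "Put aSH (Var vV) (Bin Xor (Arr aSH (Var vV)) (Var vMC))"
  let ?p3 = "prod_c B (Var vMC) (Var vTMP)"
  let ?p2 = "prod_c B (Arr aX (Var vJ)) (Arr aX (Var vJ))"
  let ?p1 = "prod_c B (Arr aL1 (Var vU)) (Arr aL2 (Var vU))"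
  let ?q1 = "Assign vTMP (Var vMC)"
  let ?b = "Bin And (Bin And (tight_e aD1 (Var vJ)) (tight_e aD2 (Var vJ))) (Bin Eq (ends_e (Var vU)) (Cst 0))"
  let ?c = "Assign vU (src_e (Var vJ)) ;; Assign vV (tgt_e (Var vJ)) ;;
      Cond ?b (?p1 ;; ?q1 ;; ?p2 ;; ?p3 ;; ?q3) skip_c"
  define P where "P e \<longleftrightarrow> tight (A aD1) e \<and> tight (A aD2) e \<and> \<not> at_ends (src e)" for e
  define trm where "trm e = word_poly (A aX e) * word_poly (A aX e) *
     (word_poly (A aL1 (src e)) * word_poly (A aL2 (src e)))" for e
  define S where "S k v = {e. e < k \<and> P e \<and> tgt e = v}" for k v
  define I where "I k zz \<longleftrightarrow> (\<forall>v. zz v < 2 ^ N \<and> pcong (cyc N) (word_poly (zz v)) (sum trm (S k v)))"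
    for k and zz :: "nat \<Rightarrow> nat"
  have finS: "finite (S k v)" for k v by (rule finite_subset[of _ "{..<k}"]) (auto simp: S_def)
  have "wp (for_c vJ vM ?c) Q V A j t"
  proof (rule wp_for[where m = m and \<kappa> = "3 * mult_time + 11" and I = "\<lambda>k V' A' j'. j' = j \<and> I k (A' aSH)"], goal_cases)
    case 6
    have "I 0 (A aSH)" using z by (simp add: I_def S_def)
    then show ?case by simp
  next
    case (8 k V' A' j' t')
    have same: "A' aD1 = A aD1" "A' aD2 = A aD2" "A' aX = A aX" "A' aTAB = A aTAB"
        "A' aL1 = A aL1" "A' aL2 = A aL2"
      using frameD(2)[OF 8(4)] by (auto simp: prod_c_def)
    have gV: "globals V'" by (rule globals_frame[OF g(1) 8(4)]) (auto simp: prod_c_def)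
    have tab: "table A'" using g(2) same by (simp add: table_def)
    have k: "k < lim" "src k < lim" "tgt k < lim" using 8(1) nm_lim src_lim tgt_lim by auto
    have II: "I k (A' aSH)" using 8 by simp
    let ?V = "V'(vU := src k, vV := tgt k)"
    let ?R = "\<lambda>V'' A'' j'' t''. (j'' = j \<and> I (Suc k) (A'' aSH)) \<and> t'' \<le> t' + (3 * mult_time + 11)"
    have gV2: "globals ?V" using gV by (simp add: globals_def params_def)
    have J: "?V vJ = k" using 8(3) by simp
    have bb: "ok ?V A' ?b" "ev ?V A' ?b = of_bool (P k)"
      using tight_e[of ?V A' "Var vJ" sa aD1] tight_e[of ?V A' "Var vJ" sb aD2] d same 8(1,3)
        ends_e[OF gV2, of A' "Var vU"] by (auto simp: P_def)
    show ?case
    proof (cases "P k")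
      case True
      have "wp ?p1 (wp (?q1 ;; ?p2 ;; ?p3 ;; ?q3) ?R) ?V A' j (Suc (Suc (Suc t')))"
      proof (rule wp_prod, goal_cases)
        case (7 V2 t2)
        have e2: "V2 vJ = k" "V2 vV = tgt k"
          using frameD(1)[OF 7(1), of vJ] frameD(1)[OF 7(1), of vV] 8(3) by auto
        have g2: "globals V2" by (rule globals_frame[OF gV2 7(1)]) auto
        let ?V2 = "V2(vTMP := V2 vMC)"
        have "wp ?p2 (wp (?p3 ;; ?q3) ?R) ?V2 A' j (Suc t2)"
        proof (rule wp_prod, goal_cases)
          case 1 then show ?case using g2 by (simp add: globals_def params_def)
        next
          case n7: (7 V3 t3)
          have e3: "V3 vV = tgt k" "V3 vTMP = V2 vMC" using frameD(1)[OF n7(1), of vV] frameD(1)[OF n7(1), of vTMP] e2 by auto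
          have "globals ?V2" using g2 by (simp add: globals_def params_def)
          then have g3: "globals V3" by (rule globals_frame[OF _ n7(1)]) auto
          have "wp ?p3 (wp ?q3 ?R) V3 A' j t3"
          proof (rule wp_prod, goal_cases)
            case nn7: (7 V4 t4)
            have e4: "V4 vV = tgt k" using frameD(1)[OF nn7(1), of vV] e3 by auto
            let ?z' = "(A' aSH)(tgt k := Bit_Operations.xor (A' aSH (tgt k)) (V4 vMC))"
            have tm: "pcong (cyc N) (word_poly (V4 vMC)) (trm k)"
            proof -
              have "pcong (cyc N) (word_poly (V4 vMC)) (word_poly (V3 vMC) * word_poly (V2 vMC))"
                using nn7(3) e3 by simp
              also have "pcong (cyc N) \<dots> (trm k)"
                unfolding trm_def using n7(3) 7(3) same e2 by (intro pcong_mult) auto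
              finally show ?thesis .
            qed
            have "I (Suc k) ?z'"
              unfolding I_def
            proof (intro allI conjI)
              fix v
              have Iv: "A' aSH v < 2 ^ N" "pcong (cyc N) (word_poly (A' aSH v)) (sum trm (S k v))"
                using II by (auto simp: I_def)
              show "?z' v < 2 ^ N" using Iv(1) nn7(2) by (auto intro: xor_less_power)
              show "pcong (cyc N) (word_poly (?z' v)) (sum trm (S (Suc k) v))"
              proof (cases "v = tgt k")
                case eq: True
                have "S (Suc k) v = insert k (S k v)" using True eq by (auto simp: S_def less_Suc_eq)
                moreover have "k \<notin> S k v" by (simp add: S_def)
                ultimately have "sum trm (S (Suc k) v) = trm k + sum trm (S k v)"
                  using finS by simp
                then show ?thesis using pcong_add[OF Iv(2) tm] eq by (simp add: word_poly_xor ac_simps)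
              next
                case ne: False
                then have "S (Suc k) v = S k v" by (auto simp: S_def less_Suc_eq)
                then show ?thesis using Iv ne by simp
              qed
            qed
            then show ?case using nn7(4) n7(4) 7(4) k by (simp add: wp_Put e4)
          qed (use g3 tab n7(2) 7(2) e3 in \<open>auto simp: globals_def\<close>)
          then show ?case by (simp add: wp_Then)
        qed (use tab e2 k x[OF 8(1)] same in auto)
        then show ?case by (simp add: wp_Then wp_Assign)
      qed (use gV2 tab k l same in \<open>auto simp: globals_def words_def\<close>)
      then have "wp (?p1 ;; ?q1 ;; ?p2 ;; ?p3 ;; ?q3) ?R ?V A' j (Suc (Suc (Suc t')))"
        by (subst wp_Then)
      then show ?thesis using True bb 8
        by (simp add: wp_Assign_Then wp_Assign wp_Cond[of ?b])
    next
      case False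
      have "I (Suc k) (A' aSH)"
      proof -
        have "S (Suc k) v = S k v" for v using False by (auto simp: S_def less_Suc_eq)
        then show ?thesis using II by (simp add: I_def)
      qed
      then show ?thesis using False bb 8
        by (simp add: wp_Assign_Then wp_Assign wp_Cond[of ?b] wp_skip)
    qed
  next
    case (9 V' A' j' t')
    have I: "I m (A' aSH)" using 9 by simp
    have "Q V' A' j t'"
    proof (rule post)
      show "frame (shared_c B) V A V' A'" using 9(2) by (simp add: shared_c_def)
      show "words (A' aSH)" using I by (simp add: I_def words_def)
      fix v
      show "pcong (cyc N) (word_poly (A' aSH v))
        (\<Sum>e\<in>{e. e < m \<and> tight (A aD1) e \<and> tight (A aD2) e \<and> \<not> at_ends (src e) \<and> tgt e = v}.
          word_poly (A aX e) * word_poly (A aX e) * (word_poly (A aL1 (src e)) * word_poly (A aL2 (src e))))"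
        using I by (simp add: I_def S_def P_def trm_def conj_ac)
    qed (use 9 in \<open>auto simp: algebra_simps\<close>)
    then show ?case using 9 by simp
  qed (use g m_less_w in \<open>auto simp: globals_def prod_c_def\<close>)
  then show ?thesis by (simp add: shared_c_def)
qed

lemma wp_result:
  assumes g: "globals V" "table A"
    and l: "words (A aL1)" "words (A aL2)" "words (A aR1)" "words (A aR2)" "words (A aSH)"
    and post: "\<And>V' t'. frame (result_c B) V A V' A \<Longrightarrow> V' vRES < 2 ^ N \<Longrightarrow>
      pcong (cyc N) (word_poly (V' vRES))
        (word_poly (A aL1 (inp 3)) * word_poly (A aL2 (inp 5)) + (\<Sum>v\<in>{v. v < n \<and> \<not> at_ends v}.
          (word_poly (A aL1 v) * word_poly (A aL2 v) + word_poly (A aSH v)) *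
          (word_poly (A aR1 v) * word_poly (A aR2 v)))) \<Longrightarrow>
      t' \<le> t + mult_time + 5 + n * (3 * mult_time + 11) \<Longrightarrow> Q V' A j t'"
  shows "wp (result_c B) Q V A j t"
proof -
  let ?q3 = "Assign vRES (Bin Xor (Var vRES) (Var vMC))"
  let ?p3 = "prod_c B (Var vTMP) (Var vMC)"
  let ?p2 = "prod_c B (Arr aR1 (Var vJ)) (Arr aR2 (Var vJ))"
  let ?p1 = "prod_c B (Arr aL1 (Var vJ)) (Arr aL2 (Var vJ))"
  let ?q1 = "Assign vTMP (Bin Xor (Var vMC) (Arr aSH (Var vJ)))"
  let ?c = "Cond (ends_e (Var vJ)) skip_c (?p1 ;; ?q1 ;; ?p2 ;; ?p3 ;; ?q3)"
  let ?p0 = "prod_c B (Arr aL1 (Var vT1)) (Arr aL2 (Var vT2))"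
  define trm where "trm v = (word_poly (A aL1 v) * word_poly (A aL2 v) + word_poly (A aSH v)) *
          (word_poly (A aR1 v) * word_poly (A aR2 v))" for v
  define S where "S k = {v. v < k \<and> \<not> at_ends v}" for k
  define F where "F = word_poly (A aL1 (inp 3)) * word_poly (A aL2 (inp 5))"
  have finS: "finite (S k)" for k by (rule finite_subset[of _ "{..<k}"]) (auto simp: S_def)
  have "wp ?p0 (wp (Assign vRES (Var vMC) ;; for_c vJ vN ?c) Q) V A j t"
  proof (rule wp_prod, goal_cases)
    case (7 V1 t1)
    let ?V1 = "V1(vRES := V1 vMC)"
    have g1: "globals ?V1" using globals_frame[OF g(1) 7(1)] by (simp add: globals_def params_def)
    have F1: "pcong (cyc N) (word_poly (V1 vMC)) F" using 7(3) g(1) by (simp add: F_def globals_def)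
    have "wp (for_c vJ vN ?c) Q ?V1 A j (Suc t1)"
    proof (rule wp_for[where m = n and \<kappa> = "3 * mult_time + 9" and
        I = "\<lambda>k V' A' j'. j' = j \<and> V' vRES < 2 ^ N \<and> pcong (cyc N) (word_poly (V' vRES)) (F + sum trm (S k))"], goal_cases)
      case 6
      show ?case using 7(2) F1 by (simp add: S_def)
    next
      case (8 k V' A' j' t')
      have [simp]: "A' = A" by (rule frame_no_amods[OF 8(4)]) (auto simp: prod_c_def)
      have gV: "globals V'" by (rule globals_frame[OF g1 8(4)]) (auto simp: prod_c_def)
      have k: "k < lim" using 8(1) nm_lim by simp
      let ?R = "\<lambda>V'' A'' j'' t''. (j'' = j \<and> V'' vRES < 2 ^ N \<and>
        pcong (cyc N) (word_poly (V'' vRES)) (F + sum trm (S (Suc k)))) \<and> t'' \<le> t' + (3 * mult_time + 9)"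
      have bb: "ok V' A (ends_e (Var vJ))" "ev V' A (ends_e (Var vJ)) = of_bool (at_ends k)"
        using ends_e[OF gV, of A "Var vJ"] 8(3) by auto
      show ?case
      proof (cases "at_ends k")
        case True
        then have "S (Suc k) = S k" by (auto simp: S_def less_Suc_eq)
        then show ?thesis using True bb 8 by (simp add: wp_Cond[of "ends_e (Var vJ)"] wp_skip)
      next
        case False
        have "wp ?p1 (wp (?q1 ;; ?p2 ;; ?p3 ;; ?q3) ?R) V' A j (Suc t')"
        proof (rule wp_prod, goal_cases)
          case m7: (7 V2 t2)
          let ?w = "Bit_Operations.xor (V2 vMC) (A aSH k)"
          have e2: "V2 vJ = k" "V2 vRES = V' vRES"
            using frameD(1)[OF m7(1), of vJ] frameD(1)[OF m7(1), of vRES] 8(3) by auto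
          have g2: "globals V2" by (rule globals_frame[OF gV m7(1)]) auto
          have wN: "?w < 2 ^ N" using m7(2) l(5) by (intro xor_less_power) (auto simp: words_def)
          have wc: "pcong (cyc N) (word_poly ?w) (word_poly (A aL1 k) * word_poly (A aL2 k) + word_poly (A aSH k))"
            unfolding word_poly_xor using m7(3) 8(3) by (intro pcong_add) auto
          let ?V2 = "V2(vTMP := ?w)"
          have g2': "globals ?V2" using g2 by (simp add: globals_def params_def)
          have "wp ?p2 (wp (?p3 ;; ?q3) ?R) ?V2 A j (Suc t2)"
          proof (rule wp_prod, goal_cases)
            case n7: (7 V3 t3)
            have e3: "V3 vTMP = ?w" "V3 vRES = V' vRES" using frameD(1)[OF n7(1), of vTMP] frameD(1)[OF n7(1), of vRES] e2 by auto
            have g3: "globals V3" by (rule globals_frame[OF g2' n7(1)]) auto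
            have "wp ?p3 (wp ?q3 ?R) V3 A j t3"
            proof (rule wp_prod, goal_cases)
              case nn7: (7 V4 t4)
              have e4: "V4 vRES = V' vRES" using frameD(1)[OF nn7(1), of vRES] e3 by auto
              have tm: "pcong (cyc N) (word_poly (V4 vMC)) (trm k)"
              proof -
                have "pcong (cyc N) (word_poly (V4 vMC)) (word_poly ?w * word_poly (V3 vMC))"
                  using nn7(3) e3 by simp
                also have "pcong (cyc N) \<dots> (trm k)"
                  unfolding trm_def using n7(3) wc e2 by (intro pcong_mult) auto
                finally show ?thesis .
              qed
              have "S (Suc k) = insert k (S k)" "k \<notin> S k" using False by (auto simp: S_def less_Suc_eq)
              then have sm: "sum trm (S (Suc k)) = trm k + sum trm (S k)" using finS by simp
              have r: "V' vRES < 2 ^ N" "pcong (cyc N) (word_poly (V' vRES)) (F + sum trm (S k))"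
                using 8(2) by auto
              have "pcong (cyc N) (word_poly (Bit_Operations.xor (V' vRES) (V4 vMC))) (F + sum trm (S (Suc k)))"
                using pcong_add[OF r(2) tm] by (simp add: word_poly_xor sm ac_simps)
              then show ?case using xor_less_power[OF r(1) nn7(2)] nn7(4) n7(4) m7(4)
                by (simp add: wp_Assign e4)
            qed (use g3 g(2) n7(2) wN e3 in \<open>auto simp: globals_def\<close>)
            then show ?case by (simp add: wp_Then)
          qed (use g2' g(2) k l e2 in \<open>auto simp: globals_def words_def\<close>)
          then show ?case using k e2 by (simp add: wp_Then wp_Assign)
        qed (use gV g(2) k l 8(3) in \<open>auto simp: globals_def words_def\<close>)
        then have "wp (?p1 ;; ?q1 ;; ?p2 ;; ?p3 ;; ?q3) ?R V' A j (Suc t')"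
          by (subst wp_Then)
        then show ?thesis using False bb 8 by (simp add: wp_Cond[of "ends_e (Var vJ)"])
      qed
    next
      case (9 V' A' j' t')
      have [simp]: "A' = A" by (rule frame_no_amods[OF 9(2)]) (auto simp: prod_c_def)
      have "bounded_state V1 A \<Longrightarrow> bounded_state ?V1 A" by (simp add: bounded_state_def)
      then have fr: "frame (result_c B) V A V' A"
        using 7(1) 9(2) by (auto simp: frame_def prod_c_def)
      have "Q V' A j t'"
        by (rule post[OF fr]) (use 9 7(4) in \<open>auto simp: F_def trm_def S_def algebra_simps\<close>)
      then show ?case using 9 by simp
    qed (use g1 n_less_w in \<open>auto simp: globals_def prod_c_def\<close>)
    then show ?case by (simp add: wp_Then wp_Assign)
  qed (use g l terminals nm_lim in \<open>auto simp: globals_def words_def\<close>)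
  then show ?thesis by (simp add: result_c_def wp_Then)
qed

end

subsection \<open>The whole program\<close>

definition main_c :: "nat \<Rightarrow> nat \<Rightarrow> com" where
  "main_c a B = setup_c a ;; random_c ;; table_c ;; adjacency_c ;; queue_c ;; kahn_c ;;
     dist_c aD1 vS1 ;; dist_c aD2 vS2 ;;
     path_sum_c B False aD1 aX aL1 vS1 ;; path_sum_c B False aD2 aY aL2 vS2 ;; shared_c B ;;
     path_sum_c B True aD1 aX aR1 vT1 ;; path_sum_c B True aD2 aY aR2 vT2 ;; result_c B"

lemma wf_main: "wf_com (main_c a B)"
  by (simp add: main_c_def)

section \<open>Composition of the phases\<close>

context graph_ram
begin

text \<open>The sums and labels start from arrays that are still zero, as in the initial memory;
  this keeps track of the arrays that no phase has written yet.\<close>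

definition zero_on :: "nat set \<Rightarrow> arrs \<Rightarrow> bool" where
  "zero_on I A \<longleftrightarrow> (\<forall>k\<in>I. A k = (\<lambda>_. 0))"

lemma zero_on_frame:
  "zero_on I A \<Longrightarrow> frame c V A V' A' \<Longrightarrow> J \<subseteq> I \<Longrightarrow> J \<inter> amods c = {} \<Longrightarrow> zero_on J A'"
  unfolding zero_on_def using frameD(2)[of c V A V' A'] by (metis disjoint_iff subsetD)

definition ready :: "env \<Rightarrow> arrs \<Rightarrow> bool" where
  "ready V A \<longleftrightarrow> globals V \<and> random_weights 0 A \<and> table A \<and> edge_order (A aORD)"

lemma ready_frame:
  assumes "ready V A" "frame c V A V' A'" "\<forall>x\<in>vmods c. x = 0 \<or> 12 \<le> x"
    "aORD \<notin> amods c" "aX \<notin> amods c" "aY \<notin> amods c" "aTAB \<notin> amods c"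
  shows "ready V' A'"
proof -
  have "A' aORD = A aORD" "A' aX = A aX" "A' aY = A aY" "A' aTAB = A aTAB"
    using frameD(2)[OF assms(2)] assms(4-7) by auto
  then show ?thesis using assms(1) globals_frame[OF _ assms(2,3)]
    by (simp add: ready_def random_weights_def table_def)
qed

lemma ready_words: "ready V A \<Longrightarrow> e < m \<Longrightarrow> A aX e < 2 ^ N \<and> A aY e < 2 ^ N"
  by (simp add: ready_def random_weights_def)

definition shares :: "arrs \<Rightarrow> bool" where
  "shares A \<longleftrightarrow> words (A aSH) \<and> (\<forall>v. pcong (cyc N) (word_poly (A aSH v))
     (\<Sum>e\<in>{e. e < m \<and> tight (A aD1) e \<and> tight (A aD2) e \<and> \<not> at_ends (src e) \<and> tgt e = v}.
        word_poly (A aX e) * word_poly (A aX e) * (word_poly (A aL1 (src e)) * word_poly (A aL2 (src e)))))"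

definition result :: "arrs \<Rightarrow> nat \<Rightarrow> bool" where
  "result A r \<longleftrightarrow> r < 2 ^ N \<and> pcong (cyc N) (word_poly r)
     (word_poly (A aL1 (inp 3)) * word_poly (A aL2 (inp 5)) + (\<Sum>v\<in>{v. v < n \<and> \<not> at_ends v}.
        (word_poly (A aL1 v) * word_poly (A aL2 v) + word_poly (A aSH v)) *
        (word_poly (A aR1 v) * word_poly (A aR2 v))))"

lemma solves_words: "solves bwd d x s z \<Longrightarrow> words z"
  by (simp add: solves_def words_def)

definition prepared :: "nat \<Rightarrow> env \<Rightarrow> arrs \<Rightarrow> nat \<Rightarrow> nat \<Rightarrow> bool" where
  "prepared T V A j t \<longleftrightarrow> ready V A \<and> zero_on {8..14} A \<and> t \<le> T"

text \<open>As \<open>;;\<close> associates to the right, each group of phases is verified in front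
  of an arbitrary continuation \<open>c\<close>.\<close>

lemma wp_prepare:
  assumes g: "globals V" and z: "zero_on {0..14} A" and t: "t \<le> T"
    and rest: "\<And>V' A' j' t'. prepared (T + 13 + 25 * m + 6 * 2 ^ (2 * h) + 10 * n) V' A' j' t' \<Longrightarrow>
      wp c Q V' A' j' t'"
  shows "wp (random_c ;; table_c ;; adjacency_c ;; queue_c ;; kahn_c ;; c) Q V A 0 t"
proof -
  have "wp random_c (wp (table_c ;; adjacency_c ;; queue_c ;; kahn_c ;; c) Q) V A 0 t"
  proof (rule wp_random[OF g])
    fix V1 A1 t1
    assume f1: "frame random_c V A V1 A1" and r1: "random_weights 0 A1" and t1: "t1 \<le> t + 2 + m * 7"
    have g1: "globals V1" by (rule globals_frame[OF g f1]) simp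
    have z1: "zero_on {0,1,2,3,4,7,8,9,10,11,12,13,14} A1" by (rule zero_on_frame[OF z f1]) auto
    have "wp table_c (wp (adjacency_c ;; queue_c ;; kahn_c ;; c) Q) V1 A1 (0 + 2 * m) t1"
    proof (rule wp_table)
      show "params V1" using g1 by (simp add: globals_def)
      show "A1 aTAB i = 0" for i using z1 by (simp add: zero_on_def)
      fix V2 A2 t2
      assume f2: "frame table_c V1 A1 V2 A2" and tab: "table A2" and t2: "t2 \<le> t1 + 3 + 2 ^ (2 * h) * 6"
      have g2: "globals V2" by (rule globals_frame[OF g1 f2]) simp
      have z2: "zero_on {0,1,2,3,4,8,9,10,11,12,13,14} A2" by (rule zero_on_frame[OF z1 f2]) auto
      have r2: "random_weights 0 A2"
        using r1 frameD(2)[OF f2, of aX] frameD(2)[OF f2, of aY] by (simp add: random_weights_def)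
      have "wp adjacency_c (wp (queue_c ;; kahn_c ;; c) Q) V2 A2 (0 + 2 * m) t2"
      proof (rule wp_adjacency[OF g2])
        show "A2 aHEAD i = 0" "A2 aIN i = 0" for i using z2 by (simp_all add: zero_on_def)
        fix V3 A3 t3
        assume f3: "frame adjacency_c V2 A2 V3 A3" and adj: "adjacency A3"
          and deg: "\<forall>v. A3 aIN v = indegree v {}" and t3: "t3 \<le> t2 + 2 + m * 7"
        have g3: "globals V3" by (rule globals_frame[OF g2 f3]) simp
        have z3: "zero_on {8..14} A3" by (rule zero_on_frame[OF z2 f3]) auto
        have r3: "random_weights 0 A3" "table A3"
          using r2 tab frameD(2)[OF f3, of aX] frameD(2)[OF f3, of aY] frameD(2)[OF f3, of aTAB]
          by (simp_all add: random_weights_def table_def)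
        have "wp queue_c (wp (kahn_c ;; c) Q) V3 A3 (0 + 2 * m) t3"
        proof (rule wp_queue[where d = "A3 aORD", OF g3])
          show "\<forall>v. A3 aIN v = indegree v {}" by (rule deg)
          fix V4 A4 t4
          assume f4: "frame queue_c V3 A3 V4 A4" and k4: "kahn {} (A4 aQ) (V4 vQL) (A3 aORD) 0 (A4 aIN)"
            and t4: "t4 \<le> t3 + 3 + n * 5"
          have g4: "globals V4" by (rule globals_frame[OF g3 f4]) simp
          have z4: "zero_on {8..14} A4" by (rule zero_on_frame[OF z3 f4]) auto
          have eq4: "A4 aX = A3 aX" "A4 aY = A3 aY" "A4 aTAB = A3 aTAB" "A4 aHEAD = A3 aHEAD"
            "A4 aNEXT = A3 aNEXT" "A4 aORD = A3 aORD"
            using frameD(2)[OF f4] by auto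
          have "wp kahn_c (wp c Q) V4 A4 (0 + 2 * m) t4"
          proof (rule wp_kahn[OF g4])
            show "adjacency A4" using adj eq4 by (simp add: adjacency_def)
            show "kahn {} (A4 aQ) (V4 vQL) (A4 aORD) 0 (A4 aIN)" using k4 eq4 by simp
            fix V5 A5 t5
            assume f5: "frame kahn_c V4 A4 V5 A5" and o5: "edge_order (A5 aORD)"
              and t5: "t5 \<le> t4 + 3 + n * 5 + m * 11"
            have g5: "globals V5" by (rule globals_frame[OF g4 f5]) simp
            have z5: "zero_on {8..14} A5" by (rule zero_on_frame[OF z4 f5]) auto
            have "A5 aX = A4 aX" "A5 aY = A4 aY" "A5 aTAB = A4 aTAB"
              using frameD(2)[OF f5] by auto
            then have "ready V5 A5" using g5 o5 r3 eq4
              by (simp add: ready_def random_weights_def table_def)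
            then show "wp c Q V5 A5 (0 + 2 * m) t5"
              using z5 t t1 t2 t3 t4 t5 by (intro rest) (simp add: prepared_def)
          qed
          then show "wp (kahn_c ;; c) Q V4 A4 (0 + 2 * m) t4" by (simp only: wp_Then)
        qed
        then show "wp (queue_c ;; kahn_c ;; c) Q V3 A3 (0 + 2 * m) t3" by (simp only: wp_Then)
      qed
      then show "wp (adjacency_c ;; queue_c ;; kahn_c ;; c) Q V2 A2 (0 + 2 * m) t2" by (simp only: wp_Then)
    qed
    then show "wp (table_c ;; adjacency_c ;; queue_c ;; kahn_c ;; c) Q V1 A1 (0 + 2 * m) t1" by (simp only: wp_Then)
  qed
  then show ?thesis by (simp only: wp_Then)
qed

definition measured :: "nat \<Rightarrow> env \<Rightarrow> arrs \<Rightarrow> nat \<Rightarrow> nat \<Rightarrow> bool" where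
  "measured T V A j t \<longleftrightarrow> ready V A \<and> dists (inp 2) (A aD1) \<and> dists (inp 4) (A aD2) \<and>
     zero_on {10..14} A \<and> t \<le> T"

lemma wp_measure:
  assumes p: "prepared T V A j t"
    and rest: "\<And>V' A' j' t'. measured (T + 6 + 18 * m) V' A' j' t' \<Longrightarrow> wp c Q V' A' j' t'"
  shows "wp (dist_c aD1 vS1 ;; dist_c aD2 vS2 ;; c) Q V A j t"
proof -
  have r: "ready V A" and z: "zero_on {8..14} A" and t: "t \<le> T" using p by (auto simp: prepared_def)
  have "wp (dist_c aD1 vS1) (wp (dist_c aD2 vS2 ;; c) Q) V A j t"
  proof (rule wp_dist)
    show "A aD1 i = 0" for i using z by (simp add: zero_on_def)
    fix V1 A1 t1
    assume f1: "frame (dist_c aD1 vS1) V A V1 A1" and d1: "dists (V vS1) (A1 aD1)" and t1: "t1 \<le> t + 3 + m * 9"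
    have r1: "ready V1 A1" by (rule ready_frame[OF r f1]) auto
    have z1: "zero_on {9..14} A1" by (rule zero_on_frame[OF z f1]) auto
    have "wp (dist_c aD2 vS2) (wp c Q) V1 A1 j t1"
    proof (rule wp_dist)
      show "A1 aD2 i = 0" for i using z1 by (simp add: zero_on_def)
      fix V2 A2 t2
      assume f2: "frame (dist_c aD2 vS2) V1 A1 V2 A2" and d2: "dists (V1 vS2) (A2 aD2)" and t2: "t2 \<le> t1 + 3 + m * 9"
      have r2: "ready V2 A2" by (rule ready_frame[OF r1 f2]) auto
      have z2: "zero_on {10..14} A2" by (rule zero_on_frame[OF z1 f2]) auto
      have "dists (inp 2) (A2 aD1)" "dists (inp 4) (A2 aD2)"
        using d1 d2 r r1 frameD(2)[OF f2, of aD1] by (simp_all add: ready_def globals_def)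
      then show "wp c Q V2 A2 j t2" using r2 z2 t t1 t2 by (intro rest) (simp add: measured_def)
    qed (use r1 in \<open>auto simp: ready_def\<close>)
    then show "wp (dist_c aD2 vS2 ;; c) Q V1 A1 j t1" by (simp only: wp_Then)
  qed (use r in \<open>auto simp: ready_def\<close>)
  then show ?thesis by (simp only: wp_Then)
qed

definition forward :: "nat \<Rightarrow> env \<Rightarrow> arrs \<Rightarrow> nat \<Rightarrow> nat \<Rightarrow> bool" where
  "forward T V A j t \<longleftrightarrow> ready V A \<and> dists (inp 2) (A aD1) \<and> dists (inp 4) (A aD2) \<and>
     solves False (A aD1) (A aX) (inp 2) (A aL1) \<and> solves False (A aD2) (A aY) (inp 4) (A aL2) \<and>
     shares A \<and> zero_on {13, 14} A \<and> t \<le> T"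

lemma wp_forward:
  assumes p: "measured T V A j t"
    and rest: "\<And>V' A' j' t'. forward (T + 8 + m * (5 * mult_time + 31)) V' A' j' t' \<Longrightarrow> wp c Q V' A' j' t'"
  shows "wp (path_sum_c B False aD1 aX aL1 vS1 ;; path_sum_c B False aD2 aY aL2 vS2 ;; shared_c B ;; c) Q V A j t"
proof -
  have r: "ready V A" and z: "zero_on {10..14} A" and t: "t \<le> T"
    and d: "dists (inp 2) (A aD1)" "dists (inp 4) (A aD2)" using p by (auto simp: measured_def)
  have "wp (path_sum_c B False aD1 aX aL1 vS1) (wp (path_sum_c B False aD2 aY aL2 vS2 ;; shared_c B ;; c) Q) V A j t"
  proof (rule wp_path_sum[where sd = "inp 2"])
    show "A aL1 i = 0" for i using z by (simp add: zero_on_def)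
    show "A aX e < 2 ^ N" if "e < m" for e using ready_words[OF r that] by simp
    fix V1 A1 t1
    assume f1: "frame (path_sum_c B False aD1 aX aL1 vS1) V A V1 A1"
      and s1: "solves False (A aD1) (A aX) (V vS1) (A1 aL1)" and t1: "t1 \<le> t + 3 + m * (mult_time + 9)"
    have r1: "ready V1 A1" by (rule ready_frame[OF r f1]) auto
    have z1: "zero_on {11..14} A1" by (rule zero_on_frame[OF z f1]) auto
    have eq1: "A1 aX = A aX" "A1 aY = A aY" "A1 aD1 = A aD1" "A1 aD2 = A aD2" using frameD(2)[OF f1] by auto
    have "wp (path_sum_c B False aD2 aY aL2 vS2) (wp (shared_c B ;; c) Q) V1 A1 j t1"
    proof (rule wp_path_sum[where sd = "inp 4"])
      show "A1 aL2 i = 0" for i using z1 by (simp add: zero_on_def)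
      show "A1 aY e < 2 ^ N" if "e < m" for e using ready_words[OF r1 that] by simp
      fix V2 A2 t2
      assume f2: "frame (path_sum_c B False aD2 aY aL2 vS2) V1 A1 V2 A2"
        and s2: "solves False (A1 aD2) (A1 aY) (V1 vS2) (A2 aL2)" and t2: "t2 \<le> t1 + 3 + m * (mult_time + 9)"
      have r2: "ready V2 A2" by (rule ready_frame[OF r1 f2]) auto
      have z2: "zero_on {12..14} A2" by (rule zero_on_frame[OF z1 f2]) auto
      have eq2: "A2 aX = A aX" "A2 aY = A aY" "A2 aD1 = A aD1" "A2 aD2 = A aD2" "A2 aL1 = A1 aL1"
        using frameD(2)[OF f2] eq1 by auto
      have S: "solves False (A2 aD1) (A2 aX) (inp 2) (A2 aL1)" "solves False (A2 aD2) (A2 aY) (inp 4) (A2 aL2)"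
        using s1 s2 r r1 eq1 eq2 by (simp_all add: ready_def globals_def)
      have "wp (shared_c B) (wp c Q) V2 A2 j t2"
      proof (rule wp_shared[where sa = "inp 2" and sb = "inp 4"])
        show "A2 aSH i = 0" for i using z2 by (simp add: zero_on_def)
        show "A2 aX e < 2 ^ N" if "e < m" for e using ready_words[OF r2 that] by simp
        fix V3 A3 t3
        assume f3: "frame (shared_c B) V2 A2 V3 A3" and w3: "words (A3 aSH)"
          and sh: "\<And>v. pcong (cyc N) (word_poly (A3 aSH v))
            (\<Sum>e\<in>{e. e < m \<and> tight (A2 aD1) e \<and> tight (A2 aD2) e \<and> \<not> at_ends (src e) \<and> tgt e = v}.
              word_poly (A2 aX e) * word_poly (A2 aX e) * (word_poly (A2 aL1 (src e)) * word_poly (A2 aL2 (src e))))"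
          and t3: "t3 \<le> t2 + 2 + m * (3 * mult_time + 13)"
        have r3: "ready V3 A3" by (rule ready_frame[OF r2 f3]) auto
        have z3: "zero_on {13, 14} A3" by (rule zero_on_frame[OF z2 f3]) auto
        have eq3: "A3 aX = A2 aX" "A3 aY = A2 aY" "A3 aD1 = A2 aD1" "A3 aD2 = A2 aD2"
          "A3 aL1 = A2 aL1" "A3 aL2 = A2 aL2"
          using frameD(2)[OF f3] by auto
        have "shares A3" using w3 sh by (simp add: shares_def eq3)
        moreover have "t3 \<le> T + 8 + m * (5 * mult_time + 31)"
          using t t1 t2 t3 by (simp add: algebra_simps)
        ultimately show "wp c Q V3 A3 j t3"
          using r3 z3 S d eq2 by (intro rest) (simp add: forward_def eq3)
      qed (use r2 S d eq2 solves_words in \<open>auto simp: ready_def\<close>)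
      then show "wp (shared_c B ;; c) Q V2 A2 j t2" by (simp only: wp_Then)
    qed (use r1 d eq1 in \<open>auto simp: ready_def\<close>)
    then show "wp (path_sum_c B False aD2 aY aL2 vS2 ;; shared_c B ;; c) Q V1 A1 j t1" by (simp only: wp_Then)
  qed (use r d in \<open>auto simp: ready_def\<close>)
  then show ?thesis by (simp only: wp_Then)
qed

definition outcome :: "nat \<Rightarrow> env \<Rightarrow> arrs \<Rightarrow> nat \<Rightarrow> nat \<Rightarrow> bool" where
  "outcome T V A j t \<longleftrightarrow> random_weights 0 A \<and> dists (inp 2) (A aD1) \<and> dists (inp 4) (A aD2) \<and>
     solves False (A aD1) (A aX) (inp 2) (A aL1) \<and> solves False (A aD2) (A aY) (inp 4) (A aL2) \<and>
     shares A \<and>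
     solves True (A aD1) (A aX) (inp 3) (A aR1) \<and> solves True (A aD2) (A aY) (inp 5) (A aR2) \<and>
     result A (V vRES) \<and> t \<le> T"

lemma wp_backward:
  assumes p: "forward T V A j t"
  shows "wp (path_sum_c B True aD1 aX aR1 vT1 ;; path_sum_c B True aD2 aY aR2 vT2 ;; result_c B)
    (outcome (T + mult_time + 11 + m * (2 * mult_time + 18) + n * (3 * mult_time + 11))) V A j t"
proof -
  let ?Q = "outcome (T + mult_time + 11 + m * (2 * mult_time + 18) + n * (3 * mult_time + 11))"
  have r: "ready V A" and z: "zero_on {13, 14} A" and t: "t \<le> T"
    and d: "dists (inp 2) (A aD1)" "dists (inp 4) (A aD2)"
    and S: "solves False (A aD1) (A aX) (inp 2) (A aL1)" "solves False (A aD2) (A aY) (inp 4) (A aL2)"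
      "shares A" using p by (auto simp: forward_def)
  have "wp (path_sum_c B True aD1 aX aR1 vT1) (wp (path_sum_c B True aD2 aY aR2 vT2 ;; result_c B) ?Q) V A j t"
  proof (rule wp_path_sum[where sd = "inp 2"])
    show "A aR1 i = 0" for i using z by (simp add: zero_on_def)
    show "A aX e < 2 ^ N" if "e < m" for e using ready_words[OF r that] by simp
    fix V1 A1 t1
    assume f1: "frame (path_sum_c B True aD1 aX aR1 vT1) V A V1 A1"
      and s1: "solves True (A aD1) (A aX) (V vT1) (A1 aR1)" and t1: "t1 \<le> t + 3 + m * (mult_time + 9)"
    have r1: "ready V1 A1" by (rule ready_frame[OF r f1]) auto
    have z1: "zero_on {14} A1" by (rule zero_on_frame[OF z f1]) auto
    have eq1: "A1 aX = A aX" "A1 aY = A aY" "A1 aD1 = A aD1" "A1 aD2 = A aD2" "A1 aL1 = A aL1"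
      "A1 aL2 = A aL2" "A1 aSH = A aSH" using frameD(2)[OF f1] by auto
    have "wp (path_sum_c B True aD2 aY aR2 vT2) (wp (result_c B) ?Q) V1 A1 j t1"
    proof (rule wp_path_sum[where sd = "inp 4"])
      show "A1 aR2 i = 0" for i using z1 by (simp add: zero_on_def)
      show "A1 aY e < 2 ^ N" if "e < m" for e using ready_words[OF r1 that] by simp
      fix V2 A2 t2
      assume f2: "frame (path_sum_c B True aD2 aY aR2 vT2) V1 A1 V2 A2"
        and s2: "solves True (A1 aD2) (A1 aY) (V1 vT2) (A2 aR2)" and t2: "t2 \<le> t1 + 3 + m * (mult_time + 9)"
      have r2: "ready V2 A2" by (rule ready_frame[OF r1 f2]) auto
      have eq2: "A2 aX = A aX" "A2 aY = A aY" "A2 aD1 = A aD1" "A2 aD2 = A aD2" "A2 aL1 = A aL1"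
        "A2 aL2 = A aL2" "A2 aSH = A aSH" "A2 aR1 = A1 aR1"
        using frameD(2)[OF f2] eq1 by auto
      have S2: "solves True (A2 aD1) (A2 aX) (inp 3) (A2 aR1)" "solves True (A2 aD2) (A2 aY) (inp 5) (A2 aR2)"
        using s1 s2 r r1 eq1 eq2 by (simp_all add: ready_def globals_def)
      have S1: "solves False (A2 aD1) (A2 aX) (inp 2) (A2 aL1)" "solves False (A2 aD2) (A2 aY) (inp 4) (A2 aL2)"
        "shares A2" using S eq2 by (simp_all add: shares_def)
      show "wp (result_c B) ?Q V2 A2 j t2"
      proof (rule wp_result)
        show "words (A2 aSH)" using S1 by (simp add: shares_def)
        show "words (A2 aL1)" "words (A2 aL2)" "words (A2 aR1)" "words (A2 aR2)"
          using S1 S2 solves_words by blast+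
        show "globals V2" "table A2" using r2 by (simp_all add: ready_def)
        fix V3 t3
        assume "V3 vRES < 2 ^ N" "pcong (cyc N) (word_poly (V3 vRES))
          (word_poly (A2 aL1 (inp 3)) * word_poly (A2 aL2 (inp 5)) + (\<Sum>v\<in>{v. v < n \<and> \<not> at_ends v}.
          (word_poly (A2 aL1 v) * word_poly (A2 aL2 v) + word_poly (A2 aSH v)) *
          (word_poly (A2 aR1 v) * word_poly (A2 aR2 v))))"
          and t3: "t3 \<le> t2 + mult_time + 5 + n * (3 * mult_time + 11)"
        then have "result A2 (V3 vRES)" by (simp add: result_def)
        moreover have "t3 \<le> T + mult_time + 11 + m * (2 * mult_time + 18) + n * (3 * mult_time + 11)"
          using t t1 t2 t3 by (simp add: algebra_simps)
        ultimately show "?Q V3 A2 j t3" using S1 S2 d eq2 r2 by (simp add: outcome_def ready_def)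
      qed
    qed (use r1 d eq1 in \<open>auto simp: ready_def\<close>)
    then show "wp (path_sum_c B True aD2 aY aR2 vT2 ;; result_c B) ?Q V1 A1 j t1" by (simp only: wp_Then)
  qed (use r d in \<open>auto simp: ready_def\<close>)
  then show ?thesis by (simp only: wp_Then)
qed

lemma wp_main:
  assumes "n = inp 0" "m = inp 1" "0 < n" "2 * n < 2 ^ w" "N < w" "h < w" "a < 2 ^ w"
    and N: "N = 3 * 3 ^ field_exp a (floorlog 2 n)" and h: "h = floorlog 2 n div 2 + 1"
  shows "\<exists>T. T \<le> 53 + 3 * floorlog 2 n + 2 * (a * floorlog 2 n) + 6 * 2 ^ (2 * h) + mult_time +
      m * (7 * mult_time + 92) + n * (3 * mult_time + 21) \<and>
    wp (main_c a B) (outcome T) (\<lambda>_. 0) (\<lambda>_ _. 0) 0 0"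
proof -
  let ?l = "floorlog 2 n"
  let ?T1 = "15 + 3 * ?l + 2 * (a * ?l)"
  let ?T2 = "?T1 + 13 + 25 * m + 6 * 2 ^ (2 * h) + 10 * n"
  let ?T3 = "?T2 + 6 + 18 * m"
  let ?T4 = "?T3 + 8 + m * (5 * mult_time + 31)"
  let ?T5 = "?T4 + mult_time + 11 + m * (2 * mult_time + 18) + n * (3 * mult_time + 11)"
  let ?c5 = "path_sum_c B True aD1 aX aR1 vT1 ;; path_sum_c B True aD2 aY aR2 vT2 ;; result_c B"
  let ?c4 = "path_sum_c B False aD1 aX aL1 vS1 ;; path_sum_c B False aD2 aY aL2 vS2 ;; shared_c B ;; ?c5"
  let ?c3 = "dist_c aD1 vS1 ;; dist_c aD2 vS2 ;; ?c4"
  let ?c2 = "random_c ;; table_c ;; adjacency_c ;; queue_c ;; kahn_c ;; ?c3"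
  have "wp (setup_c a) (wp ?c2 (outcome ?T5)) (\<lambda>_. 0) (\<lambda>_ _. 0) 0 0"
  proof (rule wp_setup[OF assms(1,3)], goal_cases)
    case (6 V' t')
    show ?case
    proof (rule wp_prepare)
      show "globals V'" using 6 unfolding globals_def params_def assms(2)[symmetric] N[symmetric] h[symmetric] by blast
      show "zero_on {0..14} (\<lambda>_ _. 0)" by (simp add: zero_on_def)
      show "t' \<le> ?T1" using 6 by simp
    qed (rule wp_measure, assumption, rule wp_forward, assumption, rule wp_backward)
  qed (use assms base_eq in auto)
  then have "wp (main_c a B) (outcome ?T5) (\<lambda>_. 0) (\<lambda>_ _. 0) 0 0"
    unfolding main_c_def by (subst wp_Then)
  then show ?thesis by (intro exI[of _ ?T5]) (simp add: algebra_simps)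
qed

end

subsection \<open>Correctness of the computed polynomial\<close>

lemma degree_cyc: "0 < N \<Longrightarrow> degree (cyc N) = N"
  by (simp add: cyc_def degree_add_eq_left degree_monom_eq)

context dag
begin

text \<open>Tails of edges into \<open>v\<close> have smaller rank, so the recurrence determines
  \<open>z\<close> by induction.\<close>

lemma path_sum_uniqueI:
  fixes z :: "'v \<Rightarrow> 'r::comm_ring_1"
  assumes "T \<subseteq> E" and z: "\<And>v. pcong g (z v)
    ((if v = u then 1 else 0) + (\<Sum>e\<in>{e \<in> T. snd e = v}. x e * z (fst e)))"
  shows "pcong g (z v) (path_sum T x u v)"
proof (induction "\<rho> v" arbitrary: v rule: less_induct)
  case less
  have "pcong g (\<Sum>e\<in>{e \<in> T. snd e = v}. x e * z (fst e))
      (\<Sum>e\<in>{e \<in> T. snd e = v}. x e * path_sum T x u (fst e))"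
    by (rule pcong_sum, rule pcong_mult[OF pcong_refl], rule less) (use rank assms(1) in auto)
  from pcong_trans[OF z pcong_add[OF pcong_refl this]] show ?case
    unfolding path_sum_last[OF assms(1), of x u v] by (simp only: eq_commute[of v u])
qed

lemma path_sum_backward_uniqueI:
  fixes z :: "'v \<Rightarrow> 'r::comm_ring_1"
  assumes "T \<subseteq> E" and z: "\<And>u. pcong g (z u)
    ((if u = v then 1 else 0) + (\<Sum>e\<in>{e \<in> T. fst e = u}. x e * z (snd e)))"
  shows "pcong g (z u) (path_sum T x u v)"
\<comment> \<open>Now the recurrence refers to larger ranks. The measure counts the edges with head
  above \<open>u\<close>, and drops because \<open>e\<close> itself is no longer counted.\<close>
proof (induction "card {e \<in> E. \<rho> u < \<rho> (snd e)}" arbitrary: u rule: less_induct)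
  case less
  have "pcong g (\<Sum>e\<in>{e \<in> T. fst e = u}. x e * z (snd e))
      (\<Sum>e\<in>{e \<in> T. fst e = u}. x e * path_sum T x (snd e) v)"
  proof (rule pcong_sum, rule pcong_mult[OF pcong_refl], rule less)
    fix e assume "e \<in> {e \<in> T. fst e = u}"
    then have e: "e \<in> E" "\<rho> u < \<rho> (snd e)" using rank[of e] assms(1) by auto
    then have "{e' \<in> E. \<rho> (snd e) < \<rho> (snd e')} \<subseteq> {e' \<in> E. \<rho> u < \<rho> (snd e')} - {e}" by auto
    then have "card {e' \<in> E. \<rho> (snd e) < \<rho> (snd e')} \<le> card ({e' \<in> E. \<rho> u < \<rho> (snd e')} - {e})"
      using finite_E by (intro card_mono) auto
    also have "\<dots> < card {e' \<in> E. \<rho> u < \<rho> (snd e')}"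
      using finite_E e by (intro card_Diff1_less) auto
    finally show "card {e' \<in> E. \<rho> (snd e) < \<rho> (snd e')} < card {e' \<in> E. \<rho> u < \<rho> (snd e')}" .
  qed
  from pcong_trans[OF z pcong_add[OF pcong_refl this]] show ?case
    unfolding path_sum_first[OF assms(1), of x u v] .
qed

end

section \<open>The polynomial of an instance given by an edge list\<close>

locale dag_instance = dag_graph G \<rho> wt for G \<rho> wt +
  fixes n :: nat and es :: "(nat \<times> nat) list" and s1 t1 s2 t2 :: nat
  assumes es: "distinct es" "set es = parcs G"
    and vertices: "pverts G = {..<n}"
    and wt_pos: "e \<in> parcs G \<Longrightarrow> 0 < wt e"
    and sources: "s1 < n" "s2 < n"
begin

definition idx :: "nat \<times> nat \<Rightarrow> nat" where
  "idx = inv_into {..<length es} ((!) es)"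

definition xi :: "(nat \<Rightarrow> 'r) \<Rightarrow> nat \<times> nat \<Rightarrow> 'r::comm_ring_1" where
  "xi r e = r (2 * idx e)"

definition yi :: "(nat \<Rightarrow> 'r) \<Rightarrow> nat \<times> nat \<Rightarrow> 'r::comm_ring_1" where
  "yi r e = r (if s1 = s2 \<and> fst e = s1 then Suc (2 * idx e) else 2 * idx e)"

definition solutions :: "((nat \<times> nat) list \<times> (nat \<times> nat) list) set" where
  "solutions = {(p, q). shortest_path (\<lambda>e. real (wt e)) s1 p t1 \<and>
     shortest_path (\<lambda>e. real (wt e)) s2 q t2 \<and>
     path_verts s1 p \<inter> path_verts s2 q \<subseteq> {s1, t1} \<inter> {s2, t2}}"

text \<open>The index sets of \<open>two_dags_indexed\<close>, but defined from shortest paths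
  instead of computed labels. The family is thus the same for all tapes, as the probability estimate
  demands.\<close>

definition family :: "nat set set" where
  "family = (\<lambda>(p, q). (\<lambda>e. 2 * idx e) ` set p \<union>
     (\<lambda>e. if s1 = s2 \<and> fst e = s1 then Suc (2 * idx e) else 2 * idx e) ` set q) ` solutions"

lemma bij_nth: "bij_betw ((!) es) {..<length es} (parcs G)"
  using bij_betw_nth[OF es(1) refl es(2)[symmetric]] .

lemma idx_nth: "i < length es \<Longrightarrow> idx (es ! i) = i"
  unfolding idx_def by (rule inv_into_f_f) (use bij_nth in \<open>auto simp: bij_betw_def\<close>)

lemma arc_nth: "e \<in> parcs G \<Longrightarrow> \<exists>i < length es. e = es ! i"
  unfolding es(2)[symmetric] by (auto simp: in_set_conv_nth)

lemma idx_less: "e \<in> parcs G \<Longrightarrow> idx e < length es"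
  using arc_nth idx_nth by metis

lemma nth_idx: "e \<in> parcs G \<Longrightarrow> es ! idx e = e"
  using arc_nth idx_nth by metis

lemma sum_arcs:
  "(\<Sum>i\<in>{i. i < length es \<and> Q (es ! i)}. f i) = (\<Sum>e\<in>{e \<in> parcs G. Q e}. f (idx e))"
proof -
  have b: "bij_betw ((!) es) {i. i < length es \<and> Q (es ! i)} {e \<in> parcs G. Q e}"
  proof (rule bij_betw_subset[OF bij_nth])
    show "(!) es ` {i. i < length es \<and> Q (es ! i)} = {e \<in> parcs G. Q e}"
      using arc_nth es(2) nth_mem[of _ es] by fastforce
  qed auto
  have "(\<Sum>i\<in>{i. i < length es \<and> Q (es ! i)}. f i) =
      (\<Sum>i\<in>{i. i < length es \<and> Q (es ! i)}. f (idx (es ! i)))"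
    by (intro sum.cong) (auto simp: idx_nth)
  also have "\<dots> = (\<Sum>e\<in>{e \<in> parcs G. Q e}. f (idx e))"
    by (rule sum.reindex_bij_betw[OF b])
  finally show ?thesis .
qed

lemma parcs_sub: "parcs G \<subseteq> {..<n} \<times> {..<n}"
  using vertices by (auto dest: in_arcsD1 in_arcsD2)

lemma two_dags_indexed:
  assumes "(1 :: 'r::comm_ring_1) + 1 = 0"
    "distances (parcs G) wt {..<n} s1 d1" "distances (parcs G) wt {..<n} s2 d2"
  shows "two_dags_indexed (parcs G) \<rho> (tight_edges (parcs G) wt d1) (tight_edges (parcs G) wt d2)
    s1 s2 {..<n} (xi r) (yi r :: _ \<Rightarrow> 'r) r idx"
proof unfold_locales
  fix u p v q
  assume "pth (tight_edges (parcs G) wt d1) u p v" "pth (tight_edges (parcs G) wt d2) u q v" "u \<noteq> v"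
  then show "pth (tight_edges (parcs G) wt d2) u p v \<and> pth (tight_edges (parcs G) wt d1) u q v"
    by (rule tight_exchange[OF assms(2,3)])
next
  show "inj_on idx (parcs G)"
    by (rule inj_onI) (metis arc_nth idx_nth)
qed (use assms(1) parcs_sub sources tight_into_source[OF assms(2) wt_pos]
      tight_into_source[OF assms(3) wt_pos] in \<open>auto simp: tight_edges_def xi_def yi_def\<close>)

context
  fixes d1 d2 :: "nat \<Rightarrow> nat"
  assumes d1: "distances (parcs G) wt {..<n} s1 d1" and d2: "distances (parcs G) wt {..<n} s2 d2"
begin

lemma avoiding_eq_solutions:
  assumes "(1 :: 'r::comm_ring_1) + 1 = 0"
  shows "two_dags.avoiding (tight_edges (parcs G) wt d1) (tight_edges (parcs G) wt d2)
    s1 t1 s2 t2 {..<n} t1 t2 = solutions"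
proof -
  interpret td: two_dags_indexed "parcs G" \<rho> "tight_edges (parcs G) wt d1" "tight_edges (parcs G) wt d2"
    s1 t1 s2 t2 "{..<n}" "xi r" "yi r" "r :: nat \<Rightarrow> 'r" idx for r
    by (rule two_dags_indexed[OF assms d1 d2])
  have "shortest_path (\<lambda>e. real (wt e)) s1 p t1 \<longleftrightarrow> pth (tight_edges (parcs G) wt d1) s1 p t1" for p
    by (rule shortest_path_iff) (use d1 sources vertices in auto)
  moreover have "shortest_path (\<lambda>e. real (wt e)) s2 p t2 \<longleftrightarrow> pth (tight_edges (parcs G) wt d2) s2 p t2" for p
    by (rule shortest_path_iff) (use d2 sources vertices in auto)
  moreover have "path_verts s1 p \<subseteq> {..<n}" if "pth (tight_edges (parcs G) wt d1) s1 p t1" for p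
    using pth_subset[OF that] parcs_sub sources by (fastforce simp: path_verts_def tight_edges_def)
  ultimately show ?thesis
    unfolding solutions_def td.avoiding_def td.meets_def td.bad_def td.ends_def paths_def
    by blast
qed

lemma family_nonempty_iff:
  "disjoint_shortest_paths (\<lambda>e. real (wt e)) [s1, s2] [t1, t2] \<longleftrightarrow> family \<noteq> {}"
proof -
  have s: "s1 \<in> pverts G" "s2 \<in> pverts G" using sources vertices by auto
  note d = d1[folded vertices] d2[folded vertices]
  show ?thesis
    unfolding disjoint_shortest_paths_iff[OF d s] family_def solutions_def
      shortest_path_iff[OF d(1) s(1)] shortest_path_iff[OF d(2) s(2)] by auto
qed

lemma family_eq:
  "family = two_dags_indexed.index_set s1 s2 idx ` two_dags.avoiding (tight_edges (parcs G) wt d1)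
    (tight_edges (parcs G) wt d2) s1 t1 s2 t2 {..<n} t1 t2"
  and family_bounds: "family \<subseteq> Pow {..<2 * length es}" "S \<in> family \<Longrightarrow> card S \<le> 2 * n"
proof -
  \<comment> \<open>The claims speak of index sets only; a concrete ring of characteristic 2 is
    chosen to enter the locale.\<close>
  have 2: "(1 :: bit poly) + 1 = 0" by (simp add: one_pCons)
  interpret td: two_dags_indexed "parcs G" \<rho> "tight_edges (parcs G) wt d1" "tight_edges (parcs G) wt d2"
    s1 t1 s2 t2 "{..<n}" "xi r" "yi r" "r :: nat \<Rightarrow> bit poly" idx for r
    by (rule two_dags_indexed[OF 2 d1 d2])
  show fam: "family = td.index_set ` td.avoiding t1 t2"
    unfolding avoiding_eq_solutions[OF 2] family_def td.index_set_def td.iy_def ..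
  show "family \<subseteq> Pow {..<2 * length es}"
    using td.index_set_less[OF _ idx_less] unfolding fam by blast
  show "S \<in> family \<Longrightarrow> card S \<le> 2 * n"
    using td.card_index_set unfolding fam by auto
qed

lemma sum_family:
  fixes r :: "nat \<Rightarrow> 'r::comm_ring_1"
  assumes "(1 :: 'r) + 1 = 0"
  shows "two_dags.avoid_sum (tight_edges (parcs G) wt d1) (tight_edges (parcs G) wt d2)
    s1 t1 s2 t2 {..<n} (xi r) (yi r) t1 t2 = (\<Sum>S\<in>family. \<Prod>i\<in>S. r i)"
proof -
  interpret td: two_dags_indexed "parcs G" \<rho> "tight_edges (parcs G) wt d1" "tight_edges (parcs G) wt d2"
    s1 t1 s2 t2 "{..<n}" "xi r" "yi r" r idx
    by (rule two_dags_indexed[OF assms d1 d2])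
  show ?thesis unfolding td.avoid_sum_index_sets family_eq ..
qed

end

end

section \<open>From the final memory to the polynomial\<close>

locale instance_ram = graph_ram w lim base inp \<omega> B N h n m Wm \<rho> +
    dg?: dag_instance G \<rho> wt n es "inp 2" "inp 3" "inp 4" "inp 5"
  for w lim base inp \<omega> B N h n m Wm \<rho> G wt es +
  assumes length_es: "length es = m"
    and es_nth: "e < m \<Longrightarrow> es ! e = (src e, tgt e)"
    and wt_nth: "e < m \<Longrightarrow> wt (es ! e) = wgt e"
begin

lemma distances_dists: "dists s d \<Longrightarrow> distances (parcs G) wt {..<n} s d"
  unfolding dists_def distances_def es(2)[symmetric]
  by (auto simp: in_set_conv_nth length_es es_nth wt_nth)
    (metis es_nth wt_nth fst_conv snd_conv length_es nth_mem)+

definition ri :: "nat \<Rightarrow> bit poly" where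
  "ri i = word_poly (\<omega> i mod 2 ^ N)"

abbreviation "TE d \<equiv> tight_edges (parcs G) wt d"

lemma sum_tight:
  "(\<Sum>i\<in>{i. i < m \<and> tight d i \<and> Q (src i) (tgt i)}. f i) =
    (\<Sum>e\<in>{e \<in> TE d. Q (fst e) (snd e)}. f (idx e))"
proof -
  let ?P = "\<lambda>e. d (fst e) \<noteq> 0 \<and> d (fst e) + wt e = d (snd e) \<and> Q (fst e) (snd e)"
  have "{i. i < m \<and> tight d i \<and> Q (src i) (tgt i)} = {i. i < length es \<and> ?P (es ! i)}"
    by (auto simp: tight_def length_es es_nth wt_nth[unfolded es_nth] simp flip: wt_nth)
  moreover have "{e \<in> TE d. Q (fst e) (snd e)} = {e \<in> parcs G. ?P e}"
    by (auto simp: tight_edges_def)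
  ultimately show ?thesis using sum_arcs[where Q = ?P and f = f] by simp
qed

lemma solves_forward:
  assumes z: "solves False d x s z" and x: "\<And>e. e \<in> parcs G \<Longrightarrow> word_poly (x (idx e)) = xp e"
  shows "pcong (cyc N) (word_poly (z v)) (path_sum (TE d) xp s v)"
proof (rule path_sum_uniqueI)
  fix v
  have "(\<Sum>e\<in>{e. e < m \<and> tight d e \<and> tgt e = v}. word_poly (x e) * word_poly (z (src e))) =
      (\<Sum>e\<in>{e. e < m \<and> tight d e \<and> tgt e = v}. word_poly (x e) * word_poly (z (fst (es ! e))))"
    by (intro sum.cong) (auto simp: es_nth)
  also have "\<dots> = (\<Sum>e\<in>{e \<in> TE d. snd e = v}. word_poly (x (idx e)) * word_poly (z (fst (es ! idx e))))"
    by (rule sum_tight[where Q = "\<lambda>_ b. b = v"])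
  also have "\<dots> = (\<Sum>e\<in>{e \<in> TE d. snd e = v}. xp e * word_poly (z (fst e)))"
    by (intro sum.cong) (auto simp: tight_edges_def nth_idx x)
  finally have eq: "\<And>c. pcong (cyc N) (word_poly (z v)) (c + (\<Sum>e\<in>{e. e < m \<and> tight d e \<and> tgt e = v}.
      word_poly (x e) * word_poly (z (src e)))) \<Longrightarrow> pcong (cyc N) (word_poly (z v)) (c + (\<Sum>e\<in>{e \<in> TE d. snd e = v}. xp e * word_poly (z (fst e))))"
    by (simp only:)
  show "pcong (cyc N) (word_poly (z v))
      ((if v = s then 1 else 0) + (\<Sum>e\<in>{e \<in> TE d. snd e = v}. xp e * word_poly (z (fst e))))"
    using z by (intro eq) (simp only: solves_def from_v_def to_v_def if_True if_False)
qed (auto simp: tight_edges_def)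

lemma solves_backward:
  assumes z: "solves True d x s z" and x: "\<And>e. e \<in> parcs G \<Longrightarrow> word_poly (x (idx e)) = xp e"
  shows "pcong (cyc N) (word_poly (z v)) (path_sum (TE d) xp v s)"
proof (rule path_sum_backward_uniqueI)
  fix v
  have "(\<Sum>e\<in>{e. e < m \<and> tight d e \<and> src e = v}. word_poly (x e) * word_poly (z (tgt e))) =
      (\<Sum>e\<in>{e. e < m \<and> tight d e \<and> src e = v}. word_poly (x e) * word_poly (z (snd (es ! e))))"
    by (intro sum.cong) (auto simp: es_nth)
  also have "\<dots> = (\<Sum>e\<in>{e \<in> TE d. fst e = v}. word_poly (x (idx e)) * word_poly (z (snd (es ! idx e))))"
    by (rule sum_tight[where Q = "\<lambda>a _. a = v"])
  also have "\<dots> = (\<Sum>e\<in>{e \<in> TE d. fst e = v}. xp e * word_poly (z (snd e)))"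
    by (intro sum.cong) (auto simp: tight_edges_def nth_idx x)
  finally have eq: "\<And>c. pcong (cyc N) (word_poly (z v)) (c + (\<Sum>e\<in>{e. e < m \<and> tight d e \<and> src e = v}.
      word_poly (x e) * word_poly (z (tgt e)))) \<Longrightarrow> pcong (cyc N) (word_poly (z v)) (c + (\<Sum>e\<in>{e \<in> TE d. fst e = v}. xp e * word_poly (z (snd e))))"
    by (simp only:)
  show "pcong (cyc N) (word_poly (z v))
      ((if v = s then 1 else 0) + (\<Sum>e\<in>{e \<in> TE d. fst e = v}. xp e * word_poly (z (snd e))))"
    using z by (intro eq) (simp only: solves_def from_v_def to_v_def if_True if_False)
qed (auto simp: tight_edges_def)

text \<open>Each array is congruent to the path sum it stands for, so the result is congruent to the
  right-hand side of \<open>avoid_sum_formula\<close>, evaluated at the random elements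
  \<open>ri\<close>.\<close>

theorem outcome_sum:
  assumes "outcome T V A j t"
  shows "pcong (cyc N) (word_poly (V vRES)) (\<Sum>S\<in>family. \<Prod>i\<in>S. ri i)"
proof -
  have rw: "random_weights 0 A" and d: "dists (inp 2) (A aD1)" "dists (inp 4) (A aD2)"
    and L: "solves False (A aD1) (A aX) (inp 2) (A aL1)" "solves False (A aD2) (A aY) (inp 4) (A aL2)"
    and sh: "shares A"
    and R: "solves True (A aD1) (A aX) (inp 3) (A aR1)" "solves True (A aD2) (A aY) (inp 5) (A aR2)"
    and res: "result A (V vRES)"
    using assms by (auto simp: outcome_def)
  note dd = d[THEN distances_dists]
  have 2: "(1 :: bit poly) + 1 = 0" by (simp add: one_pCons)
  interpret td: two_dags_indexed "parcs G" \<rho> "TE (A aD1)" "TE (A aD2)"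
    "inp 2" "inp 3" "inp 4" "inp 5" "{..<n}" "xi ri" "yi ri" ri idx
    by (rule two_dags_indexed[OF 2 dd])
  have ri2: "src (idx e) = fst e \<and> tgt (idx e) = snd e \<and> idx e < m" if "e \<in> parcs G" for e
    using arc_nth[OF that] idx_nth es_nth length_es by auto
  have X: "word_poly (A aX (idx e)) = xi ri e" and Y: "word_poly (A aY (idx e)) = yi ri e"
    if "e \<in> parcs G" for e
    using rw ri2[OF that] by (auto simp: random_weights_def xi_def yi_def ri_def)
  have L': "pcong (cyc N) (word_poly (A aL1 v)) (td.W1 (inp 2) v)"
    "pcong (cyc N) (word_poly (A aL2 v)) (td.W2 (inp 4) v)" for v
    using solves_forward[OF L(1) X] solves_forward[OF L(2) Y] by auto
  have R': "pcong (cyc N) (word_poly (A aR1 v)) (td.W1 v (inp 3))"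
    "pcong (cyc N) (word_poly (A aR2 v)) (td.W2 v (inp 5))" for v
    using solves_backward[OF R(1) X] solves_backward[OF R(2) Y] by auto
  have ends: "at_ends v \<longleftrightarrow> v \<in> td.ends" for v by (auto simp: at_ends_def td.ends_def)
  have S': "pcong (cyc N) (word_poly (A aSH v)) (td.shared v)" for v
  proof -
    let ?f = "\<lambda>i u. word_poly (A aX i) * word_poly (A aX i) * (word_poly (A aL1 u) * word_poly (A aL2 u))"
    let ?I = "{e \<in> TE (A aD1) \<inter> TE (A aD2). snd e = v \<and> fst e \<notin> td.ends}"
    let ?J = "{e. e < m \<and> tight (A aD1) e \<and> tight (A aD2) e \<and> \<not> at_ends (src e) \<and> tgt e = v}"
    have J: "?J = {i. i < length es \<and> es ! i \<in> ?I}"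
      by (auto simp: tight_def tight_edges_def length_es ends es_nth wt_nth[unfolded es_nth]
          simp flip: es(2) wt_nth) (metis es_nth length_es nth_mem)+
    have "(\<Sum>i\<in>?J. ?f i (src i)) = (\<Sum>i\<in>?J. ?f i (fst (es ! i)))"
      by (intro sum.cong) (auto simp: es_nth)
    also have "\<dots> = (\<Sum>e\<in>{e \<in> parcs G. e \<in> ?I}. ?f (idx e) (fst (es ! idx e)))"
      unfolding J by (rule sum_arcs)
    also have "\<dots> = (\<Sum>e\<in>?I. ?f (idx e) (fst e))"
      by (intro sum.cong) (auto simp: tight_edges_def nth_idx)
    finally have eq: "(\<Sum>i\<in>?J. ?f i (src i)) = (\<Sum>e\<in>?I. ?f (idx e) (fst e))" .
    have "pcong (cyc N) (word_poly (A aSH v)) (\<Sum>i\<in>?J. ?f i (src i))"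
      using sh unfolding shares_def by blast
    then have "pcong (cyc N) (word_poly (A aSH v)) (\<Sum>e\<in>?I. ?f (idx e) (fst e))"
      unfolding eq .
    also have "pcong (cyc N) (\<Sum>e\<in>?I. ?f (idx e) (fst e)) (td.shared v)"
      unfolding td.shared_def
    proof (rule pcong_sum)
      fix e assume "e \<in> ?I"
      then show "pcong (cyc N) (?f (idx e) (fst e))
          (xi ri e * xi ri e * (td.W1 (inp 2) (fst e) * td.W2 (inp 4) (fst e)))"
        using pcong_mult[OF pcong_refl pcong_mult[OF L'(1,2)]] X[of e] by (simp add: tight_edges_def)
    qed
    finally show ?thesis .
  qed
  have bad: "td.bad = {v. v < n \<and> \<not> at_ends v}" by (auto simp: td.bad_def ends)
  have "pcong (cyc N) (word_poly (V vRES))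
     (word_poly (A aL1 (inp 3)) * word_poly (A aL2 (inp 5)) + (\<Sum>v\<in>td.bad.
        (word_poly (A aL1 v) * word_poly (A aL2 v) + word_poly (A aSH v)) *
        (word_poly (A aR1 v) * word_poly (A aR2 v))))"
    using res by (simp add: result_def bad)
  also have "pcong (cyc N) \<dots> (td.avoid_sum (inp 3) (inp 5))"
    unfolding td.avoid_sum_formula
    by (rule pcong_add[OF pcong_mult[OF L'(1,2)] pcong_sum[OF
      pcong_mult[OF pcong_add[OF pcong_mult[OF L'(1,2)] S'] pcong_mult[OF R'(1,2)]]]])
  also have "td.avoid_sum (inp 3) (inp 5) = (\<Sum>S\<in>family. \<Prod>i\<in>S. ri i)"
    by (rule sum_family[OF dd 2])
  finally show ?thesis .
qed

text \<open>The result has degree below \<open>N\<close>, the degree of \<open>cyc N\<close>, so it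
  represents 0 only if it is the word 0. An empty family therefore always gives 0, and errors are
  confined to the other direction.\<close>

lemma outcome_correct:
  assumes "outcome T V A j t"
  shows "V vRES \<noteq> 0 \<Longrightarrow> family \<noteq> {}"
    "V vRES = 0 \<Longrightarrow> cyc N dvd (\<Sum>S\<in>family. \<Prod>i\<in>S. ri i)"
    "family \<noteq> {} \<longleftrightarrow> disjoint_shortest_paths (\<lambda>e. real (wt e)) [inp 2, inp 4] [inp 3, inp 5]"
    "family \<subseteq> Pow {..<2 * m}" "S \<in> family \<Longrightarrow> card S \<le> 2 * n"
proof -
  have d: "distances (parcs G) wt {..<n} (inp 2) (A aD1)" "distances (parcs G) wt {..<n} (inp 4) (A aD2)"
    and res: "V vRES < 2 ^ N" using assms by (auto simp: outcome_def result_def intro: distances_dists)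
  note sum = outcome_sum[OF assms]
  show "family \<noteq> {} \<longleftrightarrow> disjoint_shortest_paths (\<lambda>e. real (wt e)) [inp 2, inp 4] [inp 3, inp 5]"
    using family_nonempty_iff[OF d] by simp
  show "family \<subseteq> Pow {..<2 * m}" "S \<in> family \<Longrightarrow> card S \<le> 2 * n"
    using family_bounds[OF d] by (simp_all add: length_es)
  show "cyc N dvd (\<Sum>S\<in>family. \<Prod>i\<in>S. ri i)" if "V vRES = 0"
    using pcong_sym[OF sum] that by (simp add: pcong_def)
  show "family \<noteq> {}" if "V vRES \<noteq> 0"
  proof
    assume "family = {}"
    then have "cyc N dvd word_poly (V vRES)" using sum by (simp add: pcong_def)
    moreover have "word_poly (V vRES) \<noteq> 0" using that by (simp add: word_poly_eq_0_iff)
    moreover have "degree (cyc N) = N" by (rule degree_cyc[OF N_pos])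
    moreover have "degree (word_poly (V vRES)) < N"
      using res that by (simp add: less_power_iff_degree_word_poly word_poly_eq_0_iff)
    ultimately show False
      using dvd_imp_degree_le[of "cyc N" "word_poly (V vRES)"] by (simp add: not_less[symmetric])
  qed
qed

end

section \<open>Running time and error probability\<close>

text \<open>Computes the start \<open>6 + 3 * m\<close> of the working memory from the input cell holding \<open>m\<close>.\<close>

definition prelude :: "instr list" where
  "prelude = [Const nvar 1, Load nvar nvar, Const (Suc nvar) 3, Op Mul nvar nvar (Suc nvar),
     Const (Suc nvar) 6, Op Add nvar nvar (Suc nvar)]"

text \<open>With \<open>c + 2\<close> in place of \<open>c\<close>, the degree of the prime factor
  exceeds the demand by two bit lengths, which absorb the factor \<open>2 * n\<close> in the error
  bound. \<open>9 * (c + 2)\<close> chunks suffice by \<open>field_sizes\<close>.\<close>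

definition program :: "nat \<Rightarrow> instr list" where
  "program c = prelude @ ccom 6 (main_c (c + 2) (9 * (c + 2)))"

text \<open>Since \<open>l \<le> n\<close> and the table has at most \<open>8 * n\<close> entries,
  the constant part per vertex is \<open>53 + 3 + 48 + 21 = 125\<close>. The seven multiplications
  are those per edge: one in each of the four path sums and three in \<open>shared_c\<close>. In
  \<open>step_bound\<close>, 6 is the length of \<open>prelude\<close>.\<close>

definition tick_bound :: "nat \<Rightarrow> nat" where
  "tick_bound c = 125 + 2 * (c + 2) + 7 * field_ram.mult_time (9 * (c + 2))"

definition step_bound :: "nat \<Rightarrow> nat" where
  "step_bound c = 6 + length (ccom 6 (main_c (c + 2) (9 * (c + 2)))) * tick_bound c"

lemma nth_concat_triples:
  "i < length xs \<Longrightarrow> j < 3 \<Longrightarrow> concat (map (\<lambda>e. [f e, g e, k e]) xs) ! (3 * i + j) = [f (xs ! i), g (xs ! i), k (xs ! i)] ! j"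
proof (induction xs arbitrary: i)
  case (Cons x xs)
  show ?case
  proof (cases i)
    case 0
    have "j = 0 \<or> j = 1 \<or> j = 2" using Cons.prems by presburger
    then show ?thesis using 0 by auto
  next
    case (Suc i')
    then show ?thesis using Cons by (simp add: nth_append)
  qed
qed simp

lemma tape_step_halted: "halted P (fst x) \<Longrightarrow> (tape_step w P \<omega> ^^ k) x = x"
  by (induction k) (auto simp: tape_step_def)

lemma prob_ge_1_minus:
  assumes "measure_pmf.prob M B \<le> \<epsilon>" "\<And>x. x \<in> set_pmf M \<Longrightarrow> x \<notin> A \<Longrightarrow> x \<in> B"
  shows "measure_pmf.prob M A \<ge> 1 - \<epsilon>"
proof -
  have "measure_pmf.prob M (UNIV - A) \<le> measure_pmf.prob M B"
    by (rule measure_pmf.finite_measure_mono_AE) (use assms(2) in \<open>auto simp: AE_measure_pmf_iff\<close>)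
  then show ?thesis using assms(1) measure_pmf.prob_compl[of A M] by simp
qed

text \<open>The bound on \<open>K\<close> is a generous sum of the demands on the word length:
  \<open>(18 * (c + 2) + 2) * l\<close> for \<open>2 * N + 2 * h\<close>, \<open>(b + 3) * l\<close>
  for distances, \<open>9 * l\<close> for addresses, and 20 for small constants.\<close>

locale run_instance =
  fixes b c K :: nat and G :: "nat pair_pre_digraph" and es wt s1 t1 s2 t2
  assumes K: "18 * (c + 2) + b + 20 \<le> K" and inst: "dag_instance_2dsp b G es wt s1 t1 s2 t2"
begin

definition n :: nat where "n = card (pverts G)"
definition m :: nat where "m = card (parcs G)"
definition l :: nat where "l = floorlog 2 n"
definition w :: nat where "w = K * l"
definition N :: nat where "N = 3 * 3 ^ field_exp (c + 2) l"
definition h :: nat where "h = l div 2 + 1"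
definition xs :: "nat list" where "xs = encode_2dsp n es wt s1 t1 s2 t2"
definition inp :: "nat \<Rightarrow> nat" where "inp i = (if i < length xs then take_bit w (xs ! i) else 0)"

lemma graph:
  shows "weighted_dag G wt" "pverts G = {..<n}" "distinct es" "set es = parcs G" "length es = m"
    and terminals: "s1 < n" "t1 < n" "s2 < n" "t2 < n"
    and weight_less: "e \<in> parcs G \<Longrightarrow> wt e < 2 ^ (b * l)"
    and weight_positive: "e \<in> parcs G \<Longrightarrow> 0 < wt e"
proof -
  show "length es = m"
    using inst distinct_card[of es] by (simp add: dag_instance_2dsp_def m_def)
  have p: "pverts G = {..<n}" and s: "{s1, t1, s2, t2} \<subseteq> pverts G"
    using inst unfolding dag_instance_2dsp_def n_def by blast+
  show "pverts G = {..<n}" "s1 < n" "t1 < n" "s2 < n" "t2 < n" using p s by auto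
qed (use inst in \<open>auto simp: dag_instance_2dsp_def weighted_dag_def n_def l_def\<close>)

lemma parcs_subset: "parcs G \<subseteq> {..<n} \<times> {..<n}"
proof -
  have "pair_digraph G" using graph(1) by (simp add: weighted_dag_def)
  then have "pair_wf_digraph G" by (simp add: pair_digraph_def pair_fin_digraph_def)
  then show ?thesis
    unfolding graph(2)[symmetric] by (auto dest: pair_wf_digraph.in_arcsD1 pair_wf_digraph.in_arcsD2)
qed

lemma log_bounds: "0 < n" "n < 2 ^ l" "2 ^ (l - 1) \<le> n" "0 < l" "l \<le> n"
proof -
  show n: "0 < n" using terminals by simp
  show b: "n < 2 ^ l" "2 ^ (l - 1) \<le> n" "0 < l"
    using floorlog_bounds[of n 2] n floorlog_eq_zero_iff[of 2 n] by (auto simp: l_def)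
  show "l \<le> n" using b less_exp[of "l - 1"] by linarith
qed

lemma m_le: "m \<le> n * n"
  using card_mono[OF _ parcs_subset] by (simp add: m_def)

lemma K_l: "k \<le> 18 * (c + 2) + b + 20 \<Longrightarrow> k * l \<le> w"
  using K by (simp add: w_def)

lemma word_sizes: "2 * n < 2 ^ w" "m < 2 ^ (2 * l)" "20 \<le> w" "2 ^ (b * l) \<le> (2::nat) ^ w"
  "6 + 3 * m + 16 * (m + 8 * n) \<le> 2 ^ w" "1 + m * 2 ^ (b * l) + 2 ^ (b * l) < 2 ^ w"
proof -
  let ?x = "2 ^ l :: nat"
  have x: "2 \<le> ?x" using log_bounds(4) self_le_power[of "2::nat" l] by simp
  have n: "n + 1 \<le> ?x" using log_bounds(2) by simp
  have mono: "(2::nat) ^ (k * l) \<le> 2 ^ w" if "k \<le> 18 * (c + 2) + b + 20" for k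
    using K_l[OF that] by simp
  have x2: "?x * ?x = 2 ^ (2 * l)" by (simp add: power2_eq_square[symmetric] power_mult[symmetric] mult.commute)
  have mx: "m + 1 \<le> ?x * ?x"
  proof -
    have "m + 1 \<le> (n + 1) * (n + 1)" using m_le by simp
    also have "\<dots> \<le> ?x * ?x" using n by (intro mult_mono) auto
    finally show ?thesis .
  qed
  then show "m < 2 ^ (2 * l)" unfolding x2 by simp
  show "20 \<le> w" using K_l[of 20] log_bounds(4) by linarith
  show "2 ^ (b * l) \<le> (2::nat) ^ w" by (rule mono) simp
  have "2 * (n + 1) \<le> ?x * ?x" using n x by (intro mult_mono) auto
  then have "2 * n < ?x * ?x" by (rule less_le_trans[rotated]) simp
  then show "2 * n < 2 ^ w" using mono[of 2] unfolding x2 by linarith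
  \<comment> \<open>The factor \<open>128 = 16 * 8\<close> stems from 16 arrays of
    \<open>m + 8 * n\<close> entries.\<close>
  have "(2::nat) * 2 * 32 \<le> 2 ^ (7 * l)"
    using power_increasing[of 7 "7 * l" "2::nat"] log_bounds(4) by simp
  then have "(?x * ?x) * 128 \<le> 2 ^ (2 * l) * 2 ^ (7 * l)" unfolding x2 by (intro mult_mono) auto
  also have "\<dots> = 2 ^ (9 * l)" by (simp flip: power_add)
  also have "\<dots> \<le> 2 ^ w" by (rule mono) simp
  finally have *: "(?x * ?x) * 128 \<le> 2 ^ w" .
  have "2 * ?x \<le> ?x * ?x" using x by (intro mult_mono) auto
  moreover have "4 \<le> ?x * ?x" using mult_mono[OF x x] by simp
  ultimately have "6 + 19 * m + 128 * n \<le> (?x * ?x) * 128" using mx n by linarith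
  then show "6 + 3 * m + 16 * (m + 8 * n) \<le> 2 ^ w" using * by simp
  have "1 + m * 2 ^ (b * l) + 2 ^ (b * l) = 1 + (m + 1) * 2 ^ (b * l)" by simp
  also have "\<dots> \<le> 1 + (?x * ?x) * 2 ^ (b * l)" using mx by (intro add_left_mono mult_right_mono) auto
  also have "\<dots> = 1 + 2 ^ ((b + 2) * l)"
    by (simp only: x2 power_add[symmetric] add_mult_distrib mult_2 add.commute)
  also have "\<dots> < 2 ^ Suc ((b + 2) * l)"
    using one_less_power[of "2::nat" "(b + 2) * l"] log_bounds(4) by simp
  also have "\<dots> \<le> 2 ^ w"
  proof (rule power_increasing)
    show "Suc ((b + 2) * l) \<le> w" using K_l[of "b + 3"] log_bounds(4) by (simp add: algebra_simps)
  qed simp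
  finally show "1 + m * 2 ^ (b * l) + 2 ^ (b * l) < 2 ^ w" .
qed

text \<open>Minimality of \<open>field_exp\<close> makes \<open>N\<close> at most 9/2 times
  \<open>(c + 2) * l\<close> unless the exponent is 0, and \<open>l \<le> 2 * h\<close>. For the
  table, \<open>2 * h\<close> is at most \<open>l + 2\<close>, while
  \<open>2 ^ (l - 1) \<le> n\<close>.\<close>

lemma field_sizes: "N \<le> 9 * (c + 2) * h" "h \<le> l" "9 * (c + 2) * h \<le> w" "2 * N + 2 * h \<le> w"
  "2 ^ (2 * h) \<le> 8 * n"
proof -
  show h: "h \<le> l" using log_bounds(4) by (simp add: h_def)
  have lh: "l \<le> 2 * h" by (simp add: h_def)
  show N: "N \<le> 9 * (c + 2) * h"
  proof (cases "field_exp (c + 2) l")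
    case 0
    then show ?thesis by (simp add: N_def h_def)
  next
    case (Suc k)
    then have "2 * 3 ^ k < (c + 2) * l" using field_exp(2)[of k "c + 2" l] by simp
    moreover have "(c + 2) * l \<le> (c + 2) * (2 * h)" using lh by (rule mult_left_mono) simp
    moreover have "N = 9 * 3 ^ k" unfolding N_def Suc by simp
    ultimately show ?thesis by (simp add: algebra_simps)
  qed
  have "9 * (c + 2) * h \<le> 9 * (c + 2) * l" using h by (rule mult_left_mono) simp
  moreover have "9 * (c + 2) * l \<le> w" by (rule K_l) simp
  moreover have "(18 * (c + 2) + 2) * l \<le> w" by (rule K_l) simp
  ultimately show "9 * (c + 2) * h \<le> w" "2 * N + 2 * h \<le> w" using N h by (simp_all add: algebra_simps)
  have "(2::nat) ^ (2 * h) \<le> 2 ^ (l - 1 + 3)" using log_bounds(4) by (intro power_increasing) (simp_all add: h_def)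
  also have "\<dots> = 8 * 2 ^ (l - 1)" by (simp add: power_add)
  also have "\<dots> \<le> 8 * n" using log_bounds(3) by simp
  finally show "2 ^ (2 * h) \<le> 8 * n" .
qed

lemma length_xs: "length xs = 6 + 3 * m"
  using graph(5) by (simp add: xs_def encode_2dsp_def length_concat comp_def sum_list_triv)

lemma inp_header: "inp 0 = n" "inp 1 = m" "inp 2 = s1" "inp 3 = t1" "inp 4 = s2" "inp 5 = t2"
proof -
  have "m < 2 ^ w" by (rule less_le_trans[OF word_sizes(2) power_increasing[OF K_l]]) simp_all
  moreover have "n < 2 ^ w" using word_sizes(1) by simp
  ultimately show "inp 0 = n" "inp 1 = m" "inp 2 = s1" "inp 3 = t1" "inp 4 = s2" "inp 5 = t2"
    using terminals graph(5) length_xs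
    by (simp_all add: inp_def xs_def encode_2dsp_def take_bit_nat_eq_self)
qed

lemma inp_edge:
  assumes "i < m"
  shows "inp (3 * i + 6) = fst (es ! i)" "inp (3 * i + 7) = snd (es ! i)" "inp (3 * i + 8) = wt (es ! i)"
proof -
  have e: "es ! i \<in> parcs G" using assms graph(4,5) nth_mem by metis
  then have bounds: "fst (es ! i) < 2 ^ w" "snd (es ! i) < 2 ^ w" "wt (es ! i) < 2 ^ w"
    using subsetD[OF parcs_subset e] word_sizes(1) less_le_trans[OF weight_less[OF e] word_sizes(4)]
    by auto
  have xs: "xs ! (3 * i + (6 + j)) = [fst (es ! i), snd (es ! i), wt (es ! i)] ! j" if "j < 3" for j
    using nth_concat_triples[of i es j fst snd wt] assms graph(5) that
    by (simp add: xs_def encode_2dsp_def nth_append)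
  show "inp (3 * i + 6) = fst (es ! i)" "inp (3 * i + 7) = snd (es ! i)" "inp (3 * i + 8) = wt (es ! i)"
    using xs[of 0] xs[of 1] xs[of 2] assms length_xs bounds
    by (simp_all add: inp_def take_bit_nat_eq_self)
qed

text \<open>\<open>m + 8 * n\<close> entries accommodate arrays indexed by edges, arrays indexed by
  vertices, and the multiplication table.\<close>

lemma instance_ram:
  assumes "dag_graph G \<rho>" "\<And>j. \<omega> j < 2 ^ w"
  shows "instance_ram w (m + 8 * n) (6 + 3 * m) inp \<omega> (9 * (c + 2)) N h n m (2 ^ (b * l)) \<rho> G wt es"
proof -
  interpret dag_graph G \<rho> wt by (rule assms(1))
  have e: "es ! i \<in> parcs G" if "i < m" for i using that graph(4,5) nth_mem by metis
  have ve: "fst (es ! i) < n" "snd (es ! i) < n" if "i < m" for i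
    using e[OF that] parcs_subset by auto
  interpret ram w "m + 8 * n" "6 + 3 * m" inp \<omega>
  proof
    show "narr < 2 ^ w" using word_sizes(3) less_exp[of w] by linarith
  qed (use word_sizes assms(2) in \<open>simp_all add: inp_def\<close>)
  interpret field_ram w "m + 8 * n" "6 + 3 * m" inp \<omega> "9 * (c + 2)" N h
    by unfold_locales (use field_sizes in \<open>auto simp: N_def h_def\<close>)
  interpret graph_ram w "m + 8 * n" "6 + 3 * m" inp \<omega> "9 * (c + 2)" N h n m "2 ^ (b * l)" \<rho>
  proof
    show "inp (3 * i + 6) < n \<or> m \<le> i" "inp (3 * i + 7) < n \<or> m \<le> i" for i
      using ve inp_edge not_le by metis+
  qed (use word_sizes(6) inp_edge inp_header terminals e weight_less weight_positive rank
      in \<open>simp_all add: less_imp_le\<close>)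
  show ?thesis
    by unfold_locales (use graph inp_edge inp_header terminals weight_positive
      in \<open>simp_all add: src_def tgt_def wgt_def\<close>)
qed


definition index_family :: "nat set set" where
  "index_family = dag_instance.family G wt es s1 t1 s2 t2"

text \<open>Everything that holds for each single tape of words, so that only the tapes on which a
  nonempty sum vanishes remain to be counted.\<close>

lemma run_tape:
  assumes "\<And>j. \<omega> j < 2 ^ w"
  defines "x \<equiv> fst ((tape_step w (program c) \<omega> ^^ (step_bound c * (m + n))) (initial w xs, 0))"
  shows "halted (program c) x"
    "reg x 0 \<noteq> 0 \<Longrightarrow> index_family \<noteq> {}"
    "reg x 0 = 0 \<Longrightarrow> cyc N dvd (\<Sum>S\<in>index_family. \<Prod>i\<in>S. word_poly (\<omega> i mod 2 ^ N))"
    "index_family \<noteq> {} \<longleftrightarrow> wf_digraph.disjoint_shortest_paths (with_proj G) (\<lambda>e. real (wt e)) [s1, s2] [t1, t2]"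
    "index_family \<subseteq> Pow {..<2 * m}" "S \<in> index_family \<Longrightarrow> card S \<le> 2 * n"
proof -
  obtain \<rho> where "dag_graph G \<rho>" using weighted_dag_rank[OF graph(1)] .
  then interpret instance_ram w "m + 8 * n" "6 + 3 * m" inp \<omega> "9 * (c + 2)" N h n m "2 ^ (b * l)" \<rho> G wt es
    by (rule instance_ram) (rule assms(1))
  let ?M = "main_c (c + 2) (9 * (c + 2))"
  let ?\<kappa> = "length (ccom 6 ?M)"
  let ?T0 = "53 + 3 * l + 2 * ((c + 2) * l) + 6 * 2 ^ (2 * h) + mult_time +
      m * (7 * mult_time + 92) + n * (3 * mult_time + 21)"
  have N_h: "N = 3 * 3 ^ field_exp (c + 2) (floorlog 2 n)" "h = floorlog 2 n div 2 + 1"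
    by (simp_all add: N_def h_def l_def)
  have sizes: "N < w" "h < w" "c + 2 < 2 ^ w"
  proof -
    show "N < w" "h < w" using field_sizes(4) by (simp_all add: h_def)
    have "c + 2 \<le> (c + 2) * l" using mult_le_mono2[of 1 l "c + 2"] log_bounds(4) by simp
    also have "\<dots> \<le> w" by (rule K_l) simp
    finally show "c + 2 < 2 ^ w" using less_exp[of w] by linarith
  qed
  obtain T where T: "T \<le> ?T0" "wp ?M (outcome T) (\<lambda>_. 0) (\<lambda>_ _. 0) 0 0"
    using wp_main[OF inp_header(1)[symmetric] inp_header(2)[symmetric] log_bounds(1) word_sizes(1) sizes N_h]
    unfolding l_def[symmetric] by blast
  then obtain V A j t where big: "big ?M (\<lambda>_. 0, \<lambda>_ _. 0, 0, 0) (V, A, j, t)" and out: "outcome T V A j t"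
    by (auto simp: wp_def)
  have "t \<le> tick_bound c * (m + n)"
  proof -
    have "mult_time = field_ram.mult_time (9 * (c + 2))" ..
    have "(c + 2) * l \<le> (c + 2) * n" using log_bounds(5) by (rule mult_left_mono) simp
    moreover have "mult_time \<le> mult_time * n" using log_bounds(1) by simp
    ultimately have "?T0 \<le> 53 * n + 3 * n + 2 * ((c + 2) * n) + 48 * n + mult_time * n +
        m * (7 * mult_time + 92) + n * (3 * mult_time + 21)"
      using log_bounds(1,5) field_sizes(5) by linarith
    also have "\<dots> \<le> (125 + 2 * (c + 2) + 7 * mult_time) * (m + n)" by (simp add: algebra_simps)
    finally show ?thesis using T(1) out by (simp add: tick_bound_def outcome_def)
  qed
  then have t: "?\<kappa> * t \<le> ?\<kappa> * tick_bound c * (m + n)" by (simp add: mult.assoc)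
  let ?R = "(\<lambda>_. 0 :: nat)(nvar := 6 + 3 * m, Suc nvar := 6)"
  have "6 + 3 * m < 6 + 3 * m + 16 * (m + 8 * n)" using log_bounds(1) by simp
  from less_le_trans[OF this word_sizes(5)] have small: "6 + 3 * m < 2 ^ w" "(6 :: nat) < 2 ^ w"
    by auto
  have init: "initial w xs = Config 0 (\<lambda>_. 0) inp"
    by (simp add: initial_def inp_def fun_eq_iff)
  have less: "3 * m < 2 ^ w" "6 + 3 * m < 2 ^ w" "3 * m + 6 < 2 ^ w" "(3 :: nat) < 2 ^ w" "(6 :: nat) < 2 ^ w"
    using small by auto
  have six: "(f ^^ 6) y = f (f (f (f (f (f y)))))" for f :: "'z \<Rightarrow> 'z" and y
    by (simp add: eval_nat_numeral)
  have pre: "(tape_step w (program c) \<omega> ^^ 6) (initial w xs, 0) = (Config 6 ?R inp, 0)"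
    using less inp_header(2) word_sizes(3) unfolding six
    by (simp add: init program_def prelude_def tape_step_def halted_def take_bit_nat_eq_self fun_eq_iff)
  have "rel (\<lambda>_. 0) (\<lambda>_ _. 0) ?R inp"
    by (auto simp: rel_def bounded_state_def inp_def length_xs)
  moreover have "code_at (program c) 6 (ccom 6 ?M)"
    by (simp add: code_at_def program_def prelude_def nth_append)
  ultimately obtain T' R' M' where run: "(tape_step w (program c) \<omega> ^^ T') (Config 6 ?R inp, 0) =
      (Config (6 + ?\<kappa>) R' M', j)" and rel: "rel V A R' M'" and T': "T' \<le> ?\<kappa> * t"
    using ccom_correct[OF big wf_main, of ?R inp "program c" 6 ?\<kappa>] by auto
  have halt: "halted (program c) (Config (6 + ?\<kappa>) R' M')"
    by (simp add: halted_def program_def prelude_def)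
  have "T' + 6 \<le> step_bound c * (m + n)"
    using T' t log_bounds(1) unfolding step_bound_def by (simp add: algebra_simps)
  then obtain T'' where steps: "step_bound c * (m + n) = T'' + (T' + 6)"
    using le_Suc_ex add.commute by metis
  have x: "x = Config (6 + ?\<kappa>) R' M'"
    unfolding x_def steps funpow_add comp_apply pre run
    using tape_step_halted[where P = "program c" and x = "(Config (6 + ?\<kappa>) R' M', j)" and w = w and \<omega> = \<omega> and k = T''] halt by simp
  show "halted (program c) x" unfolding x by (rule halt)
  have reg: "reg x 0 = V vRES" using rel by (simp add: x rel_def)
  note correct = outcome_correct[OF out, unfolded ri_def inp_header]
  show "reg x 0 \<noteq> 0 \<Longrightarrow> index_family \<noteq> {}"
    "reg x 0 = 0 \<Longrightarrow> cyc N dvd (\<Sum>S\<in>index_family. \<Prod>i\<in>S. word_poly (\<omega> i mod 2 ^ N))"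
    "index_family \<noteq> {} \<longleftrightarrow> wf_digraph.disjoint_shortest_paths (with_proj G) (\<lambda>e. real (wt e)) [s1, s2] [t1, t2]"
    "index_family \<subseteq> Pow {..<2 * m}" "S \<in> index_family \<Longrightarrow> card S \<le> 2 * n"
    using correct unfolding index_family_def reg by blast+
qed

text \<open>Divisibility by \<open>cyc N\<close> implies divisibility by its large prime factor
  \<open>p\<close>, modulo which a multilinear polynomial of degree at most \<open>2 * n\<close>
  vanishes with probability at most \<open>2 * n / 2 ^ degree p\<close>.\<close>

lemma vanish_prob:
  assumes "index_family \<noteq> {}" "2 * m \<le> L"
  shows "measure_pmf.prob (Pi_pmf {0..<L} 0 (\<lambda>_. word_pmf w))
    {\<omega>. cyc N dvd (\<Sum>S\<in>index_family. \<Prod>i\<in>S. word_poly (\<omega> i mod 2 ^ N))} \<le> 1 / real n ^ c"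
proof -
  let ?D = "Pi_pmf {0..<L} 0 (\<lambda>_. word_pmf w)"
  let ?Z = "\<lambda>\<omega>. \<Sum>S\<in>index_family. \<Prod>i\<in>S. word_poly (\<omega> i mod 2 ^ N)"
  \<comment> \<open>The family does not depend on the tape, so its bounds may be taken from
    any.\<close>
  note fam = run_tape(5,6)[of "\<lambda>_. 0", simplified]
  obtain p where p: "prime_elem p" "p dvd cyc N" "2 * 3 ^ field_exp (c + 2) l \<le> degree p"
    using cyc_large_prime_factor[of "field_exp (c + 2) l"] unfolding N_def by blast
  have N: "0 < N" by (simp add: N_def)
  have dN: "degree p \<le> N"
    using dvd_imp_degree_le[OF p(2)] degree_cyc[OF N] N by (cases "cyc N = 0") auto
  have "measure_pmf.prob ?D {\<omega>. p dvd ?Z \<omega>} \<le> real (2 * n) * (1 / 2 ^ degree p)"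
  proof (rule multilinear_vanish_prob)
    show "measure_pmf.prob (word_pmf w) {x. p dvd a + word_poly (x mod 2 ^ N) * b} \<le> 1 / 2 ^ degree p"
      if "\<not> p dvd b" for a b
      by (rule word_vanish_prob[OF p(1) dN _ that]) (use field_sizes(4) in simp)
    show "\<not> p dvd 1" using p(1) by (simp add: prime_elem_def)
    show "index_family \<subseteq> Pow {0..<L}" using fam(1) assms(2) by fastforce
  qed (use fam(2) assms in auto)
  also have "\<dots> \<le> 1 / real n ^ c"
  proof -
    \<comment> \<open>The bit length satisfies \<open>n + 1 \<le> 2 ^ l\<close>, so it suffices to
      bound \<open>2 * n ^ (c + 1)\<close> by \<open>(n + 1) ^ (c + 2)\<close>.\<close>
    have "real n ^ c * (2 * n) \<le> real n ^ c * (real n + 1) ^ 2"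
      by (intro mult_left_mono) (simp_all add: power2_sum)
    also have "\<dots> \<le> (real n + 1) ^ c * (real n + 1) ^ 2"
      by (intro mult_right_mono power_mono) simp_all
    also have "\<dots> = (real n + 1) ^ (c + 2)" by (simp add: power_add power2_eq_square)
    also have "\<dots> \<le> (2 ^ l) ^ (c + 2)"
    proof (rule power_mono)
      have "real (n + 1) \<le> real (2 ^ l)" using log_bounds(2) by (subst of_nat_le_iff) simp
      then show "real n + 1 \<le> 2 ^ l" by simp
    qed simp
    also have "\<dots> = 2 ^ ((c + 2) * l)" by (simp only: power_mult[symmetric] mult.commute)
    also have "\<dots> \<le> 2 ^ degree p"
      using field_exp(1)[of "c + 2" l] p(3) by (intro power_increasing) simp_all
    finally show ?thesis using log_bounds(1) by (simp add: field_simps)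
  qed
  finally have "measure_pmf.prob ?D {\<omega>. p dvd ?Z \<omega>} \<le> 1 / real n ^ c" .
  moreover have "measure_pmf.prob ?D {\<omega>. cyc N dvd ?Z \<omega>} \<le> measure_pmf.prob ?D {\<omega>. p dvd ?Z \<omega>}"
    by (intro measure_pmf.finite_measure_mono) (use p(2) dvd_trans in auto)
  ultimately show ?thesis by linarith
qed

lemma decides:
  defines "D \<equiv> run w (program c) (step_bound c * (m + n)) (initial w xs)"
    and "yes \<equiv> wf_digraph.disjoint_shortest_paths (with_proj G) (\<lambda>e. real (wt e)) [s1, s2] [t1, t2]"
  shows "\<forall>x \<in> set_pmf D. halted (program c) x"
    "measure_pmf.prob D {x. if yes then accepting (program c) x else rejecting (program c) x}
      \<ge> 1 - 1 / real n ^ c"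
proof -
  let ?L = "step_bound c * (m + n)"
  let ?F = "\<lambda>\<omega>. fst ((tape_step w (program c) \<omega> ^^ ?L) (initial w xs, 0))"
  let ?\<Omega> = "Pi_pmf {0..<?L} 0 (\<lambda>_. word_pmf w)"
  \<comment> \<open>One word per time step is enough tape.\<close>
  have D: "D = map_pmf ?F ?\<Omega>" unfolding D_def by (rule run_eq_tape) simp
  have \<omega>: "\<omega> j < 2 ^ w" if "\<omega> \<in> set_pmf ?\<Omega>" for \<omega> j
    using that by (cases "j < ?L") (auto simp: set_Pi_pmf PiE_dflt_def lessThan_empty_iff)
  have correct: "halted (program c) (?F \<omega>)" "reg (?F \<omega>) 0 \<noteq> 0 \<Longrightarrow> index_family \<noteq> {}"
    "reg (?F \<omega>) 0 = 0 \<Longrightarrow> cyc N dvd (\<Sum>S\<in>index_family. \<Prod>i\<in>S. word_poly (\<omega> i mod 2 ^ N))"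
    if "\<omega> \<in> set_pmf ?\<Omega>" for \<omega>
    using run_tape(1-3)[of \<omega>, OF \<omega>[OF that]] by blast+
  show "\<forall>x \<in> set_pmf D. halted (program c) x" unfolding D using correct(1) by auto
  have yes: "yes \<longleftrightarrow> index_family \<noteq> {}" unfolding yes_def using run_tape(4)[of "\<lambda>_. 0"] by simp
  let ?A = "{x. if yes then accepting (program c) x else rejecting (program c) x}"
  show "measure_pmf.prob D ?A \<ge> 1 - 1 / real n ^ c"
    unfolding D measure_map_pmf
  proof (cases yes)
    case True
    have "2 * m \<le> ?L" by (simp add: step_bound_def algebra_simps)
    with True yes have "measure_pmf.prob ?\<Omega>
      {\<omega>. cyc N dvd (\<Sum>S\<in>index_family. \<Prod>i\<in>S. word_poly (\<omega> i mod 2 ^ N))} \<le> 1 / real n ^ c"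
      by (intro vanish_prob) auto
    then show "measure_pmf.prob ?\<Omega> (?F -` ?A) \<ge> 1 - 1 / real n ^ c"
      by (rule prob_ge_1_minus) (use True correct(1,3) in \<open>auto simp: accepting_def\<close>)
  next
    \<comment> \<open>Without a solution every tape leads to rejection, so the failure event is
      empty.\<close>
    case False
    have "measure_pmf.prob ?\<Omega> {} \<le> 1 / real n ^ c" by simp
    then show "measure_pmf.prob ?\<Omega> (?F -` ?A) \<ge> 1 - 1 / real n ^ c"
      by (rule prob_ge_1_minus) (use False yes correct(1,2) in \<open>auto simp: rejecting_def\<close>)
  qed
qed

end

theorem theorem2:
  fixes b c :: nat
  shows "\<exists>K0. \<forall>K \<ge> K0. \<exists>(P :: instr list) (C :: nat).
    \<forall>(G :: nat pair_pre_digraph) es wt s1 t1 s2 t2.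
      dag_instance_2dsp b G es wt s1 t1 s2 t2 \<longrightarrow>
      (let n = card (pverts G);
           m = card (parcs G);
           w = K * floorlog 2 n;
           D = run w P (C * (m + n)) (initial w (encode_2dsp n es wt s1 t1 s2 t2));
           yes = wf_digraph.disjoint_shortest_paths (with_proj G) (\<lambda>e. real (wt e)) [s1, s2] [t1, t2]
       in (\<forall>x \<in> set_pmf D. halted P x) \<and>
          measure_pmf.prob D {x. if yes then accepting P x else rejecting P x}
            \<ge> 1 - 1 / real n ^ c)"
proof (intro exI allI impI)
  \<comment> \<open>The witnesses stay schematic until they are read off below: \<open>K0\<close> is
    \<open>18 * (c + 2) + b + 20\<close>, \<open>P\<close> is \<open>program c\<close> and
    \<open>C\<close> is \<open>step_bound c\<close>. The last two depend only on
    \<open>c\<close>.\<close>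
  fix K G es wt s1 t1 s2 t2
  assume "18 * (c + 2) + b + 20 \<le> K" "dag_instance_2dsp b G es wt s1 t1 s2 t2"
  then interpret run_instance b c K G es wt s1 t1 s2 t2 by unfold_locales
  show "let n = card (pverts G);
           m = card (parcs G);
           w = K * floorlog 2 n;
           D = run w (program c) (step_bound c * (m + n)) (initial w (encode_2dsp n es wt s1 t1 s2 t2));
           yes = wf_digraph.disjoint_shortest_paths (with_proj G) (\<lambda>e. real (wt e)) [s1, s2] [t1, t2]
       in (\<forall>x \<in> set_pmf D. halted (program c) x) \<and>
          measure_pmf.prob D {x. if yes then accepting (program c) x else rejecting (program c) x}
            \<ge> 1 - 1 / real n ^ c"
    using decides unfolding Let_def n_def m_def w_def l_def xs_def by (intro conjI)
qed

end
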